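(* Let $d\rho = f(x)\, dx +d\rho_s$ be a probability measure on the real line with infinite support and finite moments ($d\rho_s$ being its singular part) and let $\{a_n, b_n\}_{n=1}^\infty$ be its Jacobi coefficients. Let $p$ be a positive integer, $A\subset \mathbb{R}$ a finite set of phases, and make one of these sets of assumptions: 1° $\{a_n^2-1\}_{n=1}^\infty,\ \{b_n\}_{n=1}^\infty \in \ell^p \cap GBV(A)$; 2° $\{a_n-1\}_{n=1}^\infty,\ \{b_n\}_{n=1}^\infty \in \ell^p \cap GBV(A)$. Denote $\tilde A = A \cup \{0\}$ in case 1° and $\tilde A = (A+A)\cup A \cup \{ 0\}$ in case 2°, and let $$S = \bigl\{ 2 \cos(\eta/2) \;\big|\; \eta \in \underbrace{\tilde A+\dots+\tilde A}_{p-1\text{ times}} \bigr\}.$$ Then (i) $\operatorname{supp} \rho_s \cap (-2,2) \subset S$ and, in particular, $d\rho$ has no singular continuous part; (ii) $f(x)$ is continuous and strictly positive on $(-2,2) \setminus S$.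
   Context: Jacobi coefficients: the orthonormal polynomials $p_n(x)$ of $\rho$ ($\deg p_n=n$, positive leading coefficients, $\int p_mp_n\,d\rho=\delta_{mn}$, $p_{-1}=0$) satisfy $x p_n(x)=a_{n+1}p_{n+1}(x)+b_{n+1}p_n(x)+a_np_{n-1}(x)$ with $a_n>0$, $b_n\in\mathbb{R}$; these are the Jacobi coefficients. Generalized bounded variation: a complex sequence $\{\beta_n\}_{n=N}^\infty$ has rotated bounded variation with phase $\phi\in\mathbb{R}$ if $\sum_{n=N}^\infty|e^{i\phi}\beta_{n+1}-\beta_n|<\infty$. For a finite set $A=\{\phi_1,\dots,\phi_L\}\subset\mathbb{R}$, $GBV(A)$ is the set of sequences $\{\alpha_n\}_{n=N}^\infty$ that can be written as $\alpha_n=\sum_{l=1}^L\beta_n^{(l)}$ where $\beta^{(l)}$ has rotated bounded variation with phase $\phi_l$. Conventions: $\tilde A+\dots+\tilde A$ ($k$ times) is the set of all sums of $k$ elements of $\tilde A$ (for $k=0$, the empty sum, read as $\{0\}$). The density $f$ is defined up to almost everywhere equality; "continuous and strictly positive" means that it has a representative with this property on the given set.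
   Formalization: In S the sums η are taken modulo 2π, so S becomes S ∪ (−S); as printed the claim fails, e.g. p=2, A={±2π/3}, a_n=1 and a suitable b_n give an eigenvalue at −1 while S={1,2}. *)

theory Defs
  imports "HOL-Probability.Probability" "HOL-Library.Set_Algebras"
    "HOL-Computational_Algebra.Polynomial"
begin

definition measure_support :: "'a::topological_space measure \<Rightarrow> 'a set" where
  "measure_support M = {x. \<forall>U. open U \<and> x \<in> U \<longrightarrow> emeasure M U \<noteq> 0}"

definition lebesgue_decomposition ::
    "real measure \<Rightarrow> (real \<Rightarrow> real) \<Rightarrow> real measure \<Rightarrow> bool" where
  "lebesgue_decomposition M f Ms \<longleftrightarrow>
     f \<in> borel_measurable borel \<and> (AE x in lborel. 0 \<le> f x) \<and>
     sets Ms = sets borel \<and> (\<exists>N \<in> null_sets lborel. emeasure Ms (UNIV - N) = 0) \<and>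
     (\<forall>B \<in> sets borel.
        emeasure M B = emeasure (density lborel (\<lambda>x. ennreal (f x))) B + emeasure Ms B)"

text \<open>The part of a measure that remains once all its atoms are removed. Applied to the
  singular part of a measure it is the singular continuous part.\<close>
definition continuous_part :: "real measure \<Rightarrow> real measure" where
  "continuous_part M = density M (indicator {x. emeasure M {x} = 0})"

definition orthonormal_polynomials :: "real measure \<Rightarrow> (nat \<Rightarrow> real poly) \<Rightarrow> bool" where
  "orthonormal_polynomials M P \<longleftrightarrow>
     (\<forall>n. degree (P n) = n \<and> lead_coeff (P n) > 0) \<and>
     (\<forall>m n. (LINT x|M. poly (P m) x * poly (P n) x) = (if m = n then 1 else 0))"

text \<open>The coefficients are indexed from 1; the values at index 0 are irrelevant. The case
  distinction encodes the convention that the polynomial of index \<open>-1\<close> is zero.\<close>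
definition jacobi_coefficients ::
    "real measure \<Rightarrow> (nat \<Rightarrow> real) \<Rightarrow> (nat \<Rightarrow> real) \<Rightarrow> bool" where
  "jacobi_coefficients M a b \<longleftrightarrow>
     (\<forall>n\<ge>1. a n > 0) \<and>
     (\<exists>P. orthonormal_polynomials M P \<and>
        (\<forall>n. [:0, 1:] * P n =
           smult (a (n + 1)) (P (n + 1)) + smult (b (n + 1)) (P n) +
           (if n = 0 then 0 else smult (a n) (P (n - 1)))))"

text \<open>Sequences indexed by \<open>n \<ge> N\<close> are functions on \<^typ>\<open>nat\<close> whose values below \<open>N\<close> are
  ignored.\<close>
definition rotated_bounded_variation :: "nat \<Rightarrow> real \<Rightarrow> (nat \<Rightarrow> complex) \<Rightarrow> bool" where
  "rotated_bounded_variation N \<phi> \<beta> \<longleftrightarrow>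
     summable (\<lambda>k. norm (exp (\<i> * of_real \<phi>) * \<beta> (N + k + 1) - \<beta> (N + k)))"

definition GBV :: "nat \<Rightarrow> real set \<Rightarrow> (nat \<Rightarrow> complex) set" where
  "GBV N A = {\<alpha>. \<exists>\<beta> :: real \<Rightarrow> nat \<Rightarrow> complex.
     (\<forall>\<phi>\<in>A. rotated_bounded_variation N \<phi> (\<beta> \<phi>)) \<and>
     (\<forall>n\<ge>N. \<alpha> n = (\<Sum>\<phi>\<in>A. \<beta> \<phi> n))}"

definition lp_seq :: "nat \<Rightarrow> nat \<Rightarrow> (nat \<Rightarrow> complex) set" where
  "lp_seq N p = {\<alpha>. summable (\<lambda>k. norm (\<alpha> (N + k)) ^ p)}"

text \<open>The sum is the iterated Minkowski sum of \<open>k\<close> copies of \<open>B\<close>, which is \<open>{0}\<close> for \<open>k = 0\<close>.\<close>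
definition sumset_power :: "nat \<Rightarrow> real set \<Rightarrow> real set" where
  "sumset_power k B = (\<Sum>i<k. B)"

text \<open>Phases are angles: \<^const>\<open>GBV\<close> depends on its phases modulo \<open>2 * pi\<close> only, whereas
  \<open>2 * cos (\<eta> / 2)\<close> changes sign when \<open>\<eta>\<close> is replaced by \<open>\<eta> + 2 * pi\<close>. The sums of phases are
  therefore taken modulo \<open>2 * pi\<close>, so that both signs occur. Without this the set would depend
  on the choice of representatives, and Wigner-von Neumann type coefficients, which resonate at
  both points, would have embedded eigenvalues outside of it.\<close>
definition exceptional_set :: "nat \<Rightarrow> real set \<Rightarrow> real set" where
  "exceptional_set k B =
     {2 * cos (\<eta> / 2) | \<eta>. \<exists>\<sigma> \<in> sumset_power k B. \<exists>m::int. \<eta> = \<sigma> + 2 * pi * of_int m}"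

end

theory Submission imports Defs begin

text \<open>
  For \<open>x\<close> in \<open>(-2,2)\<close> write \<open>x = z + 1/z\<close> with \<open>z\<close> on the upper unit semicircle and put
  \<open>\<psi>\<^sub>n = a\<^sub>n p\<^sub>n - cnj z p\<^sub>n\<^sub>-\<^sub>1\<close>. The three-term recurrence becomes
  \<open>a\<^sub>n \<psi>\<^sub>n\<^sub>+\<^sub>1 = (z + A\<^sub>n) \<psi>\<^sub>n + B\<^sub>n cnj \<psi>\<^sub>n\<close>, where \<open>A\<^sub>n\<close> and \<open>B\<^sub>n\<close> are linear in
  \<open>a\<^sub>n\<^sup>2 - 1\<close> and \<open>b\<^sub>n\<^sub>+\<^sub>1\<close> and satisfy \<open>\<bar>z + A\<^sub>n\<bar>\<^sup>2 - \<bar>B\<^sub>n\<bar>\<^sup>2 = a\<^sub>n\<^sup>2\<close>. The proof has two halves.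

  The first half (\<open>amplitude_converges_uniformly\<close>) shows that \<open>\<bar>\<psi>\<^sub>n\<bar>\<^sup>2\<close> converges, uniformly on
  compact subsets of \<open>(-2,2) - S\<close>, to a positive limit \<open>T\<close>. One looks for small \<open>C\<^sub>n(x)\<close> such that
  \<open>\<phi>\<^sub>n = \<psi>\<^sub>n + C\<^sub>n cnj \<psi>\<^sub>n\<close> satisfies \<open>\<phi>\<^sub>n\<^sub>+\<^sub>1 = D\<^sub>n \<phi>\<^sub>n + E\<^sub>n cnj \<phi>\<^sub>n\<close> with summable \<open>E\<^sub>n\<close>. The
  condition on \<open>C\<close> is a discrete Riccati equation. It is solved order by order in the coefficients
  (\<open>riccati_approximate_solution\<close>): the phase factor of a term of order \<open>m\<close> is a product \<open>v\<close> of
  \<open>m\<close> of the given ones, and the term can be removed by solving a linear first-order equation whose divisor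
  \<open>z - cnj z * cnj v\<close> vanishes only at resonances \<open>z\<^sup>2 = cnj v\<close>. Terms of order \<open>p\<close> are summable because
  the coefficients lie in \<open>\<ell>\<^sup>p\<close>, so only sums of at most \<open>p - 1\<close> phases enter; they make up \<open>S\<close>.
  Once the off-diagonal entry is summable, the determinant relation fixes \<open>\<bar>D\<^sub>n\<bar>\<close>, and therefore
  the growth of \<open>\<bar>\<phi>\<^sub>n\<bar>\<close>, up to a summable error. The non-oscillating terms, which cannot be
  summed, thus only influence the argument of \<open>\<phi>\<^sub>n\<close> (\<open>amplitude_converges\<close>).

  The second half identifies \<open>\<rho>\<close>. Since \<open>a\<^sub>n\<close> tends to 1 and \<open>b\<^sub>n\<close> to 0, the integrals of
  \<open>x\<^sup>k p\<^sub>n\<^sub>+\<^sub>i p\<^sub>n\<^sub>+\<^sub>j\<close> tend to those of the free Jacobi matrix, whence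
  \<open>\<integral> h \<bar>\<psi>\<^sub>n\<bar>\<^sup>2 d\<rho>\<close> tends to \<open>\<integral> h sqrt (4 - x\<^sup>2) dx / (2 * pi)\<close> for every continuous \<open>h\<close>
  (\<open>amplitude_tendsto_semicircle\<close>). Together with the first half this gives
  \<open>T d\<rho> = sqrt (4 - x\<^sup>2) dx / (2 * pi)\<close> on \<open>(-2,2) - S\<close> (\<open>density_on_open\<close>): there the singular part
  vanishes and the density is continuous and positive. The set \<open>S\<close> is finite, and outside
  \<open>[-2,2]\<close> every point without mass has a null neighbourhood, because the Jacobi matrix
  is bounded by \<open>2 + \<epsilon>\<close> on the orthogonal complement of finitely many \<open>p\<^sub>n\<close>
  (\<open>no_continuous_mass_outside\<close>). Hence the singular part has no continuous component.
\<close>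

section \<open>Sequences of rotated bounded variation\<close>

text \<open>A phase \<open>\<phi>\<close> enters only through \<open>u = exp (\<i> \<phi>)\<close>. Working with \<open>u\<close> makes phases that agree
  modulo \<open>2 * pi\<close> equal, and sums of phases become products.\<close>
definition rbv :: "complex \<Rightarrow> (nat \<Rightarrow> complex) \<Rightarrow> bool" where
  "rbv u \<beta> \<longleftrightarrow> summable (\<lambda>n. cmod (u * \<beta> (Suc n) - \<beta> n))"

lemma summable_power_add:
  fixes f g :: "nat \<Rightarrow> 'a::real_normed_vector"
  assumes "summable (\<lambda>n. norm (f n) ^ q)" "summable (\<lambda>n. norm (g n) ^ q)"
  shows "summable (\<lambda>n. norm (f n + g n) ^ q)"
proof (rule summable_comparison_test)
  show "summable (\<lambda>n. 2 ^ q * (norm (f n) ^ q + norm (g n) ^ q))"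
    using assms by (intro summable_mult summable_add)
  show "\<exists>N. \<forall>n\<ge>N. norm (norm (f n + g n) ^ q) \<le> 2 ^ q * (norm (f n) ^ q + norm (g n) ^ q)"
  proof (intro exI allI impI)
    fix n
    let ?m = "max (norm (f n)) (norm (g n))"
    have "norm (f n + g n) \<le> 2 * ?m"
      using norm_triangle_ineq[of "f n" "g n"] by linarith
    then have "norm (f n + g n) ^ q \<le> (2 * ?m) ^ q"
      by (intro power_mono) auto
    also have "\<dots> = 2 ^ q * ?m ^ q" by (simp add: power_mult_distrib)
    also have "\<dots> \<le> 2 ^ q * (norm (f n) ^ q + norm (g n) ^ q)"
      by (intro mult_left_mono) (auto simp: max_def)
    finally show "norm (norm (f n + g n) ^ q) \<le> 2 ^ q * (norm (f n) ^ q + norm (g n) ^ q)"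
      by simp
  qed
qed

lemma summable_power_cmult:
  fixes f :: "nat \<Rightarrow> complex"
  assumes "summable (\<lambda>n. cmod (f n) ^ q)"
  shows "summable (\<lambda>n. cmod (c * f n) ^ q)"
  using summable_mult[OF assms, of "cmod c ^ q"] by (simp add: norm_mult power_mult_distrib)

lemma summable_power_diff:
  fixes f g :: "nat \<Rightarrow> complex"
  assumes "summable (\<lambda>n. cmod (f n) ^ q)" "summable (\<lambda>n. cmod (g n) ^ q)"
  shows "summable (\<lambda>n. cmod (f n - g n) ^ q)"
  using summable_power_add[OF assms(1), of "\<lambda>n. - g n"] assms(2) by simp

lemma summable_power_sum:
  fixes f :: "'i \<Rightarrow> nat \<Rightarrow> 'a::real_normed_vector"
  assumes "finite W" "\<And>w. w \<in> W \<Longrightarrow> summable (\<lambda>n. norm (f w n) ^ q)" "q \<ge> 1"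
  shows "summable (\<lambda>n. norm (\<Sum>w\<in>W. f w n) ^ q)"
  using assms
proof (induction W rule: finite_induct)
  case empty
  then show ?case by (cases q) auto
next
  case (insert v W)
  then show ?case using summable_power_add[of "f v" q "\<lambda>n. \<Sum>w\<in>W. f w n"] by simp
qed

lemma summable_imp_summable_power:
  fixes f :: "nat \<Rightarrow> real"
  assumes "summable f" "\<And>n. f n \<ge> 0" "q \<ge> 1"
  shows "summable (\<lambda>n. f n ^ q)"
proof (rule summable_comparison_test_ev[OF _ assms(1)])
  have "f \<longlonglongrightarrow> 0" by (rule summable_LIMSEQ_zero[OF assms(1)])
  then have "\<forall>\<^sub>F n in sequentially. f n < 1" by (rule order_tendstoD) simp
  then show "\<forall>\<^sub>F n in sequentially. norm (f n ^ q) \<le> f n"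
  proof eventually_elim
    case (elim n)
    have "f n ^ q \<le> f n ^ 1" using elim assms by (intro power_decreasing) auto
    then show ?case using assms(2)[of n] by simp
  qed
qed

text \<open>Components with different phases cannot compensate each other. Applying \<open>\<beta> \<mapsto> v * \<beta> (Suc n) - \<beta> n\<close>
  to the sum removes the component of phase \<open>v\<close> up to a summable error and multiplies each other
  component by a nonzero constant \<open>v * cnj w - 1\<close>, so that induction on the number of phases applies.\<close>
lemma rbv_independence:
  assumes "finite W" "\<And>w. w \<in> W \<Longrightarrow> cmod w = 1" "\<And>w. w \<in> W \<Longrightarrow> rbv w (\<delta> w)" "q \<ge> 1"
    and "summable (\<lambda>n. cmod (\<Sum>w\<in>W. \<delta> w n) ^ q)" "w \<in> W"
  shows "summable (\<lambda>n. cmod (\<delta> w n) ^ q)"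
  using assms(1,2,3,5,6)
proof (induction W arbitrary: \<delta> w rule: finite_induct)
  case empty
  then show ?case by simp
next
  case (insert v W)
  let ?\<sigma> = "\<lambda>n. \<Sum>w\<in>insert v W. \<delta> w n"
  let ?r = "\<lambda>w n. w * \<delta> w (Suc n) - \<delta> w n"
  have unit: "cnj u * u = 1" if "u \<in> insert v W" for u
    using insert.prems(1)[OF that] complex_norm_square[of u] by (simp add: mult.commute)
  have r: "summable (\<lambda>n. cmod (c * ?r u n) ^ q)" if "u \<in> insert v W" for u c
    using summable_imp_summable_power[OF _ _ assms(4)] insert.prems(2)[OF that]
    by (intro summable_power_cmult) (auto simp: rbv_def)
  have s1: "summable (\<lambda>n. cmod (v * ?\<sigma> (Suc n) - ?\<sigma> n) ^ q)"
  proof -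
    have "summable (\<lambda>n. cmod (?\<sigma> (Suc n)) ^ q)"
      using insert.prems(3) summable_Suc_iff[of "\<lambda>n. cmod (?\<sigma> n) ^ q"] by simp
    then show ?thesis
      using summable_power_diff[OF summable_power_cmult[of "\<lambda>n. ?\<sigma> (Suc n)" q v] insert.prems(3)]
      by simp
  qed
  have eq: "(\<Sum>w\<in>W. (v * cnj w - 1) * \<delta> w n) =
      (v * ?\<sigma> (Suc n) - ?\<sigma> n) - (\<Sum>w\<in>insert v W. v * cnj w * ?r w n)" for n
  proof -
    have "v * ?\<sigma> (Suc n) - ?\<sigma> n = (\<Sum>w\<in>insert v W. v * \<delta> w (Suc n) - \<delta> w n)"
      by (simp only: sum_distrib_left sum_subtractf)
    also have "\<dots> = (\<Sum>w\<in>insert v W. (v * cnj w - 1) * \<delta> w n + v * cnj w * ?r w n)"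
    proof (rule sum.cong[OF refl])
      fix w assume "w \<in> insert v W"
      then have "cnj w * w = 1" by (rule unit)
      then have "v * cnj w * (w * \<delta> w (Suc n)) = v * \<delta> w (Suc n)"
        by (metis mult.assoc mult.right_neutral)
      then show "v * \<delta> w (Suc n) - \<delta> w n = (v * cnj w - 1) * \<delta> w n + v * cnj w * ?r w n"
        by (simp add: algebra_simps)
    qed
    also have "\<dots> = (\<Sum>w\<in>insert v W. (v * cnj w - 1) * \<delta> w n) + (\<Sum>w\<in>insert v W. v * cnj w * ?r w n)"
      by (simp only: sum.distrib)
    also have "(\<Sum>w\<in>insert v W. (v * cnj w - 1) * \<delta> w n) = (\<Sum>w\<in>W. (v * cnj w - 1) * \<delta> w n)"
      using insert.hyps unit[of v] by (simp add: mult.commute)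
    finally show ?thesis by simp
  qed
  have "summable (\<lambda>n. cmod (\<Sum>w\<in>insert v W. v * cnj w * ?r w n) ^ q)"
    using insert.hyps r by (intro summable_power_sum[OF _ _ assms(4)]) auto
  then have s2: "summable (\<lambda>n. cmod (\<Sum>w\<in>W. (v * cnj w - 1) * \<delta> w n) ^ q)"
    unfolding eq using s1 by (rule summable_power_diff[rotated])
  have rest: "summable (\<lambda>n. cmod (\<delta> u n) ^ q)" if u: "u \<in> W" for u
  proof -
    have "rbv w (\<lambda>n. (v * cnj w - 1) * \<delta> w n)" if "w \<in> W" for w
    proof -
      have "(\<lambda>n. cmod (w * ((v * cnj w - 1) * \<delta> w (Suc n)) - (v * cnj w - 1) * \<delta> w n))
          = (\<lambda>n. cmod (v * cnj w - 1) * cmod (?r w n))"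
        by (simp add: norm_mult[symmetric] algebra_simps)
      then show ?thesis using insert.prems(2)[of w] that unfolding rbv_def
        by (auto intro: summable_mult)
    qed
    from insert.IH[of "\<lambda>w n. (v * cnj w - 1) * \<delta> w n" u, OF _ this s2 u]
    have "summable (\<lambda>n. cmod ((v * cnj u - 1) * \<delta> u n) ^ q)"
      using insert.prems(1) by auto
    then have "summable (\<lambda>n. cmod (1 / (v * cnj u - 1) * ((v * cnj u - 1) * \<delta> u n)) ^ q)"
      by (rule summable_power_cmult)
    moreover have "v * cnj u - 1 \<noteq> 0"
    proof
      assume "v * cnj u - 1 = 0"
      then have "v * cnj u * u = u" by simp
      then have "v = u" using unit[of u] u by (simp add: mult.assoc)
      then show False using u insert.hyps by simp
    qed
    ultimately show ?thesis by simp
  qed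
  show ?case
  proof (cases "w = v")
    case False
    then show ?thesis using rest insert.prems(4) by simp
  next
    case True
    have "summable (\<lambda>n. cmod (?\<sigma> n - (\<Sum>w\<in>W. \<delta> w n)) ^ q)"
      using insert.hyps rest
      by (intro summable_power_diff insert.prems(3) summable_power_sum[OF _ _ assms(4)])
    then show ?thesis using True insert.hyps by simp
  qed
qed

lemma rbv_cnj: "rbv u \<beta> \<Longrightarrow> rbv (cnj u) (\<lambda>n. cnj (\<beta> n))"
proof -
  have "cmod (cnj u * cnj (\<beta> (Suc n)) - cnj (\<beta> n)) = cmod (u * \<beta> (Suc n) - \<beta> n)" for n
    using complex_mod_cnj[of "u * \<beta> (Suc n) - \<beta> n"] by simp
  then show "rbv u \<beta> \<Longrightarrow> rbv (cnj u) (\<lambda>n. cnj (\<beta> n))" by (simp add: rbv_def)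
qed

lemma rbv_diff:
  assumes "rbv u f" "rbv u g" shows "rbv u (\<lambda>n. f n - g n)"
proof -
  have "summable (\<lambda>n. cmod (u * f (Suc n) - f n) + cmod (u * g (Suc n) - g n))"
    using assms by (simp add: rbv_def summable_add)
  then show ?thesis unfolding rbv_def
  proof (rule summable_comparison_test[rotated], intro exI allI impI)
    fix n
    have "u * (f (Suc n) - g (Suc n)) - (f n - g n) = (u * f (Suc n) - f n) - (u * g (Suc n) - g n)"
      by (simp add: algebra_simps)
    then show "norm (cmod (u * (f (Suc n) - g (Suc n)) - (f n - g n)))
        \<le> cmod (u * f (Suc n) - f n) + cmod (u * g (Suc n) - g n)"
      using norm_triangle_ineq4 by (metis norm_ge_zero real_norm_def abs_of_nonneg)
  qed
qed

lemma rbv_zero [simp]: "rbv u (\<lambda>n. 0)" by (simp add: rbv_def)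

text \<open>Conjugating a component of phase \<open>u\<close> yields one of phase \<open>cnj u\<close>. A real sequence equals its
  conjugate, so by independence a component whose conjugate phase is not available is summable.
  This keeps the set of phases closed under conjugation without enlarging it, although the Riccati
  equation below involves the conjugates of the coefficients.\<close>
lemma real_sequence_symmetric_phases:
  fixes \<sigma> :: "nat \<Rightarrow> real"
  assumes U: "finite U" "\<And>u. u \<in> U \<Longrightarrow> cmod u = 1"
    and rbv: "\<And>u. u \<in> U \<Longrightarrow> rbv u (\<beta> u)"
    and \<sigma>: "\<And>n. complex_of_real (\<sigma> n) = (\<Sum>u\<in>U. \<beta> u n)"
  shows "summable (\<lambda>n. cmod (complex_of_real (\<sigma> n) - (\<Sum>u | u \<in> U \<and> cnj u \<in> U. \<beta> u n)))"
proof -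
  define W where "W = U \<union> cnj ` U"
  define \<delta> where "\<delta> = (\<lambda>w n. (if w \<in> U then \<beta> w n else 0) - (if cnj w \<in> U then cnj (\<beta> (cnj w) n) else 0))"
  have W: "finite W" "\<And>w. w \<in> W \<Longrightarrow> cmod w = 1" using U by (auto simp: W_def)
  have \<delta>: "rbv w (\<delta> w)" for w
  proof -
    have "rbv w (\<lambda>n. if w \<in> U then \<beta> w n else 0)" using rbv by (cases "w \<in> U") auto
    moreover have "rbv w (\<lambda>n. if cnj w \<in> U then cnj (\<beta> (cnj w) n) else 0)"
      using rbv_cnj[OF rbv, of "cnj w"] by (cases "cnj w \<in> U") auto
    ultimately show ?thesis unfolding \<delta>_def by (rule rbv_diff)
  qed
  have "(\<Sum>w\<in>W. \<delta> w n) = 0" for n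
  proof -
    have "(\<Sum>w\<in>W. if w \<in> U then \<beta> w n else 0) = (\<Sum>u\<in>U. \<beta> u n)"
      using W(1) U(1) by (simp add: W_def sum.inter_restrict[symmetric] Int_absorb1)
    moreover have "(\<Sum>w\<in>W. if cnj w \<in> U then cnj (\<beta> (cnj w) n) else 0) = cnj (\<Sum>u\<in>U. \<beta> u n)"
    proof -
      have "{w\<in>W. cnj w \<in> U} = cnj ` U" unfolding W_def by force
      then have "(\<Sum>w\<in>W. if cnj w \<in> U then cnj (\<beta> (cnj w) n) else 0)
          = (\<Sum>w\<in>cnj ` U. cnj (\<beta> (cnj w) n))"
        using W(1) by (simp add: sum.inter_filter[symmetric])
      also have "\<dots> = cnj (\<Sum>u\<in>U. \<beta> u n)"
        by (subst sum.reindex) (auto simp: inj_on_def)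
      finally show ?thesis .
    qed
    ultimately show ?thesis by (simp add: \<delta>_def sum_subtractf \<sigma>[symmetric])
  qed
  then have "summable (\<lambda>n. cmod (\<delta> w n) ^ 1)" if "w \<in> W" for w
    using that by (intro rbv_independence[OF W \<delta>]) auto
  then have "summable (\<lambda>n. cmod (\<beta> u n))" if "u \<in> U" "cnj u \<notin> U" for u
    using that by (force simp: \<delta>_def W_def)
  then have *: "summable (\<lambda>n. cmod (\<Sum>u | u \<in> U \<and> cnj u \<notin> U. \<beta> u n) ^ 1)"
    using U(1) by (intro summable_power_sum) auto
  have "complex_of_real (\<sigma> n) - (\<Sum>u | u \<in> U \<and> cnj u \<in> U. \<beta> u n)
      = (\<Sum>u | u \<in> U \<and> cnj u \<notin> U. \<beta> u n)" for n
  proof -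
    have "(\<Sum>u\<in>U. \<beta> u n) = (\<Sum>u | u \<in> U \<and> cnj u \<in> U. \<beta> u n) + (\<Sum>u | u \<in> U \<and> cnj u \<notin> U. \<beta> u n)"
      using U(1) by (subst sum.union_disjoint[symmetric]) (auto intro: sum.cong)
    then show ?thesis by (simp add: \<sigma>)
  qed
  then show ?thesis using * by simp
qed

lemma rbv_bounded:
  assumes "rbv u f" "cmod u = 1"
  shows "\<exists>M. \<forall>n. cmod (f n) \<le> M"
proof -
  define r where "r = (\<lambda>n. cmod (u * f (Suc n) - f n))"
  have r: "summable r" using assms(1) by (simp add: rbv_def r_def)
  have "cmod (f n) \<le> cmod (f 0) + sum r {..<n}" for n
  proof (induction n)
    case (Suc n)
    have "cmod (f (Suc n)) = cmod (u * f (Suc n))" by (simp add: norm_mult assms(2))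
    also have "\<dots> \<le> cmod (f n) + r n"
      using norm_triangle_ineq[of "f n" "u * f (Suc n) - f n"] by (simp add: r_def)
    finally show ?case using Suc by simp
  qed simp
  moreover have "sum r {..<n} \<le> suminf r" for n
    by (rule sum_le_suminf[OF r]) (auto simp: r_def)
  ultimately have "cmod (f n) \<le> cmod (f 0) + suminf r" for n
    using add_left_mono order_trans by blast
  then show ?thesis by blast
qed

lemma rbv_mult:
  assumes "rbv u f" "cmod u = 1" "rbv v g" "cmod v = 1"
  shows "rbv (u * v) (\<lambda>n. f n * g n)"
proof -
  obtain M where M: "\<And>n. cmod (f n) \<le> M" using rbv_bounded[OF assms(1,2)] by blast
  obtain N where N: "\<And>n. cmod (g n) \<le> N" using rbv_bounded[OF assms(3,4)] by blast
  have M0: "0 \<le> M" using M[of 0] norm_ge_zero order_trans by blast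
  let ?r = "\<lambda>n. cmod (u * f (Suc n) - f n)" and ?s = "\<lambda>n. cmod (v * g (Suc n) - g n)"
  have "summable (\<lambda>n. ?r n * N + M * ?s n)"
    using assms unfolding rbv_def by (intro summable_add summable_mult summable_mult2)
  then show ?thesis unfolding rbv_def
  proof (rule summable_comparison_test[rotated], intro exI allI impI)
    fix n
    have "u * v * (f (Suc n) * g (Suc n)) - f n * g n
        = (u * f (Suc n) - f n) * (v * g (Suc n)) + f n * (v * g (Suc n) - g n)"
      by (simp add: algebra_simps)
    then have "cmod (u * v * (f (Suc n) * g (Suc n)) - f n * g n)
        \<le> ?r n * cmod (g (Suc n)) + cmod (f n) * ?s n"
      using norm_triangle_ineq by (metis norm_mult assms(4) mult_1)
    also have "\<dots> \<le> ?r n * N + M * ?s n"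
      using M N M0 by (intro add_mono mult_mono) auto
    finally show "norm (cmod (u * v * (f (Suc n) * g (Suc n)) - f n * g n)) \<le> ?r n * N + M * ?s n"
      by simp
  qed
qed

lemma rbv_sum:
  assumes "finite I" "\<And>i. i \<in> I \<Longrightarrow> rbv u (f i)"
  shows "rbv u (\<lambda>n. \<Sum>i\<in>I. f i n)"
  using assms
proof (induction I rule: finite_induct)
  case (insert i I)
  have "rbv u (\<lambda>n. f i n - (0 - (\<Sum>i\<in>I. f i n)))"
    using insert by (intro rbv_diff rbv_zero) auto
  then show ?case using insert.hyps by simp
qed simp

text \<open>The analogue of \<^const>\<open>GBV\<close> for phase factors on the unit circle, starting at index 0.\<close>
definition gbv_unit :: "complex set \<Rightarrow> (nat \<Rightarrow> complex) \<Rightarrow> bool" where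
  "gbv_unit U s \<longleftrightarrow> (\<exists>\<beta>. (\<forall>u\<in>U. rbv u (\<beta> u)) \<and> (\<forall>n. s n = (\<Sum>u\<in>U. \<beta> u n)))"

lemma gbv_unit_single:
  assumes "finite U" "u \<in> U" "rbv u s"
  shows "gbv_unit U s"
  unfolding gbv_unit_def
proof (intro exI conjI ballI allI)
  show "rbv v (\<lambda>n. if v = u then s n else 0)" for v using assms by (cases "v = u") auto
  show "s n = (\<Sum>v\<in>U. if v = u then s n else 0)" for n using assms by simp
qed

lemma gbv_unit_sum:
  assumes "finite I" "\<And>i. i \<in> I \<Longrightarrow> gbv_unit U (s i)"
  shows "gbv_unit U (\<lambda>n. \<Sum>i\<in>I. s i n)"
proof -
  obtain \<beta> where \<beta>: "\<And>i u. i \<in> I \<Longrightarrow> u \<in> U \<Longrightarrow> rbv u (\<beta> i u)"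
    "\<And>i n. i \<in> I \<Longrightarrow> s i n = (\<Sum>u\<in>U. \<beta> i u n)"
    using assms(2) unfolding gbv_unit_def by metis
  show ?thesis unfolding gbv_unit_def
  proof (intro exI conjI ballI allI)
    show "rbv u (\<lambda>n. \<Sum>i\<in>I. \<beta> i u n)" if "u \<in> U" for u using that assms(1) \<beta>(1) by (intro rbv_sum)
    have "(\<Sum>i\<in>I. s i n) = (\<Sum>i\<in>I. \<Sum>u\<in>U. \<beta> i u n)" for n using \<beta>(2) by (intro sum.cong) auto
    also have "\<dots> n = (\<Sum>u\<in>U. \<Sum>i\<in>I. \<beta> i u n)" for n by (rule sum.swap)
    finally show "(\<Sum>i\<in>I. s i n) = (\<Sum>u\<in>U. \<Sum>i\<in>I. \<beta> i u n)" for n .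
  qed
qed

lemma gbv_unit_add:
  assumes "gbv_unit U s" "gbv_unit U t"
  shows "gbv_unit U (\<lambda>n. s n + t n)"
  using gbv_unit_sum[of "UNIV :: bool set" U "\<lambda>i. if i then s else t"] assms
  by (simp add: UNIV_bool add.commute)

lemma rbv_cmult: "rbv u s \<Longrightarrow> rbv u (\<lambda>n. c * s n)"
proof -
  assume "rbv u s"
  then have "summable (\<lambda>n. cmod c * cmod (u * s (Suc n) - s n))" unfolding rbv_def by (rule summable_mult)
  moreover have "cmod c * cmod (u * s (Suc n) - s n) = cmod (u * (c * s (Suc n)) - c * s n)" for n
    by (simp add: norm_mult[symmetric] algebra_simps)
  ultimately show ?thesis by (simp add: rbv_def)
qed

lemma gbv_unit_mono:
  assumes "gbv_unit U s" "finite W" "U \<subseteq> W"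
  shows "gbv_unit W s"
proof -
  obtain \<beta> where \<beta>: "\<And>u. u \<in> U \<Longrightarrow> rbv u (\<beta> u)" "s = (\<lambda>n. \<Sum>u\<in>U. \<beta> u n)"
    using assms(1) unfolding gbv_unit_def by (metis ext)
  show ?thesis unfolding \<beta>(2) using assms \<beta>(1)
    by (intro gbv_unit_sum) (auto intro: finite_subset gbv_unit_single)
qed

lemma gbv_unit_cmult:
  assumes "gbv_unit U s" "finite U"
  shows "gbv_unit U (\<lambda>n. c * s n)"
proof -
  obtain \<beta> where \<beta>: "\<And>u. u \<in> U \<Longrightarrow> rbv u (\<beta> u)" "s = (\<lambda>n. \<Sum>u\<in>U. \<beta> u n)"
    using assms(1) unfolding gbv_unit_def by (metis ext)
  show ?thesis unfolding \<beta>(2) sum_distrib_left using assms \<beta>(1)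
    by (intro gbv_unit_sum) (auto intro: gbv_unit_single rbv_cmult)
qed

lemma gbv_unit_mult:
  assumes "gbv_unit U s" "finite U" "gbv_unit W t" "finite W" "\<And>v. v \<in> U \<union> W \<Longrightarrow> cmod v = 1"
  shows "gbv_unit (U * W) (\<lambda>n. s n * t n)"
proof -
  obtain \<beta> where \<beta>: "\<And>u. u \<in> U \<Longrightarrow> rbv u (\<beta> u)" "s = (\<lambda>n. \<Sum>u\<in>U. \<beta> u n)"
    using assms(1) unfolding gbv_unit_def by (metis ext)
  obtain \<gamma> where \<gamma>: "\<And>w. w \<in> W \<Longrightarrow> rbv w (\<gamma> w)" "t = (\<lambda>n. \<Sum>w\<in>W. \<gamma> w n)"
    using assms(3) unfolding gbv_unit_def by (metis ext)
  have "gbv_unit (U * W) (\<lambda>n. \<beta> u n * \<gamma> w n)" if "u \<in> U" "w \<in> W" for u w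
    using that assms \<beta>(1) \<gamma>(1)
    by (intro gbv_unit_single[of _ "u * w"] rbv_mult finite_set_times set_times_intro) auto
  then show ?thesis unfolding \<beta>(2) \<gamma>(2) sum_product using assms(2,4)
    by (intro gbv_unit_sum) auto
qed

lemma GBV_gbv_unit:
  assumes "s \<in> GBV 1 A" "finite A"
  shows "gbv_unit (cis ` A) (\<lambda>n. s (Suc n))"
proof -
  obtain \<beta> where \<beta>: "\<And>\<phi>. \<phi> \<in> A \<Longrightarrow> rotated_bounded_variation 1 \<phi> (\<beta> \<phi>)"
    "\<And>n. n \<ge> 1 \<Longrightarrow> s n = (\<Sum>\<phi>\<in>A. \<beta> \<phi> n)"
    using assms(1) unfolding GBV_def by blast
  have "rbv (cis \<phi>) (\<lambda>n. \<beta> \<phi> (Suc n))" if "\<phi> \<in> A" for \<phi>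
    using \<beta>(1)[OF that] unfolding rotated_bounded_variation_def rbv_def by (simp add: cis_conv_exp)
  then have "gbv_unit (cis ` A) (\<lambda>n. \<Sum>\<phi>\<in>A. \<beta> \<phi> (Suc n))"
    using assms(2) by (intro gbv_unit_sum) (auto intro: gbv_unit_single)
  then show ?thesis using \<beta>(2) by simp
qed

lemma summable_power_imp_tendsto_0:
  fixes s :: "nat \<Rightarrow> complex"
  assumes "summable (\<lambda>n. cmod (s n) ^ p)" "p \<ge> 1"
  shows "s \<longlonglongrightarrow> 0"
proof -
  have "(\<lambda>n. root p (cmod (s n) ^ p)) \<longlonglongrightarrow> root p 0"
    by (intro tendsto_real_root summable_LIMSEQ_zero assms)
  then have "(\<lambda>n. cmod (s n)) \<longlonglongrightarrow> 0" using assms(2) by (simp add: real_root_power_cancel)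
  then show ?thesis by (rule tendsto_norm_zero_cancel)
qed

text \<open>The identity \<open>a\<^sup>2 - 1 = (a - 1)\<^sup>2 + 2 (a - 1)\<close> turns the second set of assumptions into the first
  one for the enlarged set of phases; the square accounts for the summand \<open>A + A\<close>.\<close>
lemma coefficients_reduction:
  fixes a b :: "nat \<Rightarrow> real"
  assumes A: "finite A" and p: "p \<ge> 1" and a: "\<forall>n\<ge>1. a n > 0"
    and cases: "((\<lambda>n. complex_of_real ((a n)\<^sup>2 - 1)) \<in> lp_seq 1 p \<inter> GBV 1 A \<and>
          (\<lambda>n. complex_of_real (b n)) \<in> lp_seq 1 p \<inter> GBV 1 A \<and>
          At = A \<union> {0}) \<or>
         ((\<lambda>n. complex_of_real (a n - 1)) \<in> lp_seq 1 p \<inter> GBV 1 A \<and>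
          (\<lambda>n. complex_of_real (b n)) \<in> lp_seq 1 p \<inter> GBV 1 A \<and>
          At = (A + A) \<union> A \<union> {0})"
  shows "finite At" "0 \<in> At" "a \<longlonglongrightarrow> 1" "b \<longlonglongrightarrow> 0"
    "gbv_unit (cis ` At) (\<lambda>n. complex_of_real ((a (Suc n))\<^sup>2 - 1))"
    "gbv_unit (cis ` At) (\<lambda>n. complex_of_real (b (Suc n)))"
    "summable (\<lambda>n. cmod (complex_of_real ((a (Suc n))\<^sup>2 - 1)) ^ p)"
    "summable (\<lambda>n. cmod (complex_of_real (b (Suc n))) ^ p)"
proof -
  let ?s = "\<lambda>n. complex_of_real ((a (Suc n))\<^sup>2 - 1)"
  show fin: "finite At" and "0 \<in> At" using cases A by (auto intro: finite_set_plus)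
  have AAt: "cis ` A \<subseteq> cis ` At" using cases by auto
  have bA: "(\<lambda>n. complex_of_real (b n)) \<in> GBV 1 A" "(\<lambda>n. complex_of_real (b n)) \<in> lp_seq 1 p"
    using cases by auto
  show "gbv_unit (cis ` At) (\<lambda>n. complex_of_real (b (Suc n)))"
    using GBV_gbv_unit[OF bA(1) A] AAt fin by (auto intro: gbv_unit_mono)
  show bp: "summable (\<lambda>n. cmod (complex_of_real (b (Suc n))) ^ p)"
    using bA(2) unfolding lp_seq_def by simp
  have "(\<lambda>n. complex_of_real (b (Suc n))) \<longlonglongrightarrow> of_real 0"
    using summable_power_imp_tendsto_0[OF bp p] by simp
  then show "b \<longlonglongrightarrow> 0" unfolding tendsto_of_real_iff by (rule LIMSEQ_imp_Suc)
  have "a \<longlonglongrightarrow> 1 \<and> gbv_unit (cis ` At) ?s \<and>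
    summable (\<lambda>n. cmod (?s n) ^ p)"
    using cases
  proof (elim disjE conjE)
    assume *: "(\<lambda>n. complex_of_real ((a n)\<^sup>2 - 1)) \<in> lp_seq 1 p \<inter> GBV 1 A"
    then have s: "summable (\<lambda>n. cmod (?s n) ^ p)"
      unfolding lp_seq_def by simp
    have "?s \<longlonglongrightarrow> of_real 0"
      using summable_power_imp_tendsto_0[OF s p] by simp
    then have "(\<lambda>n. (a (Suc n))\<^sup>2 - 1) \<longlonglongrightarrow> 0" unfolding tendsto_of_real_iff .
    then have "(\<lambda>n. sqrt (((a (Suc n))\<^sup>2 - 1) + 1)) \<longlonglongrightarrow> sqrt (0 + 1)" by (intro tendsto_intros)
    then have "(\<lambda>n. a (Suc n)) \<longlonglongrightarrow> 1" using a by (simp add: less_imp_le)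
    then have "a \<longlonglongrightarrow> 1" by (rule LIMSEQ_imp_Suc)
    moreover have "gbv_unit (cis ` At) ?s"
      using GBV_gbv_unit[of "\<lambda>n. complex_of_real ((a n)\<^sup>2 - 1)" A] * A AAt fin by (auto intro: gbv_unit_mono)
    ultimately show ?thesis using s by blast
  next
    assume *: "(\<lambda>n. complex_of_real (a n - 1)) \<in> lp_seq 1 p \<inter> GBV 1 A" and At: "At = (A + A) \<union> A \<union> {0}"
    define t where "t = (\<lambda>n. complex_of_real (a (Suc n) - 1))"
    have s: "summable (\<lambda>n. cmod (t n) ^ p)" using * unfolding lp_seq_def t_def by simp
    have t0: "t \<longlonglongrightarrow> 0" using summable_power_imp_tendsto_0[OF s p] .
    then have "(\<lambda>n. complex_of_real (a (Suc n) - 1)) \<longlonglongrightarrow> of_real 0" by (simp add: t_def)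
    then have "(\<lambda>n. a (Suc n) - 1) \<longlonglongrightarrow> 0" unfolding tendsto_of_real_iff .
    then have "(\<lambda>n. (a (Suc n) - 1) + 1) \<longlonglongrightarrow> 0 + 1" by (intro tendsto_intros)
    then have "(\<lambda>n. a (Suc n)) \<longlonglongrightarrow> 1" by simp
    then have lim: "a \<longlonglongrightarrow> 1" by (rule LIMSEQ_imp_Suc)
    have sq: "?s n = t n * t n + 2 * t n" for n
      by (simp add: t_def power2_eq_square algebra_simps)
    have gt: "gbv_unit (cis ` A) t" using GBV_gbv_unit[of "\<lambda>n. complex_of_real (a n - 1)" A] * A by (simp add: t_def)
    have AA: "cis ` A * cis ` A \<subseteq> cis ` At"
      unfolding At by (auto simp: set_times_def cis_mult intro!: imageI set_plus_intro)
    have fA: "finite (cis ` A)" and nA: "\<And>v. v \<in> cis ` A \<union> cis ` A \<Longrightarrow> cmod v = 1" using A by auto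
    have fAt: "finite (cis ` At)" using fin by simp
    have "gbv_unit (cis ` At) (\<lambda>n. t n * t n)"
      by (rule gbv_unit_mono[OF gbv_unit_mult[OF gt fA gt fA nA] fAt AA])
    moreover have "gbv_unit (cis ` At) (\<lambda>n. 2 * t n)"
      by (rule gbv_unit_mono[OF gbv_unit_cmult[OF gt fA] fAt AAt])
    ultimately have "gbv_unit (cis ` At) ?s"
      unfolding sq by (rule gbv_unit_add)
    moreover have "summable (\<lambda>n. cmod (?s n) ^ p)"
    proof -
      have "Bseq (\<lambda>n. t n + 2)"
        by (rule convergent_imp_Bseq) (use tendsto_add[OF t0 tendsto_const[of 2]] in \<open>auto simp: convergent_def\<close>)
      then obtain M where M: "M > 0" "\<And>n. cmod (t n + 2) \<le> M" unfolding Bseq_def by blast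
      show ?thesis
      proof (rule summable_comparison_test[OF _ summable_mult[OF s, of "M ^ p"]], intro exI allI impI)
        fix n
        have "?s n = (t n + 2) * t n" unfolding sq by (simp add: algebra_simps)
        then have "cmod (?s n) \<le> M * cmod (t n)"
          using M(2)[of n] by (simp add: norm_mult mult_right_mono)
        then have "cmod (?s n) ^ p \<le> (M * cmod (t n)) ^ p"
          by (intro power_mono) auto
        then show "norm (cmod (?s n) ^ p) \<le> M ^ p * cmod (t n) ^ p"
          by (simp add: power_mult_distrib)
      qed
    qed
    ultimately show ?thesis using lim by blast
  qed
  then show "a \<longlonglongrightarrow> 1" "gbv_unit (cis ` At) ?s"
    "summable (\<lambda>n. cmod (?s n) ^ p)" by blast+
qed

lemma symmetric_decomposition:
  fixes s :: "nat \<Rightarrow> real"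
  assumes U: "finite U" "\<And>u. u \<in> U \<Longrightarrow> cmod u = 1" and g: "gbv_unit U (\<lambda>n. complex_of_real (s n))"
    and sp: "summable (\<lambda>n. cmod (complex_of_real (s n)) ^ p)" and p: "p \<ge> 1"
  shows "\<exists>\<beta>. (\<forall>u\<in>{u \<in> U. cnj u \<in> U}. rbv u (\<beta> u) \<and> summable (\<lambda>n. cmod (\<beta> u n) ^ p)) \<and>
    summable (\<lambda>n. cmod (complex_of_real (s n) - (\<Sum>u | u \<in> U \<and> cnj u \<in> U. \<beta> u n)))"
proof -
  obtain \<beta> where \<beta>: "\<And>u. u \<in> U \<Longrightarrow> rbv u (\<beta> u)" "\<And>n. complex_of_real (s n) = (\<Sum>u\<in>U. \<beta> u n)"
    using g unfolding gbv_unit_def by blast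
  have "summable (\<lambda>n. cmod (complex_of_real (s n) - (\<Sum>u | u \<in> U \<and> cnj u \<in> U. \<beta> u n)))"
    by (rule real_sequence_symmetric_phases[OF U \<beta>])
  moreover have "summable (\<lambda>n. cmod (\<beta> u n) ^ p)" if "u \<in> U" for u
    by (rule rbv_independence[OF U \<beta>(1) p _ that]) (use sp \<beta>(2) in auto)
  ultimately show ?thesis using \<beta>(1) by blast
qed

section \<open>A discrete Riccati equation without resonances\<close>

text \<open>The setting of the Riccati equation. The set \<open>X\<close> consists of the spectral parameters, \<open>\<omega>\<close> is a
  common bound for all components of the coefficients, and a quantity of order \<open>m\<close> is bounded by a
  multiple of \<open>\<omega> n ^ m\<close>. The last assumption excludes small divisors up to order \<open>p - 1\<close>.\<close>
locale nonresonant =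
  fixes X :: "'x set" and z :: "'x \<Rightarrow> complex" and U :: "complex set"
    and \<omega> :: "nat \<Rightarrow> real" and p :: nat
  assumes z_unit: "x \<in> X \<Longrightarrow> cmod (z x) = 1"
    and U_unit: "u \<in> U \<Longrightarrow> cmod u = 1"
    and U_cnj: "u \<in> U \<Longrightarrow> cnj u \<in> U"
    and \<omega>_nonneg: "\<omega> n \<ge> 0"
    and \<omega>_summable: "summable (\<lambda>n. \<omega> n ^ p)"
    and p_pos: "p \<ge> 1"
    and nonresonance: "m < p \<Longrightarrow> v \<in> U ^ m \<Longrightarrow> \<exists>d>0. \<forall>x\<in>X. d \<le> cmod (z x - cnj (z x) * v)"
begin

lemma \<omega>_tendsto_0: "\<omega> \<longlonglongrightarrow> 0"
proof -
  have "(\<lambda>n. root p (\<omega> n ^ p)) \<longlonglongrightarrow> root p 0"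
    by (intro tendsto_real_root summable_LIMSEQ_zero \<omega>_summable)
  then show ?thesis using p_pos \<omega>_nonneg by (simp add: real_root_power_cancel)
qed

lemma \<omega>_bounded: "\<exists>W\<ge>0. \<forall>n. \<omega> n \<le> W"
proof -
  have "Bseq \<omega>" by (rule convergent_imp_Bseq) (use \<omega>_tendsto_0 in \<open>auto simp: convergent_def\<close>)
  then obtain W where "W > 0" "\<And>n. norm (\<omega> n) \<le> W" unfolding Bseq_def by blast
  then show ?thesis using \<omega>_nonneg by (intro exI[of _ W]) auto
qed

lemma \<omega>_power_le:
  assumes "k \<le> m"
  shows "\<exists>M\<ge>0. \<forall>n. \<omega> n ^ m \<le> M * \<omega> n ^ k"
proof -
  obtain W where W: "W \<ge> 0" "\<And>n. \<omega> n \<le> W" using \<omega>_bounded by blast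
  have "\<omega> n ^ m \<le> W ^ (m - k) * \<omega> n ^ k" for n
  proof -
    have "\<omega> n ^ m = \<omega> n ^ (m - k) * \<omega> n ^ k" using assms by (simp add: power_add[symmetric])
    also have "\<dots> \<le> W ^ (m - k) * \<omega> n ^ k"
      using W \<omega>_nonneg by (intro mult_right_mono power_mono) auto
    finally show ?thesis .
  qed
  then show ?thesis using W by (intro exI[of _ "W ^ (m - k)"]) auto
qed

lemma U_power_unit: "v \<in> U ^ m \<Longrightarrow> cmod v = 1"
proof (induction m arbitrary: v)
  case 0
  then show ?case by (simp add: set_one)
next
  case (Suc m)
  then show ?case using U_unit by (auto simp: set_times_def norm_mult)
qed

lemma U_power_cnj: "v \<in> U ^ m \<Longrightarrow> cnj v \<in> U ^ m"
proof (induction m arbitrary: v)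
  case 0
  then show ?case by (simp add: set_one)
next
  case (Suc m)
  then obtain u w where "u \<in> U" "w \<in> U ^ m" "v = u * w" by (auto simp: set_times_def)
  then show ?case using U_cnj Suc.IH[of w] by (auto simp: set_times_def)
qed

text \<open>The error terms: summable in the index, uniformly in the spectral parameter.\<close>
definition usummable :: "(nat \<Rightarrow> 'x \<Rightarrow> complex) \<Rightarrow> bool" where
  "usummable g \<longleftrightarrow> (\<exists>\<epsilon>. summable \<epsilon> \<and> (\<forall>n. \<forall>x\<in>X. cmod (g n x) \<le> \<epsilon> n))"

definition ubounded :: "(nat \<Rightarrow> 'x \<Rightarrow> complex) \<Rightarrow> bool" where
  "ubounded g \<longleftrightarrow> (\<exists>M\<ge>0. \<forall>n. \<forall>x\<in>X. cmod (g n x) \<le> M)"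

text \<open>Finite sums of products of a bounded function of the parameter with a rotating sequence of order at
  least \<open>k\<close>, modulo errors that are summable uniformly on \<open>X\<close>. A rotating sequence of order \<open>m\<close> has
  as its phase a product of exactly \<open>m\<close> elements of \<open>U\<close>; this is the bookkeeping that relates orders to
  resonances.\<close>
inductive osc :: "nat \<Rightarrow> (nat \<Rightarrow> 'x \<Rightarrow> complex) \<Rightarrow> bool" for k where
  osc_usummable: "usummable g \<Longrightarrow> osc k g"
| osc_term: "k \<le> m \<Longrightarrow> v \<in> U ^ m \<Longrightarrow> rbv v \<gamma> \<Longrightarrow> K \<ge> 0 \<Longrightarrow> (\<And>n. cmod (\<gamma> n) \<le> K * \<omega> n ^ m) \<Longrightarrow>
    H \<ge> 0 \<Longrightarrow> (\<And>x. x \<in> X \<Longrightarrow> cmod (h x) \<le> H) \<Longrightarrow> osc k (\<lambda>n x. h x * \<gamma> n)"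
| osc_add: "osc k g \<Longrightarrow> osc k g' \<Longrightarrow> osc k (\<lambda>n x. g n x + g' n x)"

lemma usummable_add: "usummable g \<Longrightarrow> usummable g' \<Longrightarrow> usummable (\<lambda>n x. g n x + g' n x)"
  unfolding usummable_def
proof (elim exE conjE)
  fix e e' assume *: "summable e" "summable e'"
    "\<forall>n. \<forall>x\<in>X. cmod (g n x) \<le> e n" "\<forall>n. \<forall>x\<in>X. cmod (g' n x) \<le> e' n"
  show "\<exists>\<epsilon>. summable \<epsilon> \<and> (\<forall>n. \<forall>x\<in>X. cmod (g n x + g' n x) \<le> \<epsilon> n)"
    using * by (intro exI[of _ "\<lambda>n. e n + e' n"])
      (auto intro!: summable_add norm_triangle_le add_mono)
qed

lemma usummable_mult: "usummable g \<Longrightarrow> ubounded g' \<Longrightarrow> usummable (\<lambda>n x. g n x * g' n x)"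
  unfolding usummable_def ubounded_def
proof (elim exE conjE)
  fix e M assume *: "summable e" "0 \<le> M"
    "\<forall>n. \<forall>x\<in>X. cmod (g n x) \<le> e n" "\<forall>n. \<forall>x\<in>X. cmod (g' n x) \<le> M"
  have "cmod (g n x * g' n x) \<le> e n * M" if "x \<in> X" for n x
    unfolding norm_mult using * that by (intro mult_mono) (auto intro: order_trans[OF norm_ge_zero])
  then show "\<exists>\<epsilon>. summable \<epsilon> \<and> (\<forall>n. \<forall>x\<in>X. cmod (g n x * g' n x) \<le> \<epsilon> n)"
    using * by (intro exI[of _ "\<lambda>n. e n * M"]) (auto intro: summable_mult2)
qed

lemma usummable_ubounded: "usummable g \<Longrightarrow> ubounded g"
  unfolding usummable_def ubounded_def
proof (elim exE conjE)
  fix e assume *: "summable e" "\<forall>n. \<forall>x\<in>X. cmod (g n x) \<le> e n"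
  have "Bseq e" by (rule convergent_imp_Bseq)
    (use summable_LIMSEQ_zero[OF *(1)] in \<open>auto simp: convergent_def\<close>)
  then obtain W where "W > 0" "\<And>n. norm (e n) \<le> W" unfolding Bseq_def by blast
  moreover from this have "e n \<le> W" for n using abs_le_D1[of "e n" W] by simp
  ultimately show "\<exists>M\<ge>0. \<forall>n. \<forall>x\<in>X. cmod (g n x) \<le> M" using *(2)
    by (intro exI[of _ W]) (meson less_imp_le order_trans)
qed

lemma ubounded_add: "ubounded g \<Longrightarrow> ubounded g' \<Longrightarrow> ubounded (\<lambda>n x. g n x + g' n x)"
  unfolding ubounded_def
proof (elim exE conjE)
  fix a b assume "0 \<le> a" "0 \<le> b" "\<forall>n. \<forall>x\<in>X. cmod (g n x) \<le> a" "\<forall>n. \<forall>x\<in>X. cmod (g' n x) \<le> b"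
  then show "\<exists>M\<ge>0. \<forall>n. \<forall>x\<in>X. cmod (g n x + g' n x) \<le> M"
    by (intro exI[of _ "a + b"]) (auto intro!: norm_triangle_le add_mono)
qed

lemma usummable_cong: "usummable g \<Longrightarrow> (\<And>n x. x \<in> X \<Longrightarrow> g' n x = g n x) \<Longrightarrow> usummable g'"
  by (simp add: usummable_def)

lemma term_bound:
  assumes "K \<ge> 0" "\<And>n. cmod (\<gamma> n) \<le> K * \<omega> n ^ m" "H \<ge> 0" "\<And>x. x \<in> X \<Longrightarrow> cmod (h x) \<le> H" "x \<in> X"
  shows "cmod (h x * \<gamma> n) \<le> H * K * \<omega> n ^ m"
  unfolding norm_mult mult.assoc using assms by (intro mult_mono) auto

lemma term_ubounded:
  assumes "K \<ge> 0" "\<And>n. cmod (\<gamma> n) \<le> K * \<omega> n ^ m" "H \<ge> 0" "\<And>x. x \<in> X \<Longrightarrow> cmod (h x) \<le> H"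
  shows "ubounded (\<lambda>n x. h x * \<gamma> n)"
proof -
  obtain M where M: "M \<ge> 0" "\<And>n. \<omega> n ^ m \<le> M" using \<omega>_power_le[of 0 m] by auto
  have "cmod (h x * \<gamma> n) \<le> H * K * M" if "x \<in> X" for x n
  proof -
    have "H * K * \<omega> n ^ m \<le> H * K * M" using M assms by (intro mult_left_mono) auto
    then show ?thesis using term_bound[of K \<gamma> m H h x n] assms that by simp
  qed
  then show ?thesis using M assms unfolding ubounded_def by (intro exI[of _ "H * K * M"]) auto
qed

lemma term_usummable:
  assumes "K \<ge> 0" "\<And>n. cmod (\<gamma> n) \<le> K * \<omega> n ^ m" "H \<ge> 0" "\<And>x. x \<in> X \<Longrightarrow> cmod (h x) \<le> H" "p \<le> m"
  shows "usummable (\<lambda>n x. h x * \<gamma> n)"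
proof -
  obtain M where M: "M \<ge> 0" "\<And>n. \<omega> n ^ m \<le> M * \<omega> n ^ p" using \<omega>_power_le[OF assms(5)] by auto
  have "cmod (h x * \<gamma> n) \<le> H * K * (M * \<omega> n ^ p)" if "x \<in> X" for x n
  proof -
    have "H * K * \<omega> n ^ m \<le> H * K * (M * \<omega> n ^ p)" using M assms by (intro mult_left_mono) auto
    then show ?thesis using term_bound[of K \<gamma> m H h x n] assms that by simp
  qed
  then show ?thesis unfolding usummable_def
    by (intro exI[of _ "\<lambda>n. H * K * (M * \<omega> n ^ p)"]) (auto intro!: summable_mult \<omega>_summable)
qed

lemma osc_ubounded: "osc k g \<Longrightarrow> ubounded g"
proof (induction rule: osc.induct)
  case (osc_usummable g) then show ?case by (rule usummable_ubounded)
next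
  case (osc_term m v \<gamma> K H h) then show ?case by (intro term_ubounded)
next
  case (osc_add g g') then show ?case by (intro ubounded_add)
qed

lemma osc_cong:
  assumes "osc k g" "\<And>n x. x \<in> X \<Longrightarrow> g' n x = g n x"
  shows "osc k g'"
proof -
  have "usummable (\<lambda>n x. g' n x - g n x)" using assms(2) unfolding usummable_def
    by (intro exI[of _ "\<lambda>n. 0"]) auto
  from osc_add[OF assms(1) osc_usummable[OF this]] show ?thesis by simp
qed

lemma osc_mono:
  assumes "osc k g" "l \<le> k"
  shows "osc l g"
  using assms(1)
proof (induction rule: osc.induct)
  case (osc_usummable g) then show ?case by (rule osc.osc_usummable)
next
  case (osc_term m v \<gamma> K H h)
  then show ?case using assms(2) by (intro osc.osc_term[of l m v \<gamma> K H h]) auto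
next
  case (osc_add g g') then show ?case by (intro osc.osc_add)
qed

lemma osc_mult:
  assumes "osc k g" "osc l g'"
  shows "osc (k + l) (\<lambda>n x. g n x * g' n x)"
  using assms(1)
proof (induction rule: osc.induct)
  case (osc_usummable g)
  then show ?case by (intro osc.osc_usummable usummable_mult osc_ubounded[OF assms(2)])
next
  case (osc_add g1 g2)
  from osc.osc_add[OF osc_add.IH] show ?case by (simp add: algebra_simps)
next
  case t: (osc_term m v \<gamma> K H h)
  show ?case using assms(2)
  proof (induction rule: osc.induct)
    case (osc_usummable g)
    have "usummable (\<lambda>n x. g n x * (h x * \<gamma> n))"
      using t by (intro usummable_mult osc_usummable term_ubounded)
    then show ?case by (intro osc.osc_usummable) (simp add: mult.commute)
  next
    case (osc_add g1 g2)
    from osc.osc_add[OF osc_add.IH] show ?case by (simp add: algebra_simps)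
  next
    case s: (osc_term m' v' \<gamma>' K' H' h')
    have "osc (k + l) (\<lambda>n x. (h x * h' x) * (\<gamma> n * \<gamma>' n))"
    proof (rule osc.osc_term[of "k + l" "m + m'" "v * v'" _ "K * K'" "H * H'"])
      show "v * v' \<in> U ^ (m + m')" unfolding power_add using t s by (intro set_times_intro)
      show "rbv (v * v') (\<lambda>n. \<gamma> n * \<gamma>' n)" using t s U_power_unit by (intro rbv_mult) auto
      show "cmod (\<gamma> n * \<gamma>' n) \<le> K * K' * \<omega> n ^ (m + m')" for n
      proof -
        have "cmod (\<gamma> n) * cmod (\<gamma>' n) \<le> (K * \<omega> n ^ m) * (K' * \<omega> n ^ m')"
          using t s \<omega>_nonneg by (intro mult_mono) auto
        then show ?thesis by (simp add: norm_mult power_add mult_ac)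
      qed
      show "cmod (h x * h' x) \<le> H * H'" if "x \<in> X" for x
        using t s that by (auto simp: norm_mult intro!: mult_mono)
    qed (use t s in auto)
    then show ?case by (simp add: mult_ac)
  qed
qed

lemma osc_scale:
  assumes "osc k g" "H \<ge> 0" "\<And>x. x \<in> X \<Longrightarrow> cmod (h x) \<le> H"
  shows "osc k (\<lambda>n x. h x * g n x)"
proof -
  have "osc 0 (\<lambda>n x. h x * 1)"
    using assms by (intro osc_term[of 0 0 1 "\<lambda>n. 1" 1 H h]) (auto simp: rbv_def set_one)
  from osc_mult[OF this assms(1)] show ?thesis by simp
qed

lemma osc_uminus: "osc k g \<Longrightarrow> osc k (\<lambda>n x. - g n x)"
  using osc_scale[of k g 1 "\<lambda>x. - 1"] by simp

lemma osc_diff: "osc k g \<Longrightarrow> osc k g' \<Longrightarrow> osc k (\<lambda>n x. g n x - g' n x)"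
  using osc_add[OF _ osc_uminus, of k g g'] by simp

lemma osc_cnj: "osc k g \<Longrightarrow> osc k (\<lambda>n x. cnj (g n x))"
proof (induction rule: osc.induct)
  case (osc_usummable g) then show ?case by (intro osc.osc_usummable) (simp add: usummable_def)
next
  case (osc_term m v \<gamma> K H h)
  then have "osc k (\<lambda>n x. cnj (h x) * cnj (\<gamma> n))"
    by (intro osc.osc_term[of k m "cnj v" _ K H]) (auto intro: rbv_cnj U_power_cnj)
  then show ?case by simp
next
  case (osc_add g g') then show ?case using osc.osc_add by simp
qed

lemma unit_cnj: "cmod u = 1 \<Longrightarrow> u * cnj u = 1"
  using complex_norm_square[of u] by simp

lemma usummable_increment:
  assumes "rbv v \<gamma>" "H \<ge> 0" "\<And>x. x \<in> X \<Longrightarrow> cmod (h x) \<le> H"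
  shows "usummable (\<lambda>n x. h x * (v * \<gamma> (Suc n) - \<gamma> n))"
proof -
  have "usummable (\<lambda>n x. (v * \<gamma> (Suc n) - \<gamma> n) * h x)"
    using assms by (intro usummable_mult) (auto simp: usummable_def rbv_def ubounded_def)
  then show ?thesis by (simp add: mult.commute)
qed

text \<open>Shifting a rotating sequence multiplies it by \<open>cnj v\<close> up to a summable error. The sequence
  \<open>\<omega> (Suc n)\<close> is therefore never compared with \<open>\<omega> n\<close>.\<close>
lemma osc_Suc: "osc k g \<Longrightarrow> osc k (\<lambda>n. g (Suc n))"
proof (induction rule: osc.induct)
  case (osc_usummable g)
  then obtain e where "summable e" "\<forall>n. \<forall>x\<in>X. cmod (g n x) \<le> e n" by (auto simp: usummable_def)
  then show ?case by (intro osc.osc_usummable) (auto simp: usummable_def summable_Suc_iff intro!: exI[of _ "\<lambda>n. e (Suc n)"])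
next
  case t: (osc_term m v \<gamma> K H h)
  have v: "cmod v = 1" using t U_power_unit by blast
  have b: "cmod (h x * cnj v) \<le> H" if "x \<in> X" for x using t v that by (simp add: norm_mult)
  have o1: "osc k (\<lambda>n x. (h x * cnj v) * \<gamma> n)"
    using t b by (intro osc.osc_term[of k m v \<gamma> K H])
  have o2: "usummable (\<lambda>n x. (h x * cnj v) * (v * \<gamma> (Suc n) - \<gamma> n))"
    using t b by (intro usummable_increment)
  have "(h x * cnj v) * \<gamma> n + (h x * cnj v) * (v * \<gamma> (Suc n) - \<gamma> n)
      = h x * \<gamma> (Suc n) * (v * cnj v)" for n x by (simp add: algebra_simps)
  with osc.osc_add[OF o1 osc.osc_usummable[OF o2]] show ?case using unit_cnj[OF v] by simp
next
  case (osc_add g g') then show ?case using osc.osc_add by simp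
qed

lemma osc_p_usummable: "osc p g \<Longrightarrow> usummable g"
proof (induction rule: osc.induct)
  case (osc_usummable g) then show ?case .
next
  case (osc_term m v \<gamma> K H h) then show ?case by (intro term_usummable)
next
  case (osc_add g g') then show ?case by (intro usummable_add)
qed

lemma osc_tendsto_0:
  assumes "osc 1 g"
  shows "uniform_limit X g (\<lambda>_. 0) sequentially"
proof -
  have *: "uniform_limit X g (\<lambda>_. 0) sequentially"
    if "\<And>n x. x \<in> X \<Longrightarrow> cmod (g n x) \<le> e n" "e \<longlonglongrightarrow> 0" for e :: "nat \<Rightarrow> real" and g
  proof (rule uniform_limitI)
    fix \<epsilon> :: real assume "\<epsilon> > 0"
    then have "\<forall>\<^sub>F n in sequentially. e n < \<epsilon>" using that(2) by (intro order_tendstoD)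
    then show "\<forall>\<^sub>F n in sequentially. \<forall>x\<in>X. dist (g n x) 0 < \<epsilon>"
      by eventually_elim (use that(1) in \<open>auto intro: le_less_trans\<close>)
  qed
  show ?thesis using assms
  proof (induction rule: osc.induct)
    case (osc_usummable g)
    then show ?case using * summable_LIMSEQ_zero unfolding usummable_def by blast
  next
    case (osc_term m v \<gamma> K H h)
    have "(\<lambda>n. H * K * \<omega> n ^ m) \<longlonglongrightarrow> H * K * 0 ^ m"
      by (intro tendsto_intros \<omega>_tendsto_0)
    then have "(\<lambda>n. H * K * \<omega> n ^ m) \<longlonglongrightarrow> 0" using osc_term by (simp add: power_0_left)
    then show ?case using osc_term(4-7) term_bound[of K \<gamma> m H h]
      by (intro *[of _ "\<lambda>n. H * K * \<omega> n ^ m"]) blast+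
  next
    case (osc_add g g')
    from uniform_limit_add[OF osc_add.IH] show ?case by simp
  qed
qed

text \<open>For the term \<open>h x * \<gamma> n\<close> of phase \<open>v\<close> the ansatz \<open>\<delta> n x = \<kappa> x * h x * \<gamma> n\<close> works when
  \<open>\<kappa> x = 1 / (z x - cnj (z x) * cnj v)\<close>, because \<open>\<gamma> (Suc n)\<close> equals \<open>cnj v * \<gamma> n\<close> up to a summable
  error. From order \<open>p\<close> on, the term is summable itself and \<open>\<delta> = 0\<close> does.\<close>
lemma cohomological_equation:
  assumes "osc k g"
  shows "\<exists>\<delta>. osc k \<delta> \<and> usummable (\<lambda>n x. g n x + cnj (z x) * \<delta> (Suc n) x - z x * \<delta> n x)"
  using assms
proof (induction rule: osc.induct)
  case (osc_usummable g)
  moreover have "osc k (\<lambda>n x. 0)"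
    by (intro osc.osc_usummable) (auto simp: usummable_def intro!: exI[of _ "\<lambda>n. 0"])
  ultimately show ?case by (intro exI[of _ "\<lambda>n x. 0"]) auto
next
  case t: (osc_term m v \<gamma> K H h)
  show ?case
  proof (cases "p \<le> m")
    case True
    have "usummable (\<lambda>n x. h x * \<gamma> n)" using t True by (intro term_usummable)
    moreover have "osc k (\<lambda>n x. 0)"
      by (intro osc.osc_usummable) (auto simp: usummable_def intro!: exI[of _ "\<lambda>n. 0"])
    ultimately show ?thesis by (intro exI[of _ "\<lambda>n x. 0"]) auto
  next
    case False
    have v: "cmod v = 1" using t U_power_unit by blast
    obtain d where d: "d > 0" "\<And>x. x \<in> X \<Longrightarrow> d \<le> cmod (z x - cnj (z x) * cnj v)"
      using nonresonance[of m "cnj v"] U_power_cnj t False by auto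
    define h' where "h' = (\<lambda>x. h x / (z x - cnj (z x) * cnj v))"
    have h': "cmod (h' x) \<le> H / d" if "x \<in> X" for x
      using t d that unfolding h'_def norm_divide by (intro frac_le) auto
    have "osc k (\<lambda>n x. h' x * \<gamma> n)"
      using t h' d by (intro osc.osc_term[of k m v \<gamma> K "H / d"]) auto
    moreover have "usummable (\<lambda>n x. (h' x * cnj (z x) * cnj v) * (v * \<gamma> (Suc n) - \<gamma> n))"
      using t h' d v z_unit by (intro usummable_increment[of v \<gamma> "H / d"]) (auto simp: norm_mult)
    then have "usummable (\<lambda>n x. h x * \<gamma> n + cnj (z x) * (h' x * \<gamma> (Suc n)) - z x * (h' x * \<gamma> n))"
    proof (rule usummable_cong)
      fix n x assume x: "x \<in> X"
      have nz: "z x - cnj (z x) * cnj v \<noteq> 0" using d(1) d(2)[OF x] by auto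
      then have h: "h x = h' x * (z x - cnj (z x) * cnj v)" by (simp add: h'_def)
      have "h x * \<gamma> n + cnj (z x) * (h' x * \<gamma> (Suc n)) - z x * (h' x * \<gamma> n)
          = h' x * cnj (z x) * ((v * cnj v) * \<gamma> (Suc n) - cnj v * \<gamma> n)"
        unfolding h unit_cnj[OF v] by (simp add: algebra_simps)
      then show "h x * \<gamma> n + cnj (z x) * (h' x * \<gamma> (Suc n)) - z x * (h' x * \<gamma> n)
          = (h' x * cnj (z x) * cnj v) * (v * \<gamma> (Suc n) - \<gamma> n)"
        by (simp add: algebra_simps)
    qed
    ultimately show ?thesis by (intro exI[of _ "\<lambda>n x. h' x * \<gamma> n"]) auto
  qed
next
  case (osc_add g g')
  then obtain \<delta> \<delta>' where "osc k \<delta>" "osc k \<delta>'"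
    "usummable (\<lambda>n x. g n x + cnj (z x) * \<delta> (Suc n) x - z x * \<delta> n x)"
    "usummable (\<lambda>n x. g' n x + cnj (z x) * \<delta>' (Suc n) x - z x * \<delta>' n x)" by blast
  then show ?case
    by (intro exI[of _ "\<lambda>n x. \<delta> n x + \<delta>' n x"])
      (auto intro: osc.osc_add usummable_cong[OF usummable_add] simp: algebra_simps)
qed

text \<open>If \<open>\<psi>\<^sub>n\<^sub>+\<^sub>1 = (z + A\<^sub>n) \<psi>\<^sub>n + B\<^sub>n cnj \<psi>\<^sub>n\<close>, the expression below is the coefficient of \<open>cnj \<phi>\<^sub>n\<close> in
  \<open>\<phi>\<^sub>n\<^sub>+\<^sub>1\<close> for \<open>\<phi>\<^sub>n = \<psi>\<^sub>n + C\<^sub>n cnj \<psi>\<^sub>n\<close>, up to the factor \<open>1 - \<bar>C\<^sub>n\<bar>\<^sup>2\<close>. It is made small by successive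
  corrections as in a normal form computation: a residual of order \<open>k\<close> is removed by the
  linear equation above, and what the correction creates carries another factor of order 1.\<close>
lemma riccati_approximate_solution:
  assumes A: "osc 1 A" and B: "osc 1 B"
  shows "\<exists>C. osc 1 C \<and> usummable (\<lambda>n x. B n x + C (Suc n) x * cnj (z x + A n x) - C n x * (z x + A n x)
      - C n x * C (Suc n) x * cnj (B n x))"
proof -
  define F where "F = (\<lambda>C n x. B n x + C (Suc n) x * cnj (z x + A n x) - C n x * (z x + A n x)
      - C n x * C (Suc n) x * cnj (B n x))"
  have "\<exists>C. osc 1 C \<and> osc (Suc k) (F C)" for k
  proof (induction k)
    case 0
    have "osc 1 (\<lambda>n x. 0)"
      by (intro osc.osc_usummable) (auto simp: usummable_def intro!: exI[of _ "\<lambda>n. 0"])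
    moreover have "osc (Suc 0) (F (\<lambda>n x. 0))" using B by (simp add: F_def)
    ultimately show ?case by blast
  next
    case (Suc k)
    then obtain C where C: "osc 1 C" "osc (Suc k) (F C)" by blast
    from cohomological_equation[OF C(2)] obtain \<delta> where \<delta>: "osc (Suc k) \<delta>"
      "usummable (\<lambda>n x. F C n x + cnj (z x) * \<delta> (Suc n) x - z x * \<delta> n x)" by blast
    \<comment> \<open>The residual of \<open>C + \<delta>\<close> is the solved linear part plus five products of \<open>\<delta>\<close> with \<open>A\<close> or \<open>B\<close>.\<close>
    have [simp]: "Suc k + 1 = Suc (Suc k)" by simp
    have \<delta>1: "osc 1 \<delta>" by (rule osc_mono[OF \<delta>(1)]) simp
    have 1: "osc (Suc (Suc k)) (\<lambda>n x. \<delta> (Suc n) x * cnj (A n x))"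
      using osc_mult[OF osc_Suc[OF \<delta>(1)] osc_cnj[OF A]] by simp
    have 2: "osc (Suc (Suc k)) (\<lambda>n x. \<delta> n x * A n x)"
      using osc_mult[OF \<delta>(1) A] by simp
    have 3: "osc (Suc (Suc k)) (\<lambda>n x. \<delta> (Suc n) x * C n x * cnj (B n x))"
      by (rule osc_mono[OF osc_mult[OF osc_mult[OF osc_Suc[OF \<delta>(1)] C(1)] osc_cnj[OF B]]]) simp
    have 4: "osc (Suc (Suc k)) (\<lambda>n x. \<delta> n x * C (Suc n) x * cnj (B n x))"
      by (rule osc_mono[OF osc_mult[OF osc_mult[OF \<delta>(1) osc_Suc[OF C(1)]] osc_cnj[OF B]]]) simp
    have 5: "osc (Suc (Suc k)) (\<lambda>n x. \<delta> n x * \<delta> (Suc n) x * cnj (B n x))"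
      by (rule osc_mono[OF osc_mult[OF osc_mult[OF \<delta>(1) osc_Suc[OF \<delta>1]] osc_cnj[OF B]]]) simp
    have "osc (Suc (Suc k)) (F (\<lambda>n x. C n x + \<delta> n x))"
      by (rule osc_cong[OF osc_add[OF osc_usummable[OF \<delta>(2)]
              osc_diff[OF osc_diff[OF osc_diff[OF osc_diff[OF 1 2] 3] 4] 5]]])
        (simp add: F_def algebra_simps)
    then show ?case using osc_add[OF C(1) \<delta>1] by blast
  qed
  from this[of "p - 1"] obtain C where "osc 1 C" "osc p (F C)" using p_pos by auto
  then show ?thesis using osc_p_usummable unfolding F_def by blast
qed

end

lemma (in nonresonant) osc_sum:
  assumes "finite I" "\<And>i. i \<in> I \<Longrightarrow> osc k (g i)"
  shows "osc k (\<lambda>n x. \<Sum>i\<in>I. g i n x)"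
  using assms
proof (induction I rule: finite_induct)
  case empty
  show ?case by (intro osc_usummable) (auto simp: usummable_def intro!: exI[of _ "\<lambda>n. 0"])
next
  case (insert i I)
  then show ?case using osc_add[of k "g i" "\<lambda>n x. \<Sum>i\<in>I. g i n x"] by simp
qed

section \<open>Convergence of the amplitude\<close>

text \<open>The increments are compared with a convergent product: the values stay between
  \<open>N m x * exp (- 2 * suminf \<tau>)\<close> and \<open>N m x * exp (suminf \<tau>)\<close>, and the series of increments converges
  uniformly.\<close>
lemma uniform_limit_of_small_relative_increments:
  fixes N :: "nat \<Rightarrow> 'x \<Rightarrow> real"
  assumes pos: "\<And>n x. n \<ge> m \<Longrightarrow> x \<in> X \<Longrightarrow> N n x > 0"
    and step: "\<And>n x. n \<ge> m \<Longrightarrow> x \<in> X \<Longrightarrow> \<bar>N (Suc n) x - N n x\<bar> \<le> \<tau> n * N n x"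
    and \<tau>: "summable \<tau>" "\<And>n. \<tau> n \<ge> 0" "\<And>n. n \<ge> m \<Longrightarrow> \<tau> n \<le> 1 / 2"
    and bound: "\<And>x. x \<in> X \<Longrightarrow> N m x \<le> M"
  shows "\<exists>T. uniform_limit X N T sequentially \<and> (\<forall>x\<in>X. T x > 0) \<and>
    (\<exists>M'\<ge>0. \<forall>n\<ge>m. \<forall>x\<in>X. N n x \<le> M')"
proof -
  define P where "P = (\<lambda>k x. N (m + k) x)"
  define t where "t = (\<lambda>k. \<tau> (m + k))"
  have t: "summable t" "\<And>k. t k \<ge> 0" "\<And>k. t k \<le> 1 / 2"
    using \<tau> summable_iff_shift[of \<tau> m] by (auto simp: t_def add.commute)
  have P: "P k x > 0" "\<bar>P (Suc k) x - P k x\<bar> \<le> t k * P k x" if "x \<in> X" for k x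
    using pos[of "m + k" x] step[of "m + k" x] that by (auto simp: P_def t_def)
  have sum_t: "sum t {..<k} \<le> suminf t" for k
    by (rule sum_le_suminf) (use t in auto)
  have up: "P k x \<le> P 0 x * exp (sum t {..<k})" if "x \<in> X" for k x
  proof (induction k)
    case (Suc k)
    have "P (Suc k) x \<le> (1 + t k) * P k x" using P(2)[OF that, of k] by (simp add: algebra_simps abs_le_iff)
    also have "\<dots> \<le> exp (t k) * (P 0 x * exp (sum t {..<k}))"
      using Suc P(1)[OF that, of k] t(2)[of k] exp_ge_add_one_self[of "t k"] by (intro mult_mono) auto
    finally show ?case by (simp add: exp_add mult_ac)
  qed simp
  have low: "P 0 x * exp (- 2 * sum t {..<k}) \<le> P k x" if "x \<in> X" for k x
  proof (induction k)
    case (Suc k)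
    \<comment> \<open>This is where the bound \<open>1 / 2\<close> on the increments enters.\<close>
    have "exp (- 2 * t k) \<le> 1 - t k"
    proof -
      have "1 + 2 * t k \<le> exp (2 * t k)" by (rule exp_ge_add_one_self)
      then have "exp (- 2 * t k) \<le> 1 / (1 + 2 * t k)"
        using t(2)[of k] by (simp add: exp_minus inverse_eq_divide frac_le)
      also have "\<dots> \<le> 1 - t k"
      proof -
        have "0 \<le> t k * (1 - 2 * t k)" using t(2,3)[of k] by (intro mult_nonneg_nonneg) auto
        then have "1 \<le> (1 - t k) * (1 + 2 * t k)" by (simp add: algebra_simps)
        then show ?thesis using t(2)[of k] by (simp add: divide_le_eq)
      qed
      finally show ?thesis .
    qed
    then have "exp (- 2 * t k) * (P 0 x * exp (- 2 * sum t {..<k})) \<le> (1 - t k) * P k x"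
      using Suc P(1)[OF that] t(3)[of k] by (intro mult_mono) (auto intro: less_imp_le)
    also have "\<dots> \<le> P (Suc k) x" using P(2)[OF that, of k] by (simp add: algebra_simps abs_le_iff)
    finally show ?case by (simp add: exp_add[symmetric] algebra_simps)
  qed simp
  define M' where "M' = \<bar>M\<bar> * exp (suminf t)"
  have M': "P k x \<le> M'" if "x \<in> X" for k x
  proof -
    have "P 0 x \<le> \<bar>M\<bar>" using bound[OF that] by (simp add: P_def)
    then have "P 0 x * exp (sum t {..<k}) \<le> M'"
      unfolding M'_def using sum_t by (intro mult_mono) auto
    then show ?thesis using up[OF that, of k] by simp
  qed
  have M'0: "M' \<ge> 0" by (simp add: M'_def)
  have "uniform_limit X (\<lambda>n x. \<Sum>k<n. P (Suc k) x - P k x) (\<lambda>x. \<Sum>k. P (Suc k) x - P k x) sequentially"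
  proof (rule Weierstrass_m_test)
    fix k x assume "x \<in> X"
    then show "norm (P (Suc k) x - P k x) \<le> t k * M'"
      using P(2)[of x k] mult_left_mono[OF M'[of x k] t(2)[of k]] by simp
  qed (intro summable_mult2 t)
  then have "uniform_limit X (\<lambda>n x. P 0 x + (\<Sum>k<n. P (Suc k) x - P k x))
      (\<lambda>x. P 0 x + (\<Sum>k. P (Suc k) x - P k x)) sequentially"
    by (intro uniform_limit_add uniform_limit_const)
  moreover have "P 0 x + (\<Sum>k<n. P (Suc k) x - P k x) = P n x" for n x
    by (induction n) auto
  ultimately have "uniform_limit X P (\<lambda>x. P 0 x + (\<Sum>k. P (Suc k) x - P k x)) sequentially"
    by (simp only:)
  then obtain T where T: "uniform_limit X P T sequentially"
    by blast
  have lim: "uniform_limit X N T sequentially"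
  proof (rule uniform_limitI)
    fix e :: real assume "e > 0"
    then have "\<forall>\<^sub>F k in sequentially. \<forall>x\<in>X. dist (P k x) (T x) < e" using T by (rule uniform_limitD[rotated])
    then show "\<forall>\<^sub>F n in sequentially. \<forall>x\<in>X. dist (N n x) (T x) < e"
      unfolding P_def add.commute[of m] by (subst (asm) eventually_sequentially_seg)
  qed
  have "T x > 0" if "x \<in> X" for x
  proof -
    have "(\<lambda>k. P k x) \<longlonglongrightarrow> T x" using tendsto_uniform_limitI[OF T that] .
    moreover have "P 0 x * exp (- 2 * suminf t) \<le> P k x" for k
    proof -
      have "P 0 x * exp (- 2 * suminf t) \<le> P 0 x * exp (- 2 * sum t {..<k})"
        using P(1)[OF that, of 0] sum_t[of k] by (intro mult_left_mono) auto
      then show ?thesis using low[OF that, of k] by simp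
    qed
    ultimately have "P 0 x * exp (- 2 * suminf t) \<le> T x"
      by (intro LIMSEQ_le_const) auto
    moreover have "P 0 x * exp (- 2 * suminf t) > 0" using P(1)[OF that, of 0] by simp
    ultimately show ?thesis by linarith
  qed
  moreover have "\<forall>n\<ge>m. \<forall>x\<in>X. N n x \<le> M'"
    using M' unfolding P_def by (metis le_add_diff_inverse)
  ultimately show ?thesis using lim M'0 by blast
qed

text \<open>The left-hand side is the determinant of a product of three matrices of the form
  \<open>((u, v), (v', u'))\<close>: the transfer matrix \<open>(a, b)\<close>, and the changes of variables \<open>(1, d)\<close> after it and
  \<open>(1, - c)\<close> before it, the latter being the inverse of \<open>(1, c)\<close> up to a scalar.\<close>
lemma det_conjugated:
  fixes a a' b b' c c' d d' :: "'a::comm_ring_1"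
  shows "(a + d * b' - c' * b - c' * d * a') * (a' + d' * b - c * b' - c * d' * a)
     - (b + d * a' - c * a - c * d * b') * (b' + d' * a - c' * a' - c' * d' * b)
     = (a * a' - b * b') * (1 - c * c') * (1 - d * d')"
proof -
  have *: "(x - c' * y) * (x' - c * y') - (y - c * x) * (y' - c' * x')
      = (x * x' - y * y') * (1 - c * c')" for x x' y y' :: 'a
    by (simp add: algebra_simps)
  have "(a + d * b') * (a' + d' * b) - (b + d * a') * (b' + d' * a) = (a * a' - b * b') * (1 - d * d')"
    by (simp add: algebra_simps)
  with *[of "a + d * b'" "b + d * a'" "a' + d' * b" "b' + d' * a"]
  show ?thesis by (simp only: distrib_left mult.assoc mult.commute mult.left_commute diff_diff_eq)
qed

context nonresonant
begin

text \<open>In terms of \<open>\<phi>\<^sub>n = \<psi>\<^sub>n + C\<^sub>n cnj \<psi>\<^sub>n\<close> one step reads \<open>\<phi>\<^sub>n\<^sub>+\<^sub>1 = D \<phi>\<^sub>n + E cnj \<phi>\<^sub>n\<close> up to a scalar, with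
  summable \<open>E\<close>, and the determinant fixes \<open>\<bar>D\<bar>\<^sup>2 - \<bar>E\<bar>\<^sup>2\<close>. The normalisation
  \<open>N\<^sub>n = \<bar>\<phi>\<^sub>n\<bar>\<^sup>2 / (1 - \<bar>C\<^sub>n\<bar>\<^sup>2)\<close> absorbs the determinants of the changes of variables, so that
  \<open>N\<close> changes by a summable relative amount per step.\<close>
theorem amplitude_converges:
  fixes \<psi> :: "nat \<Rightarrow> 'x \<Rightarrow> complex" and a :: "nat \<Rightarrow> real"
  assumes A: "osc 1 A" and B: "osc 1 B"
    and a: "\<And>n. a n > 0" "a \<longlonglongrightarrow> 1"
    and rec: "\<And>n x. x \<in> X \<Longrightarrow> a n * \<psi> (Suc n) x = (z x + A n x) * \<psi> n x + B n x * cnj (\<psi> n x)"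
    and det: "\<And>n x. x \<in> X \<Longrightarrow> (cmod (z x + A n x))\<^sup>2 - (cmod (B n x))\<^sup>2 = (a n)\<^sup>2"
    and nz: "\<And>n x. x \<in> X \<Longrightarrow> \<psi> n x \<noteq> 0"
    and bd: "\<And>n. \<exists>M. \<forall>x\<in>X. cmod (\<psi> n x) \<le> M"
  shows "\<exists>T. uniform_limit X (\<lambda>n x. (cmod (\<psi> n x))\<^sup>2) T sequentially \<and> (\<forall>x\<in>X. T x > 0)"
proof -
  obtain C where C: "osc 1 C" and neg: "usummable (\<lambda>n x. B n x + C (Suc n) x * cnj (z x + A n x)
      - C n x * (z x + A n x) - C n x * C (Suc n) x * cnj (B n x))"
    using riccati_approximate_solution[OF A B] by blast
  define E where "E = (\<lambda>n x. B n x + C (Suc n) x * cnj (z x + A n x)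
      - C n x * (z x + A n x) - C n x * C (Suc n) x * cnj (B n x))"
  obtain \<epsilon> where \<epsilon>: "summable \<epsilon>" "\<And>n x. x \<in> X \<Longrightarrow> cmod (E n x) \<le> \<epsilon> n"
    using neg unfolding usummable_def E_def by blast
  define \<epsilon>' where "\<epsilon>' = (\<lambda>n. \<bar>\<epsilon> n\<bar>)"
  show ?thesis
  proof (cases "X = {}")
    case True
    then show ?thesis by (auto simp: uniform_limit_on_empty)
  next
    case False
    then have e0: "\<epsilon> n \<ge> 0" for n using \<epsilon>(2) norm_ge_zero order_trans by (metis ex_in_conv)
    have Clim: "uniform_limit X C (\<lambda>_. 0) sequentially" by (rule osc_tendsto_0[OF C])
    have "\<forall>\<^sub>F n in sequentially. \<forall>x\<in>X. cmod (C n x) < 1 / 2"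
      using uniform_limitD[OF Clim, of "1 / 2"] by simp
    \<comment> \<open>From some index on \<open>P \<ge> 9 / 64\<close> and \<open>\<bar>D\<bar> + \<bar>E\<bar> \<le> 4\<close> below, and \<open>2 * 4 * 64 / 9 < 120\<close>.\<close>
    moreover have "\<forall>\<^sub>F n in sequentially. 120 * \<epsilon> n < 1 / 2"
      using tendsto_mult_right_zero[OF summable_LIMSEQ_zero[OF \<epsilon>(1)], of 120]
      by (rule order_tendstoD) simp
    moreover have "\<forall>\<^sub>F n in sequentially. 1 / 2 < a n" "\<forall>\<^sub>F n in sequentially. a n < 2"
      by (rule order_tendstoD[OF a(2)], simp)+
    ultimately have "\<forall>\<^sub>F n in sequentially. (\<forall>x\<in>X. cmod (C n x) < 1 / 2) \<and> 120 * \<epsilon> n < 1 / 2 \<and> 1 / 2 < a n \<and> a n < 2"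
      by eventually_elim auto
    then obtain m where m: "\<And>n x. n \<ge> m \<Longrightarrow> x \<in> X \<Longrightarrow> cmod (C n x) < 1 / 2"
      "\<And>n. n \<ge> m \<Longrightarrow> 120 * \<epsilon> n < 1 / 2" "\<And>n. n \<ge> m \<Longrightarrow> 1 / 2 < a n" "\<And>n. n \<ge> m \<Longrightarrow> a n < 2"
      unfolding eventually_sequentially by blast
    define \<phi> where "\<phi> = (\<lambda>n x. \<psi> n x + C n x * cnj (\<psi> n x))"
    define N where "N = (\<lambda>n x. (cmod (\<phi> n x))\<^sup>2 / (1 - (cmod (C n x))\<^sup>2))"
    have sq: "(cmod (C n x))\<^sup>2 \<le> 1 / 4" if "n \<ge> m" "x \<in> X" for n x
      using power_mono[of "cmod (C n x)" "1 / 2" 2] m(1)[OF that] by (simp add: power2_eq_square)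
    have \<phi>_low: "cmod (\<phi> n x) \<ge> cmod (\<psi> n x) * (1 - cmod (C n x))" for n x
      using norm_diff_ineq[of "\<psi> n x" "C n x * cnj (\<psi> n x)"]
      by (simp add: \<phi>_def norm_mult algebra_simps)
    have \<phi>_up: "cmod (\<phi> n x) \<le> cmod (\<psi> n x) * (1 + cmod (C n x))" for n x
      using norm_triangle_ineq[of "\<psi> n x" "C n x * cnj (\<psi> n x)"]
      by (simp add: \<phi>_def norm_mult algebra_simps)
    have \<phi>_nz: "cmod (\<phi> n x) > 0" if "n \<ge> m" "x \<in> X" for n x
    proof -
      have "0 < cmod (\<psi> n x) * (1 - cmod (C n x))" using nz[OF that(2), of n] m(1)[OF that] by simp
      then show ?thesis using \<phi>_low[of n x] by linarith
    qed
    have N_pos: "N n x > 0" if "n \<ge> m" "x \<in> X" for n x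
      unfolding N_def using \<phi>_nz[OF that] sq[OF that] by (intro divide_pos_pos) auto
    have N_step: "\<bar>N (Suc n) x - N n x\<bar> \<le> (120 * \<epsilon> n) * N n x" if n: "n \<ge> m" and x: "x \<in> X" for n x
    proof -
      let ?a = "z x + A n x" and ?b = "B n x" and ?c = "C n x" and ?c' = "C (Suc n) x"
      let ?s = "\<psi> n x"
      define D where "D = ?a + ?c' * cnj ?b - cnj ?c * ?b - cnj ?c * ?c' * cnj ?a"
      \<comment> \<open>The determinant of the step in the new variables.\<close>
      define P where "P = (a n)\<^sup>2 * (1 - (cmod ?c)\<^sup>2) * (1 - (cmod ?c')\<^sup>2)"
      define d e f where "d = cmod D" and "e = cmod (E n x)" and "f = cmod (\<phi> n x)"
      have c: "(cmod ?c)\<^sup>2 \<le> 1 / 4" "(cmod ?c')\<^sup>2 \<le> 1 / 4" using sq[of n x] sq[of "Suc n" x] n x by auto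
      have "complex_of_real (d\<^sup>2 - e\<^sup>2) = complex_of_real P"
      proof -
        have "complex_of_real P = (?a * cnj ?a - ?b * cnj ?b) * (1 - ?c * cnj ?c) * (1 - ?c' * cnj ?c')"
          unfolding P_def det[OF x, of n, symmetric] of_real_mult of_real_diff complex_norm_square by simp
        moreover have "complex_of_real (d\<^sup>2 - e\<^sup>2) = D * cnj D - E n x * cnj (E n x)"
          unfolding d_def e_def of_real_diff complex_norm_square ..
        moreover have "D * cnj D - E n x * cnj (E n x)
            = (?a * cnj ?a - ?b * cnj ?b) * (1 - ?c * cnj ?c) * (1 - ?c' * cnj ?c')"
          unfolding D_def E_def
          unfolding complex_cnj_add complex_cnj_diff complex_cnj_mult complex_cnj_cnj
          by (rule det_conjugated)
        ultimately show ?thesis by metis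
      qed
      then have de: "d\<^sup>2 - e\<^sup>2 = P" by (simp only: of_real_eq_iff)
      have eq: "(1 - ?c * cnj ?c) * (a n * \<phi> (Suc n) x) = D * \<phi> n x + E n x * cnj (\<phi> n x)"
      proof -
        have "a n * \<phi> (Suc n) x = a n * \<psi> (Suc n) x + ?c' * cnj (a n * \<psi> (Suc n) x)"
          by (simp add: \<phi>_def algebra_simps)
        also have "\<dots> = (?a * ?s + ?b * cnj ?s) + ?c' * cnj (?a * ?s + ?b * cnj ?s)"
          unfolding rec[OF x] ..
        finally show ?thesis unfolding D_def E_def \<phi>_def by (simp add: algebra_simps)
      qed
      have P_pos: "P \<ge> 9 / 64"
      proof -
        have "(1/2)\<^sup>2 * (3 / 4) * (3 / 4) \<le> P" unfolding P_def
          using c m(3)[OF n] by (intro mult_mono power_mono) auto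
        then show ?thesis by (simp add: power2_eq_square)
      qed
      have P_le: "P \<le> 4"
      proof -
        have "P \<le> 2\<^sup>2 * 1 * 1" unfolding P_def
          using c m(3)[OF n] m(4)[OF n] by (intro mult_mono power_mono) auto
        then show ?thesis by simp
      qed
      have e_le: "0 \<le> e" "e \<le> \<epsilon> n" "\<epsilon> n \<le> 1 / 240" using \<epsilon>(2)[OF x] m(2)[OF n] by (auto simp: e_def)
      have d0: "0 \<le> d" by (simp add: d_def)
      have de_le: "e \<le> d" using de P_pos by (intro power2_le_imp_le[OF _ d0]) linarith
      have e1: "e \<le> 1" using e_le by linarith
      have "d\<^sup>2 \<le> 3\<^sup>2" using de P_le power_mono[OF e1 e_le(1), of 2] by (simp add: power2_eq_square)
      then have d_le: "d \<le> 3" by (rule power2_le_imp_le) simp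
      define r where "r = 1 - (cmod ?c)\<^sup>2"
      define r' where "r' = 1 - (cmod ?c')\<^sup>2"
      have r: "r > 0" "r' > 0" using c by (auto simp: r_def r'_def)
      define G where "G = cmod (D * \<phi> n x + E n x * cnj (\<phi> n x))"
      have "G = cmod ((1 - ?c * cnj ?c) * (a n * \<phi> (Suc n) x))" by (simp add: G_def eq)
      also have "1 - ?c * cnj ?c = complex_of_real r" by (simp add: r_def complex_norm_square[symmetric])
      finally have G: "G = r * (a n * cmod (\<phi> (Suc n) x))"
        using r a(1)[of n] by (simp add: norm_mult)
      have G_up: "G \<le> (d + e) * f"
        using norm_triangle_ineq[of "D * \<phi> n x" "E n x * cnj (\<phi> n x)"]
        by (simp add: G_def d_def e_def f_def norm_mult algebra_simps)
      have G_low: "(d - e) * f \<le> G"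
        using norm_diff_ineq[of "D * \<phi> n x" "E n x * cnj (\<phi> n x)"]
        by (simp add: G_def d_def e_def f_def norm_mult algebra_simps)
      have f0: "0 \<le> f" by (simp add: f_def)
      have "G\<^sup>2 \<le> ((d + e) * f)\<^sup>2" using G_up by (intro power_mono) (auto simp: G_def)
      moreover have "((d - e) * f)\<^sup>2 \<le> G\<^sup>2" using G_low de_le f0 by (intro power_mono) auto
      moreover have "((d + e) * f)\<^sup>2 - P * f\<^sup>2 = 2 * e * (d + e) * f\<^sup>2"
        unfolding de[symmetric] by (simp add: power2_eq_square algebra_simps)
      moreover have "P * f\<^sup>2 - ((d - e) * f)\<^sup>2 = 2 * e * (d - e) * f\<^sup>2"
        unfolding de[symmetric] by (simp add: power2_eq_square algebra_simps)
      moreover have "2 * e * (d - e) * f\<^sup>2 \<le> 2 * e * (d + e) * f\<^sup>2"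
        using e_le(1) by (intro mult_right_mono mult_left_mono) auto
      ultimately have 1: "\<bar>G\<^sup>2 - P * f\<^sup>2\<bar> \<le> 2 * e * (d + e) * f\<^sup>2" by linarith
      have "2 * e * (d + e) \<le> 2 * \<epsilon> n * 4" using e_le d_le e1 d0 by (intro mult_mono) auto
      then have "2 * e * (d + e) * f\<^sup>2 \<le> 8 * \<epsilon> n * f\<^sup>2" by (intro mult_right_mono) auto
      with 1 have 2: "\<bar>G\<^sup>2 - P * f\<^sup>2\<bar> \<le> 8 * \<epsilon> n * f\<^sup>2" by linarith
      have N1: "G\<^sup>2 = P * r * N (Suc n) x"
        using r unfolding G N_def P_def r_def[symmetric] r'_def[symmetric]
        by (simp add: power_mult_distrib) (simp add: power2_eq_square)
      have N2: "f\<^sup>2 = r * N n x" unfolding N_def f_def using r by (simp add: r_def[symmetric])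
      have "r * (P * \<bar>N (Suc n) x - N n x\<bar>) = \<bar>G\<^sup>2 - P * f\<^sup>2\<bar>"
      proof -
        have "G\<^sup>2 - P * f\<^sup>2 = (r * P) * (N (Suc n) x - N n x)" unfolding N1 N2 by (simp add: algebra_simps)
        then show ?thesis using r P_pos by (simp add: abs_mult)
      qed
      also have "\<dots> \<le> r * (8 * \<epsilon> n * N n x)" using 2 unfolding N2 by (simp add: mult_ac)
      finally have 3: "P * \<bar>N (Suc n) x - N n x\<bar> \<le> 8 * \<epsilon> n * N n x" using r by simp
      have "9 / 64 * \<bar>N (Suc n) x - N n x\<bar> \<le> P * \<bar>N (Suc n) x - N n x\<bar>"
        using P_pos by (intro mult_right_mono) auto
      with 3 have "\<bar>N (Suc n) x - N n x\<bar> \<le> 512 / 9 * (\<epsilon> n * N n x)"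
        by (simp add: mult.assoc)
      moreover have "0 \<le> \<epsilon> n * N n x" using e0 N_pos[OF n x] by (intro mult_nonneg_nonneg) auto
      ultimately show ?thesis by (simp add: mult.assoc)
    qed
    obtain M where M: "\<And>x. x \<in> X \<Longrightarrow> cmod (\<psi> m x) \<le> M" using bd by blast
    have N_bd: "N m x \<le> 4 * M\<^sup>2" if x: "x \<in> X" for x
    proof -
      have "cmod (\<phi> m x) \<le> M * (3 / 2)"
        using \<phi>_up[of m x] mult_mono[OF M[OF x], of "1 + cmod (C m x)" "3 / 2"] m(1)[of m x] x
          order_trans[OF norm_ge_zero M[OF x]] by auto
      then have "(cmod (\<phi> m x))\<^sup>2 \<le> (M * (3 / 2))\<^sup>2" by (intro power_mono) auto
      then have "N m x \<le> (M * (3 / 2))\<^sup>2 / (3 / 4)"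
        unfolding N_def using sq[of m x] x by (intro frac_le) auto
      also have "\<dots> \<le> 4 * M\<^sup>2" by (simp add: power2_eq_square)
      finally show ?thesis .
    qed
    have "\<exists>T. uniform_limit X N T sequentially \<and> (\<forall>x\<in>X. T x > 0) \<and>
        (\<exists>M'\<ge>0. \<forall>n\<ge>m. \<forall>x\<in>X. N n x \<le> M')"
    proof (rule uniform_limit_of_small_relative_increments[of m X N "\<lambda>n. 120 * \<epsilon> n" "4 * M\<^sup>2"])
      show "summable (\<lambda>n. 120 * \<epsilon> n)" by (rule summable_mult[OF \<epsilon>(1)])
    qed (use N_pos N_step N_bd e0 m(2) in \<open>auto intro: less_imp_le\<close>)
    then obtain T M' where T: "uniform_limit X N T sequentially" "\<forall>x\<in>X. T x > 0"
      and M': "M' \<ge> 0" "\<forall>n\<ge>m. \<forall>x\<in>X. N n x \<le> M'" by blast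
    have close: "\<bar>(cmod (\<psi> n x))\<^sup>2 - N n x\<bar> \<le> 4 * cmod (C n x) * M'" if n: "n \<ge> m" and x: "x \<in> X" for n x
    proof -
      define c s f where "c = cmod (C n x)" and "s = cmod (\<psi> n x)" and "f = cmod (\<phi> n x)"
      have c: "0 \<le> c" "c < 1 / 2" using m(1)[OF n x] by (auto simp: c_def)
      have "(s * (1 - c))\<^sup>2 \<le> f\<^sup>2" using \<phi>_low[of n x] c by (intro power_mono) (auto simp: s_def c_def f_def)
      moreover have "f\<^sup>2 \<le> (s * (1 + c))\<^sup>2" using \<phi>_up[of n x] by (intro power_mono) (auto simp: s_def c_def f_def)
      moreover have f: "f\<^sup>2 = (1 - c) * (1 + c) * N n x"
      proof -
        have *: "1 - c\<^sup>2 = (1 - c) * (1 + c)" by (simp add: power2_eq_square algebra_simps)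
        have "f\<^sup>2 = (1 - c\<^sup>2) * N n x" unfolding N_def f_def[symmetric] c_def[symmetric]
          using sq[OF n x] by (simp add: c_def)
        then show ?thesis by (simp only: *)
      qed
      ultimately have "(1 - c) * ((1 - c) * s\<^sup>2) \<le> (1 - c) * ((1 + c) * N n x)"
        "(1 + c) * ((1 - c) * N n x) \<le> (1 + c) * ((1 + c) * s\<^sup>2)"
        by (simp_all add: power2_eq_square mult_ac)
      then have i: "(1 - c) * s\<^sup>2 \<le> (1 + c) * N n x" "(1 - c) * N n x \<le> (1 + c) * s\<^sup>2"
        using c by simp_all
      have Np: "0 < N n x" by (rule N_pos[OF n x])
      have s2: "s\<^sup>2 \<le> 3 * N n x"
      proof -
        have "1 / 2 * s\<^sup>2 \<le> (1 - c) * s\<^sup>2" using c by (intro mult_right_mono) auto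
        moreover have "(1 + c) * N n x \<le> 3 / 2 * N n x" using c Np by (intro mult_right_mono) auto
        ultimately show ?thesis using i(1) by linarith
      qed
      have "c * s\<^sup>2 \<le> c * (3 * N n x)" using s2 c by (intro mult_left_mono) auto
      moreover have "s\<^sup>2 - N n x \<le> c * s\<^sup>2 + c * N n x" "N n x - s\<^sup>2 \<le> c * s\<^sup>2 + c * N n x"
        using i by (simp_all add: algebra_simps)
      ultimately have "\<bar>s\<^sup>2 - N n x\<bar> \<le> 4 * c * N n x" by linarith
      also have "\<dots> \<le> 4 * c * M'" using M' n x c by (intro mult_left_mono) auto
      finally show ?thesis by (simp add: s_def c_def)
    qed
    have "uniform_limit X (\<lambda>n x. (cmod (\<psi> n x))\<^sup>2) T sequentially"
    proof (rule uniform_limitI)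
      fix e :: real assume e: "e > 0"
      then have "e / 2 > 0" "e / (8 * (M' + 1)) > 0" using M' by auto
      then have "\<forall>\<^sub>F n in sequentially. \<forall>x\<in>X. dist (N n x) (T x) < e / 2"
        "\<forall>\<^sub>F n in sequentially. \<forall>x\<in>X. dist (C n x) 0 < e / (8 * (M' + 1))"
        using uniform_limitD[OF T(1)] uniform_limitD[OF Clim] by blast+
      moreover have "\<forall>\<^sub>F n in sequentially. n \<ge> m" by (rule eventually_ge_at_top)
      ultimately show "\<forall>\<^sub>F n in sequentially. \<forall>x\<in>X. dist ((cmod (\<psi> n x))\<^sup>2) (T x) < e"
      proof eventually_elim
        case (elim n)
        show ?case
        proof
          fix x assume x: "x \<in> X"
          have "4 * cmod (C n x) * M' \<le> 4 * (e / (8 * (M' + 1))) * (M' + 1)"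
            using elim(2) x M' e by (intro mult_mono) (auto intro: less_imp_le)
          also have "\<dots> = e / 2" using M' by (simp add: field_simps)
          finally have "\<bar>(cmod (\<psi> n x))\<^sup>2 - N n x\<bar> \<le> e / 2" using close[of n x] elim(3) x by linarith
          moreover have "\<bar>N n x - T x\<bar> < e / 2" using elim(1) x by (simp add: dist_real_def)
          ultimately show "dist ((cmod (\<psi> n x))\<^sup>2) (T x) < e" unfolding dist_real_def by linarith
        qed
      qed
    qed
    then show ?thesis using T(2) by blast
  qed
qed

end

section \<open>Jacobi matrices and polynomials in the mean square\<close>

lemma poly_uniform_approximation:
  fixes h :: "real \<Rightarrow> real"
  assumes "continuous_on {c..d} h" "e > 0"
  shows "\<exists>q. \<forall>x\<in>{c..d}. \<bar>h x - poly q x\<bar> < e"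
proof -
  obtain g where g: "real_polynomial_function g" "\<And>x. x \<in> {c..d} \<Longrightarrow> \<bar>h x - g x\<bar> < e"
    using Stone_Weierstrass_real_polynomial_function[OF compact_Icc assms] by metis
  obtain k n where "g = (\<lambda>x. \<Sum>i\<le>n. k i * x ^ i)"
    using g(1) unfolding real_polynomial_function_iff_sum by blast
  then have "g x = poly (\<Sum>i\<le>n. monom (k i) i) x" for x by (simp add: poly_sum poly_monom)
  with g(2) show ?thesis by metis
qed

text \<open>The conventions \<open>a 0 = 0\<close> and \<open>0 - 1 = 0\<close> make the recurrence valid for \<open>n = 0\<close> as it stands.\<close>
locale jacobi = prob_space \<rho> for \<rho> :: "real measure" +
  fixes P :: "nat \<Rightarrow> real poly" and a b :: "nat \<Rightarrow> real"
  assumes sets_\<rho> [simp, measurable_cong]: "sets \<rho> = sets borel"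
    and moments: "integrable \<rho> (\<lambda>x. x ^ k)"
    and orthonormal: "orthonormal_polynomials \<rho> P"
    and a_0: "a 0 = 0"
    and a_pos: "n \<ge> 1 \<Longrightarrow> a n > 0"
    and recurrence: "[:0, 1:] * P n =
      smult (a (Suc n)) (P (Suc n)) + smult (b (Suc n)) (P n) + smult (a n) (P (n - 1))"
begin

lemma space_\<rho> [simp]: "space \<rho> = UNIV"
  using sets_eq_imp_space_eq[OF sets_\<rho>] by simp

lemma a_nonneg: "a n \<ge> 0"
  using a_0 a_pos[of n] by (cases n) auto

lemma degree_P: "degree (P n) = n" and lead_coeff_P: "lead_coeff (P n) > 0"
  and orthonormality: "(LINT x|\<rho>. poly (P m) x * poly (P n) x) = (if m = n then 1 else 0)"
  using orthonormal unfolding orthonormal_polynomials_def by blast+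

lemma integrable_poly: "integrable \<rho> (\<lambda>x. poly q x)"
  unfolding poly_altdef by (intro Bochner_Integration.integrable_sum integrable_mult_right moments)

lemma integrable_poly_mult: "integrable \<rho> (\<lambda>x. poly q x * poly r x)"
  using integrable_poly[of "q * r"] by simp

lemma integrable_poly_mult3: "integrable \<rho> (\<lambda>x. poly q x * poly r x * poly s x)"
  using integrable_poly[of "q * r * s"] by simp

lemma recurrence_poly: "x * poly (P n) x =
    a (Suc n) * poly (P (Suc n)) x + b (Suc n) * poly (P n) x + a n * poly (P (n - 1)) x"
  using arg_cong[OF recurrence[of n], of "\<lambda>q. poly q x"] by simp

definition fourier_coeff :: "real poly \<Rightarrow> nat \<Rightarrow> real" where
  "fourier_coeff q n = (LINT x|\<rho>. poly q x * poly (P n) x)"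

lemma fourier_coeff_sum:
  "fourier_coeff (\<Sum>k<m. smult (c k) (P k)) n = (if n < m then c n else 0)"
proof -
  have "fourier_coeff (\<Sum>k<m. smult (c k) (P k)) n = (\<Sum>k<m. c k * (LINT x|\<rho>. poly (P k) x * poly (P n) x))"
    unfolding fourier_coeff_def
    by (simp add: poly_sum sum_distrib_right mult.assoc Bochner_Integration.integral_sum
        integrable_poly_mult integrable_mult_right)
  also have "\<dots> = (if n < m then c n else 0)" by (simp add: orthonormality if_distrib[of "\<lambda>t. _ * t"] cong: if_cong)
  finally show ?thesis .
qed

lemma expansion_exists: "(\<And>i. i \<ge> m \<Longrightarrow> coeff q i = 0) \<Longrightarrow> \<exists>c. q = (\<Sum>k<m. smult (c k) (P k))"
proof (induction m arbitrary: q)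
  case 0
  then show ?case by (auto simp: poly_eq_iff)
next
  case (Suc m)
  define s where "s = coeff q m / lead_coeff (P m)"
  have "coeff (q - smult s (P m)) i = 0" if "i \<ge> m" for i
  proof (cases "i = m")
    case True
    then show ?thesis using lead_coeff_P[of m] by (simp add: s_def degree_P)
  next
    case False
    then show ?thesis using that Suc.prems[of i] by (simp add: coeff_eq_0 degree_P)
  qed
  from Suc.IH[OF this] obtain c where c: "q - smult s (P m) = (\<Sum>k<m. smult (c k) (P k))" by blast
  have "(\<Sum>k<Suc m. smult ((c(m := s)) k) (P k)) = (\<Sum>k<m. smult (c k) (P k)) + smult s (P m)"
    by simp
  then have "q = (\<Sum>k<Suc m. smult ((c(m := s)) k) (P k))" by (simp add: c[symmetric])
  then show ?case by blast
qed

lemma expansion: "\<exists>m. q = (\<Sum>k<m. smult (fourier_coeff q k) (P k)) \<and> (\<forall>n\<ge>m. fourier_coeff q n = 0)"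
proof -
  obtain c where c: "q = (\<Sum>k<Suc (degree q). smult (c k) (P k))"
    using expansion_exists[of "Suc (degree q)" q] coeff_eq_0 by (metis Suc_le_eq)
  have fourier_coeff: "fourier_coeff q n = (if n < Suc (degree q) then c n else 0)" for n
    by (subst c) (rule fourier_coeff_sum)
  have "(\<Sum>k<Suc (degree q). smult (fourier_coeff q k) (P k)) = q"
    by (subst (2) c, rule sum.cong) (auto simp: fourier_coeff)
  then show ?thesis by (intro exI[of _ "Suc (degree q)"]) (auto simp: fourier_coeff)
qed

lemma integral_expansion:
  assumes "q = (\<Sum>k<m. smult (c k) (P k))"
  shows "(LINT x|\<rho>. poly q x * poly r x) = (\<Sum>k<m. c k * (LINT x|\<rho>. poly (P k) x * poly r x))"
  unfolding assms
  by (simp add: poly_sum sum_distrib_right mult.assoc Bochner_Integration.integral_sum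
      integrable_poly_mult integrable_mult_right)

lemma fourier_coeff_x_P: "(LINT x|\<rho>. x * (poly (P n) x * poly q x)) =
    a (Suc n) * fourier_coeff q (Suc n) + b (Suc n) * fourier_coeff q n + a n * fourier_coeff q (n - 1)"
proof -
  have "x * (poly (P n) x * poly q x) = a (Suc n) * (poly q x * poly (P (Suc n)) x)
      + b (Suc n) * (poly q x * poly (P n) x) + a n * (poly q x * poly (P (n - 1)) x)" for x
    unfolding mult.assoc[symmetric] recurrence_poly by (simp add: algebra_simps)
  then show ?thesis unfolding fourier_coeff_def
    by (simp add: integrable_poly_mult integrable_mult_right)
qed

text \<open>The quadratic form of a Jacobi matrix is dominated by its absolute row sums: estimate each
  off-diagonal product by the arithmetic-geometric mean inequality.\<close>
lemma quadratic_form_bound: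
  assumes q: "q = (\<Sum>k<m. smult (fourier_coeff q k) (P k))" and m: "\<And>n. n \<ge> m \<Longrightarrow> fourier_coeff q n = 0"
  shows "\<bar>LINT x|\<rho>. x * (poly q x)\<^sup>2\<bar> \<le> (\<Sum>n<m. (\<bar>b (Suc n)\<bar> + a (Suc n) + a n) * (fourier_coeff q n)\<^sup>2)"
proof -
  define c where "c = fourier_coeff q"
  have "(LINT x|\<rho>. x * (poly q x)\<^sup>2) = (LINT x|\<rho>. poly q x * poly ([:0, 1:] * q) x)"
    by (simp add: power2_eq_square mult_ac)
  also have "\<dots> = (\<Sum>n<m. c n * (LINT x|\<rho>. poly (P n) x * poly ([:0, 1:] * q) x))"
    unfolding c_def by (rule integral_expansion[OF q])
  also have "\<dots> = (\<Sum>n<m. c n * (LINT x|\<rho>. x * (poly (P n) x * poly q x)))"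
    by (simp add: mult_ac)
  also have "\<dots> = (\<Sum>n<m. c n * (a (Suc n) * c (Suc n) + b (Suc n) * c n + a n * c (n - 1)))"
    unfolding fourier_coeff_x_P c_def ..
  finally have eq: "(LINT x|\<rho>. x * (poly q x)\<^sup>2) =
    (\<Sum>n<m. c n * (a (Suc n) * c (Suc n) + b (Suc n) * c n + a n * c (n - 1)))" .
  have amgm: "\<bar>u * v\<bar> \<le> (u\<^sup>2 + v\<^sup>2) / 2" for u v :: real
    using zero_le_power2[of "\<bar>u\<bar> - \<bar>v\<bar>"] by (simp add: power2_diff abs_mult power2_abs)
  have "\<bar>LINT x|\<rho>. x * (poly q x)\<^sup>2\<bar> \<le> (\<Sum>n<m. \<bar>b (Suc n)\<bar> * (c n)\<^sup>2
      + a (Suc n) * ((c n)\<^sup>2 + (c (Suc n))\<^sup>2) / 2 + a n * ((c n)\<^sup>2 + (c (n - 1))\<^sup>2) / 2)"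
    unfolding eq
  proof (rule order_trans[OF sum_abs sum_mono])
    fix n
    have "\<bar>c n * (a (Suc n) * c (Suc n) + b (Suc n) * c n + a n * c (n - 1))\<bar>
        = \<bar>a (Suc n) * (c n * c (Suc n)) + b (Suc n) * (c n * c n) + a n * (c n * c (n - 1))\<bar>"
      by (simp add: algebra_simps)
    also have "\<dots> \<le> a (Suc n) * \<bar>c n * c (Suc n)\<bar> + \<bar>b (Suc n)\<bar> * (c n)\<^sup>2 + a n * \<bar>c n * c (n - 1)\<bar>"
      using a_nonneg by (intro order_trans[OF abs_triangle_ineq] add_mono)
        (auto simp: abs_mult power2_eq_square)
    also have "\<dots> \<le> a (Suc n) * (((c n)\<^sup>2 + (c (Suc n))\<^sup>2) / 2) + \<bar>b (Suc n)\<bar> * (c n)\<^sup>2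
        + a n * (((c n)\<^sup>2 + (c (n - 1))\<^sup>2) / 2)"
      using a_nonneg amgm by (intro add_mono mult_left_mono) auto
    finally show "\<bar>c n * (a (Suc n) * c (Suc n) + b (Suc n) * c n + a n * c (n - 1))\<bar> \<le>
       \<bar>b (Suc n)\<bar> * (c n)\<^sup>2 + a (Suc n) * ((c n)\<^sup>2 + (c (Suc n))\<^sup>2) / 2 + a n * ((c n)\<^sup>2 + (c (n - 1))\<^sup>2) / 2"
      by (simp add: mult_ac)
  qed
  also have "\<dots> \<le> (\<Sum>n<m. (\<bar>b (Suc n)\<bar> + a (Suc n) + a n) * (c n)\<^sup>2)"
  proof -
    have 1: "(\<Sum>n<m. a (Suc n) * (c (Suc n))\<^sup>2) = (\<Sum>n<m. a n * (c n)\<^sup>2)"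
    proof -
      have "(\<Sum>n<m. a (Suc n) * (c (Suc n))\<^sup>2) + a 0 * (c 0)\<^sup>2 = (\<Sum>n<Suc m. a n * (c n)\<^sup>2)"
        by (subst sum.lessThan_Suc_shift) simp
      then show ?thesis using m[of m] by (simp add: a_0 c_def)
    qed
    have 2: "(\<Sum>n<m. a n * (c (n - 1))\<^sup>2) \<le> (\<Sum>n<m. a (Suc n) * (c n)\<^sup>2)"
    proof (cases m)
      case (Suc k)
      have "(\<Sum>n<m. a n * (c (n - 1))\<^sup>2) = (\<Sum>n<k. a (Suc n) * (c n)\<^sup>2)"
        unfolding Suc by (subst sum.lessThan_Suc_shift) (simp add: a_0)
      also have "\<dots> \<le> (\<Sum>n<m. a (Suc n) * (c n)\<^sup>2)" unfolding Suc using a_nonneg by simp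
      finally show ?thesis .
    qed simp
    have "(\<Sum>n<m. \<bar>b (Suc n)\<bar> * (c n)\<^sup>2
      + a (Suc n) * ((c n)\<^sup>2 + (c (Suc n))\<^sup>2) / 2 + a n * ((c n)\<^sup>2 + (c (n - 1))\<^sup>2) / 2)
      = (\<Sum>n<m. \<bar>b (Suc n)\<bar> * (c n)\<^sup>2) + (\<Sum>n<m. a (Suc n) * (c n)\<^sup>2) / 2 + (\<Sum>n<m. a (Suc n) * (c (Suc n))\<^sup>2) / 2
       + (\<Sum>n<m. a n * (c n)\<^sup>2) / 2 + (\<Sum>n<m. a n * (c (n - 1))\<^sup>2) / 2"
      by (simp add: sum.distrib sum_divide_distrib distrib_left add_divide_distrib)
    also have "\<dots> \<le> (\<Sum>n<m. \<bar>b (Suc n)\<bar> * (c n)\<^sup>2) + (\<Sum>n<m. a (Suc n) * (c n)\<^sup>2) + (\<Sum>n<m. a n * (c n)\<^sup>2)"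
      using 1 2 by linarith
    finally show ?thesis by (simp add: sum.distrib distrib_right)
  qed
  finally show ?thesis by (simp add: c_def)
qed

lemma parseval:
  assumes q: "q = (\<Sum>k<m. smult (fourier_coeff q k) (P k))"
  shows "(LINT x|\<rho>. (poly q x)\<^sup>2) = (\<Sum>n<m. (fourier_coeff q n)\<^sup>2)"
proof -
  have "(LINT x|\<rho>. (poly q x)\<^sup>2) = (LINT x|\<rho>. poly q x * poly q x)" by (simp add: power2_eq_square)
  also have "\<dots> = (\<Sum>n<m. fourier_coeff q n * (LINT x|\<rho>. poly (P n) x * poly q x))"
    by (rule integral_expansion[OF q])
  finally show ?thesis by (simp add: fourier_coeff_def power2_eq_square mult.commute)
qed

end

locale bounded_jacobi = jacobi +
  fixes L :: real
  assumes L: "\<bar>b (Suc n)\<bar> + a (Suc n) + a n \<le> L"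
begin

lemma L_pos: "L > 0"
  using L[of 0] a_pos[of 1] a_nonneg[of 0] by simp

lemma form_le: "\<bar>LINT x|\<rho>. x * (poly q x)\<^sup>2\<bar> \<le> L * (LINT x|\<rho>. (poly q x)\<^sup>2)"
proof -
  obtain m where m: "q = (\<Sum>k<m. smult (fourier_coeff q k) (P k))" "\<forall>n\<ge>m. fourier_coeff q n = 0" using expansion by blast
  have "(\<Sum>n<m. (\<bar>b (Suc n)\<bar> + a (Suc n) + a n) * (fourier_coeff q n)\<^sup>2) \<le> (\<Sum>n<m. L * (fourier_coeff q n)\<^sup>2)"
    using L by (intro sum_mono mult_right_mono) auto
  with quadratic_form_bound[of q m] m show ?thesis by (simp add: parseval[OF m(1)] sum_distrib_left)
qed

text \<open>The bound on the quadratic form of the multiplication operator yields the same bound on its norm,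
  by polarisation with the vectors \<open>L q + x q\<close> and \<open>L q - x q\<close>.\<close>
lemma multiplication_norm_le:
  "(LINT x|\<rho>. x\<^sup>2 * (poly q x)\<^sup>2) \<le> L\<^sup>2 * (LINT x|\<rho>. (poly q x)\<^sup>2)"
proof -
  let ?A = "LINT x|\<rho>. (poly q x)\<^sup>2" and ?B = "LINT x|\<rho>. x\<^sup>2 * (poly q x)\<^sup>2"
  define u where "u = smult L q + [:0, 1:] * q"
  define v where "v = smult L q - [:0, 1:] * q"
  have i: "integrable \<rho> (\<lambda>x. (poly r x)\<^sup>2)" "integrable \<rho> (\<lambda>x. x * (poly r x)\<^sup>2)" for r
    using integrable_poly[of "r\<^sup>2"] integrable_poly[of "[:0, 1:] * r\<^sup>2"] by simp_all
  have i2: "integrable \<rho> (\<lambda>x. x\<^sup>2 * (poly q x)\<^sup>2)"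
    using integrable_poly[of "[:0, 1:]\<^sup>2 * q\<^sup>2"] by (simp add: power2_eq_square mult_ac)
  have 1: "(LINT x|\<rho>. x * (poly u x)\<^sup>2) - (LINT x|\<rho>. x * (poly v x)\<^sup>2) = 4 * L * ?B"
  proof -
    have "(LINT x|\<rho>. x * (poly u x)\<^sup>2) - (LINT x|\<rho>. x * (poly v x)\<^sup>2)
        = (LINT x|\<rho>. x * (poly u x)\<^sup>2 - x * (poly v x)\<^sup>2)" using i by simp
    also have "\<dots> = (LINT x|\<rho>. 4 * L * (x\<^sup>2 * (poly q x)\<^sup>2))"
      by (intro Bochner_Integration.integral_cong) (auto simp: u_def v_def power2_eq_square algebra_simps)
    finally show ?thesis by simp
  qed
  have 2: "(LINT x|\<rho>. (poly u x)\<^sup>2) + (LINT x|\<rho>. (poly v x)\<^sup>2) = 2 * L\<^sup>2 * ?A + 2 * ?B"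
  proof -
    have "(LINT x|\<rho>. (poly u x)\<^sup>2) + (LINT x|\<rho>. (poly v x)\<^sup>2)
        = (LINT x|\<rho>. (poly u x)\<^sup>2 + (poly v x)\<^sup>2)" using i by simp
    also have "\<dots> = (LINT x|\<rho>. 2 * L\<^sup>2 * (poly q x)\<^sup>2 + 2 * (x\<^sup>2 * (poly q x)\<^sup>2))"
      by (intro Bochner_Integration.integral_cong) (auto simp: u_def v_def power2_eq_square algebra_simps)
    finally show ?thesis using i i2 by simp
  qed
  have "4 * L * ?B \<le> L * (2 * L\<^sup>2 * ?A + 2 * ?B)"
    unfolding 1[symmetric] 2[symmetric] using form_le[of u] form_le[of v]
    by (simp add: distrib_left abs_le_iff)
  then have "4 * ?B \<le> 2 * L\<^sup>2 * ?A + 2 * ?B" using L_pos by (simp add: mult.assoc mult.left_commute[of _ L])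
  then show ?thesis by linarith
qed

lemma even_moment_le: "(LINT x|\<rho>. (x ^ k)\<^sup>2) \<le> (L ^ k)\<^sup>2"
proof (induction k)
  case 0
  then show ?case using prob_space by simp
next
  case (Suc k)
  have "(LINT x|\<rho>. (x ^ Suc k)\<^sup>2) = (LINT x|\<rho>. x\<^sup>2 * (poly (monom 1 k) x)\<^sup>2)"
    by (simp add: poly_monom power_mult_distrib)
  also have "\<dots> \<le> L\<^sup>2 * (LINT x|\<rho>. (poly (monom 1 k) x)\<^sup>2)" by (rule multiplication_norm_le)
  also have "\<dots> \<le> L\<^sup>2 * (L ^ k)\<^sup>2" using Suc by (intro mult_left_mono) (auto simp: poly_monom)
  finally show ?case by (simp add: power_mult_distrib)
qed

text \<open>The even moments grow at most like \<open>L\<^sup>2\<^sup>k\<close>, which leaves no mass where \<open>\<bar>x\<bar> > L + 1\<close> by Markov's inequality.\<close>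
lemma AE_bounded: "AE x in \<rho>. \<bar>x\<bar> \<le> L + 1"
proof -
  let ?S = "{x. L + 1 < \<bar>x\<bar>}"
  have S: "?S \<in> sets \<rho>" by simp
  have "measure \<rho> ?S \<le> ((L / (L + 1))\<^sup>2) ^ k" for k
  proof -
    have i: "integrable \<rho> (\<lambda>x. (x ^ k)\<^sup>2)" using moments[of "k * 2"] by (simp add: power_mult)
    have "(LINT x|\<rho>. ((L + 1) ^ k)\<^sup>2 * indicator ?S x) \<le> (LINT x|\<rho>. (x ^ k)\<^sup>2)"
    proof (rule integral_mono[OF _ i])
      show "integrable \<rho> (\<lambda>x. ((L + 1) ^ k)\<^sup>2 * indicator ?S x)"
        by (intro integrable_mult_right) (simp add: emeasure_eq_measure)
      fix x show "((L + 1) ^ k)\<^sup>2 * indicator ?S x \<le> (x ^ k)\<^sup>2"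
      proof (cases "x \<in> ?S")
        case True
        then have *: "(L + 1) ^ k \<le> \<bar>x\<bar> ^ k" using L_pos by (intro power_mono) auto
        have "((L + 1) ^ k)\<^sup>2 \<le> (\<bar>x\<bar> ^ k)\<^sup>2" by (rule power_mono[OF *]) (use L_pos in simp)
        then have "((L + 1) ^ k)\<^sup>2 \<le> (x ^ k)\<^sup>2" by (metis power_abs power2_abs)
          then show ?thesis using True by simp
      qed simp
    qed
    then have "((L + 1) ^ k)\<^sup>2 * measure \<rho> ?S \<le> (L ^ k)\<^sup>2" using even_moment_le[of k] by simp
    then have "measure \<rho> ?S \<le> (L ^ k)\<^sup>2 / ((L + 1) ^ k)\<^sup>2" using L_pos
      by (simp add: pos_le_divide_eq mult.commute)
    also have "\<dots> = ((L / (L + 1))\<^sup>2) ^ k" by (simp add: power_divide power_mult[symmetric] mult.commute)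
    finally show ?thesis .
  qed
  moreover have "(\<lambda>k. ((L / (L + 1))\<^sup>2) ^ k) \<longlonglongrightarrow> 0"
    using L_pos by (intro LIMSEQ_power_zero) (simp add: power_less_one_iff)
  ultimately have "measure \<rho> ?S \<le> 0" by (intro LIMSEQ_le_const) auto
  then have "emeasure \<rho> ?S = 0" using measure_nonneg[of \<rho> ?S] by (simp add: emeasure_eq_measure)
  then show ?thesis by (intro AE_I[of _ _ ?S]) auto
qed

end

context bounded_jacobi
begin

lemma abs_le_AE: "AE x in \<rho>. x \<in> {-(L + 1)..L + 1}"
  using AE_bounded by eventually_elim auto

lemma continuous_bounded:
  fixes g :: "real \<Rightarrow> real"
  assumes "continuous_on UNIV g"
  shows "\<exists>G\<ge>0. \<forall>x\<in>{-(L + 1)..L + 1}. \<bar>g x\<bar> \<le> G"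
proof -
  have "compact (g ` {-(L + 1)..L + 1})"
    by (rule compact_continuous_image[OF continuous_on_subset[OF assms]]) auto
  then have "bounded (g ` {-(L + 1)..L + 1})" by (rule compact_imp_bounded)
  then obtain G where "\<forall>y\<in>g ` {-(L + 1)..L + 1}. norm y \<le> G" unfolding bounded_iff by blast
  then have "\<forall>x\<in>{-(L + 1)..L + 1}. \<bar>g x\<bar> \<le> \<bar>G\<bar>" by force
  then show ?thesis by (intro exI[of _ "\<bar>G\<bar>"]) auto
qed

lemma borel_measurable_\<rho>: "f \<in> borel_measurable borel \<Longrightarrow> f \<in> borel_measurable \<rho>"
  by (subst measurable_cong_sets[OF sets_\<rho> refl])

lemma integrable_continuous:
  fixes g :: "real \<Rightarrow> real"
  assumes "continuous_on UNIV g"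
  shows "integrable \<rho> g"
proof -
  obtain G where "G \<ge> 0" "\<forall>x\<in>{-(L + 1)..L + 1}. \<bar>g x\<bar> \<le> G" using continuous_bounded[OF assms] by blast
  then show ?thesis
    using abs_le_AE borel_measurable_\<rho>[OF borel_measurable_continuous_onI[OF assms]]
    by (intro integrable_const_bound[of _ G]) auto
qed

lemma polynomial_approximation:
  fixes g :: "real \<Rightarrow> real"
  assumes g: "continuous_on UNIV g"
  shows "\<exists>q. \<forall>r j. (\<lambda>k. LINT x|\<rho>. poly r x * (poly (q k) x) ^ j) \<longlonglongrightarrow> (LINT x|\<rho>. poly r x * (g x) ^ j)"
proof -
  have "\<exists>q. \<forall>x\<in>{-(L + 1)..L + 1}. \<bar>g x - poly q x\<bar> < 1 / real (Suc k)" for k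
    by (intro poly_uniform_approximation continuous_on_subset[OF g]) auto
  then obtain q where q: "\<And>k x. x \<in> {-(L + 1)..L + 1} \<Longrightarrow> \<bar>g x - poly (q k) x\<bar> < 1 / real (Suc k)"
    by metis
  obtain G where G: "G \<ge> 0" "\<And>x. x \<in> {-(L + 1)..L + 1} \<Longrightarrow> \<bar>g x\<bar> \<le> G" using continuous_bounded[OF g] by blast
  have "(\<lambda>k. LINT x|\<rho>. poly r x * (poly (q k) x) ^ j) \<longlonglongrightarrow> (LINT x|\<rho>. poly r x * (g x) ^ j)" for r j
  proof (rule integral_dominated_convergence)
    show "integrable \<rho> (\<lambda>x. \<bar>poly r x\<bar> * (G + 1) ^ j)"
      by (intro integrable_mult_left integrable_abs integrable_poly)
    show "(\<lambda>x. poly r x * g x ^ j) \<in> borel_measurable \<rho>"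
      by (intro borel_measurable_\<rho> borel_measurable_continuous_onI continuous_intros g)
    show "(\<lambda>x. poly r x * poly (q k) x ^ j) \<in> borel_measurable \<rho>" for k
      by (intro borel_measurable_\<rho> borel_measurable_continuous_onI continuous_intros)
    show "AE x in \<rho>. (\<lambda>k. poly r x * poly (q k) x ^ j) \<longlonglongrightarrow> poly r x * g x ^ j"
      using abs_le_AE
    proof eventually_elim
      case (elim x)
      have "(\<lambda>k. poly (q k) x) \<longlonglongrightarrow> g x"
      proof (rule LIMSEQ_I)
        fix e :: real assume "e > 0"
        then obtain N where N: "inverse (real (Suc N)) < e" using reals_Archimedean by blast
        show "\<exists>N. \<forall>k\<ge>N. norm (poly (q k) x - g x) < e"
        proof (intro exI allI impI)
          fix k assume "N \<le> k"
          then have "1 / real (Suc k) \<le> 1 / real (Suc N)" by (simp add: frac_le)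
          then show "norm (poly (q k) x - g x) < e" using q[OF elim, of k] N
            by (simp add: abs_minus_commute inverse_eq_divide)
        qed
      qed
      then show ?case by (intro tendsto_intros)
    qed
    show "AE x in \<rho>. norm (poly r x * poly (q k) x ^ j) \<le> \<bar>poly r x\<bar> * (G + 1) ^ j" for k
      using abs_le_AE
    proof eventually_elim
      case (elim x)
      have "1 / real (Suc k) \<le> 1" by simp
      then have "\<bar>poly (q k) x\<bar> \<le> G + 1" using q[OF elim, of k] G(2)[OF elim] by linarith
      then have "\<bar>poly (q k) x\<bar> ^ j \<le> (G + 1) ^ j" by (intro power_mono) auto
      then show ?case by (simp add: abs_mult power_abs mult_left_mono)
    qed
  qed
  then show ?thesis by blast
qed

text \<open>Only the first \<open>N\<close> coefficients of \<open>g\<close> see the large rows of the Jacobi matrix. For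
  polynomials this is the row sum bound; continuous functions are limits of polynomials on the
  compact support of the measure.\<close>
lemma form_le_compact_perturbation:
  fixes g :: "real \<Rightarrow> real"
  assumes g: "continuous_on UNIV g" and c: "\<And>n. n \<ge> N \<Longrightarrow> \<bar>b (Suc n)\<bar> + a (Suc n) + a n \<le> c" "c \<ge> 0"
  shows "\<bar>LINT x|\<rho>. x * (g x)\<^sup>2\<bar> \<le> c * (LINT x|\<rho>. (g x)\<^sup>2) + L * (\<Sum>n<N. (LINT x|\<rho>. poly (P n) x * g x)\<^sup>2)"
proof -
  have poly: "\<bar>LINT x|\<rho>. x * (poly q x)\<^sup>2\<bar> \<le> c * (LINT x|\<rho>. (poly q x)\<^sup>2)
      + L * (\<Sum>n<N. (LINT x|\<rho>. poly (P n) x * poly q x)\<^sup>2)" for q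
  proof -
    obtain m where m: "q = (\<Sum>k<m. smult (fourier_coeff q k) (P k))" "\<forall>n\<ge>m. fourier_coeff q n = 0" using expansion by blast
    have "(\<Sum>n<m. (\<bar>b (Suc n)\<bar> + a (Suc n) + a n) * (fourier_coeff q n)\<^sup>2)
        \<le> (\<Sum>n<m. c * (fourier_coeff q n)\<^sup>2 + (if n < N then L * (fourier_coeff q n)\<^sup>2 else 0))"
    proof (rule sum_mono)
      fix n
      show "(\<bar>b (Suc n)\<bar> + a (Suc n) + a n) * (fourier_coeff q n)\<^sup>2 \<le> c * (fourier_coeff q n)\<^sup>2 + (if n < N then L * (fourier_coeff q n)\<^sup>2 else 0)"
      proof (cases "n < N")
        case True
        have "(\<bar>b (Suc n)\<bar> + a (Suc n) + a n) * (fourier_coeff q n)\<^sup>2 \<le> L * (fourier_coeff q n)\<^sup>2" using L by (intro mult_right_mono) auto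
        moreover have "0 \<le> c * (fourier_coeff q n)\<^sup>2" using c by simp
        ultimately show ?thesis using True by simp
      next
        case False
        then show ?thesis using c by (auto intro!: mult_right_mono)
      qed
    qed
    also have "\<dots> = c * (\<Sum>n<m. (fourier_coeff q n)\<^sup>2) + (\<Sum>n<m. if n < N then L * (fourier_coeff q n)\<^sup>2 else 0)"
      by (simp add: sum.distrib sum_distrib_left)
    also have "(\<Sum>n<m. if n < N then L * (fourier_coeff q n)\<^sup>2 else 0) = (\<Sum>n\<in>{..<m} \<inter> {n. n < N}. L * (fourier_coeff q n)\<^sup>2)"
      by (subst sum.inter_restrict) auto
    also have "\<dots> \<le> (\<Sum>n<N. L * (fourier_coeff q n)\<^sup>2)"
      using L_pos by (intro sum_mono2) auto
    finally show ?thesis using quadratic_form_bound[of q m] m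
      by (simp add: parseval[OF m(1)] sum_distrib_left fourier_coeff_def mult.commute)
  qed
  obtain q where q: "\<And>r j. (\<lambda>k. LINT x|\<rho>. poly r x * (poly (q k) x) ^ j) \<longlonglongrightarrow> (LINT x|\<rho>. poly r x * (g x) ^ j)"
    using polynomial_approximation[OF g] by blast
  show ?thesis
  proof (rule LIMSEQ_le)
    show "(\<lambda>k. \<bar>LINT x|\<rho>. x * (poly (q k) x)\<^sup>2\<bar>) \<longlonglongrightarrow> \<bar>LINT x|\<rho>. x * (g x)\<^sup>2\<bar>"
      using q[of "[:0, 1:]" 2] by (intro tendsto_rabs) simp
    show "(\<lambda>k. c * (LINT x|\<rho>. (poly (q k) x)\<^sup>2) + L * (\<Sum>n<N. (LINT x|\<rho>. poly (P n) x * poly (q k) x)\<^sup>2))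
      \<longlonglongrightarrow> c * (LINT x|\<rho>. (g x)\<^sup>2) + L * (\<Sum>n<N. (LINT x|\<rho>. poly (P n) x * g x)\<^sup>2)"
      using q[of 1 2] q[of "P _" 1] by (intro tendsto_intros) simp_all
  qed (use poly in auto)
qed

end

text \<open>The Nevai class: the coefficients tend to those of the free Jacobi matrix.\<close>
locale nevai = bounded_jacobi +
  assumes a_lim: "a \<longlonglongrightarrow> 1" and b_lim: "b \<longlonglongrightarrow> 0"
begin

text \<open>A bump \<open>g\<close> around \<open>x0\<close> satisfies \<open>\<bar>\<integral> x g\<^sup>2 d\<rho>\<bar> \<ge> (2 + 2 * \<epsilon>) \<integral> g\<^sup>2 d\<rho>\<close>, whereas the Jacobi matrix is bounded
  by \<open>2 + \<epsilon>\<close> off the span of \<open>p\<^sub>0, ..., p\<^sub>N\<^sub>-\<^sub>1\<close>. So the finitely many coefficients \<open>\<integral> p\<^sub>n g d\<rho>\<close> must carry a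
  fixed fraction of \<open>\<integral> g\<^sup>2 d\<rho>\<close>. By the Cauchy-Schwarz inequality the squares of the coefficients are at
  most \<open>const * \<rho>(B) * \<integral> g\<^sup>2 d\<rho>\<close>, where \<open>B\<close> contains the support of \<open>g\<close>. When \<open>x0\<close> is not an atom,
  \<open>\<rho>(B)\<close> is small for small \<open>B\<close>, and \<open>\<integral> g\<^sup>2 d\<rho> = 0\<close> follows.\<close>
lemma no_continuous_mass_outside:
  assumes x0: "\<bar>x0\<bar> > 2" and atom: "measure \<rho> {x0} = 0"
  shows "\<exists>\<delta>>0. emeasure \<rho> (ball x0 \<delta>) = 0"
proof -
  define \<epsilon> where "\<epsilon> = (\<bar>x0\<bar> - 2) / 3"
  have \<epsilon>: "\<epsilon> > 0" "\<bar>x0\<bar> = 2 + 3 * \<epsilon>" using x0 by (auto simp: \<epsilon>_def field_simps)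
  \<comment> \<open>The sign reduces the negative half-line to the positive one.\<close>
  define s where "s = sgn x0"
  have s: "s * x0 = \<bar>x0\<bar>" "\<bar>s\<bar> = 1" using x0 by (auto simp: s_def abs_sgn sgn_if)
  have "(\<lambda>n. \<bar>b (Suc n)\<bar> + a (Suc n) + a n) \<longlonglongrightarrow> \<bar>0\<bar> + 1 + 1"
    by (intro tendsto_intros LIMSEQ_Suc a_lim b_lim)
  then have "\<forall>\<^sub>F n in sequentially. \<bar>b (Suc n)\<bar> + a (Suc n) + a n < 2 + \<epsilon>"
    by (rule order_tendstoD) (use \<epsilon> in simp)
  then obtain N where N: "\<And>n. n \<ge> N \<Longrightarrow> \<bar>b (Suc n)\<bar> + a (Suc n) + a n \<le> 2 + \<epsilon>"
    unfolding eventually_sequentially by (meson less_imp_le)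
  define I where "I = {x0 - \<epsilon>..x0 + \<epsilon>}"
  have "\<exists>K\<ge>0. \<forall>x\<in>I. \<bar>poly (P n) x\<bar> \<le> K" for n
  proof -
    have "compact ((\<lambda>x. poly (P n) x) ` I)"
      unfolding I_def by (intro compact_continuous_image continuous_intros compact_Icc)
    then have "bounded ((\<lambda>x. poly (P n) x) ` I)" by (rule compact_imp_bounded)
    then obtain K where "\<forall>y\<in>(\<lambda>x. poly (P n) x) ` I. norm y \<le> K" unfolding bounded_iff by blast
    then have "\<forall>x\<in>I. \<bar>poly (P n) x\<bar> \<le> \<bar>K\<bar>" by force
    then show ?thesis by (intro exI[of _ "\<bar>K\<bar>"]) auto
  qed
  then obtain K where K: "\<And>n. K n \<ge> 0" "\<And>n x. x \<in> I \<Longrightarrow> \<bar>poly (P n) x\<bar> \<le> K n" by metis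
  define K' where "K' = L * (\<Sum>n<N. (K n)\<^sup>2)"
  have K': "K' \<ge> 0" using L_pos by (simp add: K'_def sum_nonneg)
  have "(\<lambda>k. measure \<rho> (ball x0 (1 / real (Suc k)))) \<longlonglongrightarrow> measure \<rho> (\<Inter>k. ball x0 (1 / real (Suc k)))"
    by (intro finite_Lim_measure_decseq) (auto simp: decseq_def intro!: subset_ball frac_le)
  also have "(\<Inter>k. ball x0 (1 / real (Suc k))) = {x0}"
  proof (intro equalityI subsetI)
    fix y assume y: "y \<in> (\<Inter>k. ball x0 (1 / real (Suc k)))"
    show "y \<in> {x0}"
    proof (rule ccontr)
      assume "y \<notin> {x0}"
      then have "dist x0 y > 0" by simp
      then obtain k where "inverse (real (Suc k)) < dist x0 y" using reals_Archimedean by blast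
      moreover have "y \<in> ball x0 (1 / real (Suc k))" using y by blast
      ultimately show False by (simp add: inverse_eq_divide)
    qed
  qed auto
  finally have "(\<lambda>k. K' * measure \<rho> (ball x0 (1 / real (Suc k)))) \<longlonglongrightarrow> K' * 0"
    unfolding atom by (intro tendsto_intros)
  then have "\<forall>\<^sub>F k in sequentially. K' * measure \<rho> (ball x0 (1 / real (Suc k))) < \<epsilon>"
    by (rule order_tendstoD) (use \<epsilon> in simp)
  moreover have "\<forall>\<^sub>F k in sequentially. 1 / real (Suc k) < \<epsilon>"
    using order_tendstoD(2)[OF LIMSEQ_inverse_real_of_nat \<epsilon>(1)] by (simp add: inverse_eq_divide)
  ultimately have "\<forall>\<^sub>F k in sequentially. K' * measure \<rho> (ball x0 (1 / real (Suc k))) < \<epsilon> \<and> 1 / real (Suc k) < \<epsilon>"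
    by eventually_elim auto
  then obtain k where k: "K' * measure \<rho> (ball x0 (1 / real (Suc k))) < \<epsilon>" "1 / real (Suc k) < \<epsilon>"
    unfolding eventually_sequentially by blast
  define \<delta> where "\<delta> = 1 / real (Suc k)"
  define B where "B = ball x0 \<delta>"
  have \<delta>: "\<delta> > 0" "\<delta> < \<epsilon>" "K' * measure \<rho> B < \<epsilon>" using k by (auto simp: \<delta>_def B_def)
  \<comment> \<open>A tent over the ball of radius \<open>\<delta>\<close>, positive exactly there.\<close>
  define g where "g = (\<lambda>x. max 0 (1 - \<bar>x - x0\<bar> / \<delta>))"
  have g: "continuous_on UNIV g" unfolding g_def using \<delta> by (intro continuous_intros) auto
  have g0: "0 \<le> g x" "g x \<le> 1" for x using \<delta> by (auto simp: g_def)
  have gB: "g x = 0" if "x \<notin> B" for x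
    using that \<delta> by (auto simp: g_def B_def dist_real_def abs_minus_commute max_def field_simps)
  have gx: "(2 + 2 * \<epsilon>) * (g x)\<^sup>2 \<le> s * x * (g x)\<^sup>2" for x
  proof (cases "x \<in> B")
    case True
    have "\<bar>s * (x - x0)\<bar> < \<delta>" using True s(2) by (simp add: abs_mult B_def dist_real_def abs_minus_commute)
    moreover have "s * x = s * x0 + s * (x - x0)" by (simp add: algebra_simps)
    ultimately have "2 + 2 * \<epsilon> \<le> s * x" using s(1) \<epsilon> \<delta>(2) by (simp add: abs_less_iff)
    then show ?thesis by (intro mult_right_mono) auto
  qed (simp add: gB)
  have i1: "integrable \<rho> g" "integrable \<rho> (\<lambda>x. (g x)\<^sup>2)" "integrable \<rho> (\<lambda>x. x * (g x)\<^sup>2)"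
    "integrable \<rho> (\<lambda>x. poly (P n) x * g x)" for n
    by (intro integrable_continuous continuous_intros g)+
  define A where "A = (LINT x|\<rho>. (g x)\<^sup>2)"
  have A0: "A \<ge> 0" unfolding A_def by simp
  have "(2 + 2 * \<epsilon>) * A \<le> s * (LINT x|\<rho>. x * (g x)\<^sup>2)"
  proof -
    have "(2 + 2 * \<epsilon>) * A = (LINT x|\<rho>. (2 + 2 * \<epsilon>) * (g x)\<^sup>2)" by (simp add: A_def)
    also have "\<dots> \<le> (LINT x|\<rho>. s * (x * (g x)\<^sup>2))"
      using i1 gx by (intro integral_mono integrable_mult_right) (auto simp: mult.assoc)
    finally show ?thesis by simp
  qed
  also have "\<dots> \<le> \<bar>LINT x|\<rho>. x * (g x)\<^sup>2\<bar>" using s(2) by (metis abs_ge_self abs_mult mult_1)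
  also have "\<dots> \<le> (2 + \<epsilon>) * A + L * (\<Sum>n<N. (LINT x|\<rho>. poly (P n) x * g x)\<^sup>2)"
    unfolding A_def using N \<epsilon> by (intro form_le_compact_perturbation g) auto
  finally have 1: "\<epsilon> * A \<le> L * (\<Sum>n<N. (LINT x|\<rho>. poly (P n) x * g x)\<^sup>2)" by (simp add: algebra_simps)
  have 2: "(LINT x|\<rho>. g x)\<^sup>2 \<le> measure \<rho> B * A"
  proof (cases "A = 0")
    case True
    then have "AE x in \<rho>. (g x)\<^sup>2 = 0"
      using integral_nonneg_eq_0_iff_AE[OF i1(2)] by (simp add: A_def)
    then have "(LINT x|\<rho>. g x) = (LINT x|\<rho>. 0)"
      using i1(1) by (intro integral_cong_AE) auto
    then show ?thesis using True by simp
  next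
    case False
    \<comment> \<open>The minimiser of the nonnegative quadratic polynomial behind the Cauchy-Schwarz inequality.\<close>
    define t where "t = (LINT x|\<rho>. g x) / A"
    have ib: "integrable \<rho> (indicator B :: real \<Rightarrow> real)" by (simp add: B_def emeasure_eq_measure)
    have "0 \<le> (LINT x|\<rho>. (t * g x - indicator B x)\<^sup>2)" by simp
    also have "\<dots> = (LINT x|\<rho>. t\<^sup>2 * (g x)\<^sup>2 - 2 * t * g x + indicator B x)"
      by (intro Bochner_Integration.integral_cong) (auto simp: gB power2_eq_square algebra_simps indicator_def)
    also have "\<dots> = t\<^sup>2 * A - 2 * t * (LINT x|\<rho>. g x) + measure \<rho> B"
      using i1 ib by (simp add: A_def)
    also have "\<dots> = measure \<rho> B - (LINT x|\<rho>. g x)\<^sup>2 / A"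
      using False by (simp add: t_def power2_eq_square field_simps)
    finally show ?thesis using False A0 by (simp add: field_simps)
  qed
  have "(LINT x|\<rho>. poly (P n) x * g x)\<^sup>2 \<le> (K n)\<^sup>2 * (measure \<rho> B * A)" for n
  proof -
    have "\<bar>LINT x|\<rho>. poly (P n) x * g x\<bar> \<le> (LINT x|\<rho>. \<bar>poly (P n) x * g x\<bar>)" by (rule integral_abs_bound)
    also have "\<dots> \<le> (LINT x|\<rho>. K n * g x)"
    proof (intro integral_mono integrable_abs integrable_mult_right i1)
      fix x
      show "\<bar>poly (P n) x * g x\<bar> \<le> K n * g x"
      proof (cases "x \<in> B")
        case True
        then have "x \<in> I" using \<delta> by (auto simp: B_def I_def dist_real_def)
        then show ?thesis using K(2)[of x n] g0[of x] by (simp add: abs_mult mult_right_mono)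
      qed (simp add: gB)
    qed
    finally have "\<bar>LINT x|\<rho>. poly (P n) x * g x\<bar> \<le> K n * (LINT x|\<rho>. g x)" by simp
    then have "(\<bar>LINT x|\<rho>. poly (P n) x * g x\<bar>)\<^sup>2 \<le> (K n * (LINT x|\<rho>. g x))\<^sup>2" by (intro power_mono) auto
    also have "\<dots> \<le> (K n)\<^sup>2 * (measure \<rho> B * A)" unfolding power_mult_distrib using 2 by (intro mult_left_mono) auto
    finally show ?thesis by simp
  qed
  then have "L * (\<Sum>n<N. (LINT x|\<rho>. poly (P n) x * g x)\<^sup>2) \<le> L * (\<Sum>n<N. (K n)\<^sup>2 * (measure \<rho> B * A))"
    using L_pos by (intro mult_left_mono sum_mono) auto
  also have "\<dots> = (K' * measure \<rho> B) * A" by (simp add: K'_def sum_distrib_right mult.assoc)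
  finally have "\<epsilon> * A \<le> (K' * measure \<rho> B) * A" using 1 by linarith
  then have "(\<epsilon> - K' * measure \<rho> B) * A \<le> 0" by (simp add: algebra_simps)
  then have "A = 0" using \<delta>(3) A0 by (simp add: mult_le_0_iff)
  then have "AE x in \<rho>. (g x)\<^sup>2 = 0"
    using integral_nonneg_eq_0_iff_AE[OF i1(2)] by (simp add: A_def)
  then have "AE x in \<rho>. x \<notin> B"
  proof eventually_elim
    case (elim x)
    then have "g x = 0" by simp
    then show ?case using \<delta>(1) by (auto simp: g_def B_def dist_real_def abs_minus_commute max_def field_simps split: if_splits)
  qed
  then have "emeasure \<rho> B = 0" by (subst (asm) AE_iff_measurable[of B]) (auto simp: B_def)
  then show ?thesis using \<delta>(1) unfolding B_def by blast
qed

end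

section \<open>The weak limit of the amplitude\<close>

lemma integral_cos_multiple:
  "integral {0..pi} (\<lambda>\<theta>. cos ((real i - real j) * \<theta>)) = (if i = j then pi else 0)"
proof (cases "i = j")
  case False
  define m where "m = real i - real j"
  have m: "m \<noteq> 0" using False by (simp add: m_def)
  have "((\<lambda>\<theta>. cos (m * \<theta>)) has_integral (sin (m * pi) / m - sin (m * 0) / m)) {0..pi}"
  proof (rule fundamental_theorem_of_calculus)
    fix x show "((\<lambda>\<theta>. sin (m * \<theta>) / m) has_vector_derivative cos (m * x)) (at x within {0..pi})"
      using m by (auto intro!: derivative_eq_intros simp flip: has_real_derivative_iff_has_vector_derivative)
  qed simp
  moreover have "sin (m * pi) = 0"
    using sin_npi_int[of "int i - int j"] by (simp add: m_def mult.commute)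
  ultimately show ?thesis using False by (simp add: m_def integral_unique)
qed simp

text \<open>Substitute \<open>x = 2 * cos \<theta>\<close>, which reverses the orientation.\<close>
lemma semicircle_substitution:
  fixes f :: "real \<Rightarrow> real"
  assumes f: "continuous_on {-2..2} f"
  shows "integral {-2..2} (\<lambda>x. f x * sqrt (4 - x\<^sup>2)) = integral {0..pi} (\<lambda>\<theta>. f (2 * cos \<theta>) * (4 * (sin \<theta>)\<^sup>2))"
proof -
  let ?F = "\<lambda>x. f x * sqrt (4 - x\<^sup>2)"
  have "((\<lambda>\<theta>. (- 2 * sin \<theta>) *\<^sub>R ?F (2 * cos \<theta>)) has_integral
      (integral {2 * cos 0..2 * cos pi} ?F - integral {2 * cos pi..2 * cos 0} ?F)) {0..pi}"
  proof (rule has_integral_substitution_general[of "{}" 0 pi _ "-2" 2])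
    show "(\<lambda>\<theta>. 2 * cos \<theta>) ` {0..pi} \<subseteq> {-2..2::real}"
      using cos_ge_minus_one by (auto simp: abs_le_iff)
    show "continuous_on {- 2..2} ?F" by (intro continuous_intros f)
  qed (auto intro!: derivative_eq_intros continuous_intros)
  then have "((\<lambda>\<theta>. - (2 * sin \<theta> * ?F (2 * cos \<theta>))) has_integral - integral {-2..2} ?F) {0..pi}"
    by simp
  then have "((\<lambda>\<theta>. 2 * sin \<theta> * ?F (2 * cos \<theta>)) has_integral integral {-2..2} ?F) {0..pi}"
    by (simp only: has_integral_neg_iff minus_minus)
  then have "((\<lambda>\<theta>. f (2 * cos \<theta>) * (4 * (sin \<theta>)\<^sup>2)) has_integral integral {-2..2} ?F) {0..pi}"
  proof (rule has_integral_eq[rotated])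
    fix \<theta> assume t: "\<theta> \<in> {0..pi}"
    have "4 - (2 * cos \<theta>)\<^sup>2 = (2 * sin \<theta>)\<^sup>2" 
      by (simp add: power_mult_distrib cos_squared_eq)
    then have "sqrt (4 - (2 * cos \<theta>)\<^sup>2) = \<bar>2 * sin \<theta>\<bar>" by (simp only: real_sqrt_abs)
    then have "sqrt (4 - (2 * cos \<theta>)\<^sup>2) = 2 * sin \<theta>" using t sin_ge_zero[of \<theta>] by simp
    then show "2 * sin \<theta> * ?F (2 * cos \<theta>) = f (2 * cos \<theta>) * (4 * (sin \<theta>)\<^sup>2)"
      by (simp add: power2_eq_square)
  qed
  then show ?thesis by (simp add: integral_unique)
qed

text \<open>The limit of \<open>\<integral> q p\<^sub>n\<^sub>+\<^sub>i p\<^sub>n\<^sub>+\<^sub>j d\<rho>\<close>: the matrix elements of \<open>q\<close> of the free Jacobi matrix on the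
  integers, diagonalised by the Fourier transform.\<close>
definition chebyshev_moment :: "real poly \<Rightarrow> nat \<Rightarrow> nat \<Rightarrow> real" where
  "chebyshev_moment q i j = integral {0..pi} (\<lambda>\<theta>. poly q (2 * cos \<theta>) * cos ((real i - real j) * \<theta>)) / pi"

lemma integrable_trig_poly:
  "(\<lambda>\<theta>. poly q (2 * cos \<theta>) * cos (m * \<theta>)) integrable_on {0..pi}"
  by (intro integrable_continuous_real continuous_intros)

lemma chebyshev_moment_pCons:
  "chebyshev_moment (pCons c q) i j =
    (if i = j then c else 0) + chebyshev_moment q (i + 2) (j + 1) + chebyshev_moment q i (j + 1)"
proof -
  let ?m = "real i - real j"
  have eq: "poly (pCons c q) (2 * cos \<theta>) * cos (?m * \<theta>) = c * cos (?m * \<theta>)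
     + (poly q (2 * cos \<theta>) * cos ((real (i + 2) - real (j + 1)) * \<theta>)
     + poly q (2 * cos \<theta>) * cos ((real i - real (j + 1)) * \<theta>))" for \<theta>
  proof -
    have "cos ((real (i + 2) - real (j + 1)) * \<theta>) + cos ((real i - real (j + 1)) * \<theta>)
        = cos (?m * \<theta> + \<theta>) + cos (?m * \<theta> - \<theta>)" by (simp add: algebra_simps)
    also have "\<dots> = 2 * cos \<theta> * cos (?m * \<theta>)" by (simp add: cos_add cos_diff)
    finally have "cos ((real (i + 2) - real (j + 1)) * \<theta>) + cos ((real i - real (j + 1)) * \<theta>)
      = 2 * cos \<theta> * cos (?m * \<theta>)" .
    then show ?thesis by (simp add: distrib_left[symmetric] algebra_simps del: of_nat_add)
  qed
  have i: "(\<lambda>\<theta>. c * cos (?m * \<theta>)) integrable_on {0..pi}"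
    by (intro integrable_continuous_real continuous_intros)
  have "integral {0..pi} (\<lambda>\<theta>. poly (pCons c q) (2 * cos \<theta>) * cos (?m * \<theta>)) =
      integral {0..pi} (\<lambda>\<theta>. c * cos (?m * \<theta>))
      + (integral {0..pi} (\<lambda>\<theta>. poly q (2 * cos \<theta>) * cos ((real (i + 2) - real (j + 1)) * \<theta>))
      + integral {0..pi} (\<lambda>\<theta>. poly q (2 * cos \<theta>) * cos ((real i - real (j + 1)) * \<theta>)))"
    unfolding eq using i integrable_trig_poly
    by (simp add: integral_add integrable_add del: of_nat_add)
  also have "integral {0..pi} (\<lambda>\<theta>. c * cos (?m * \<theta>)) = c * (if i = j then pi else 0)"
    by (simp only: integral_mult_right integral_cos_multiple)
  finally show ?thesis unfolding chebyshev_moment_def by (simp add: add_divide_distrib del: of_nat_add)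
qed

context nevai
begin

definition moment :: "real poly \<Rightarrow> nat \<Rightarrow> nat \<Rightarrow> real" where
  "moment q k l = (LINT x|\<rho>. poly q x * (poly (P k) x * poly (P l) x))"

lemma integrable_moment: "integrable \<rho> (\<lambda>x. poly q x * (poly (P k) x * poly (P l) x))"
  using integrable_poly_mult3 by (simp add: mult.assoc)

lemma moment_pCons:
  "moment (pCons c q) (Suc k) l = (if Suc k = l then c else 0) + a (Suc (Suc k)) * moment q (Suc (Suc k)) l
     + b (Suc (Suc k)) * moment q (Suc k) l + a (Suc k) * moment q k l"
proof -
  have "poly (pCons c q) x * (poly (P (Suc k)) x * poly (P l) x) = c * (poly (P (Suc k)) x * poly (P l) x)
     + a (Suc (Suc k)) * (poly q x * (poly (P (Suc (Suc k))) x * poly (P l) x))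
     + b (Suc (Suc k)) * (poly q x * (poly (P (Suc k)) x * poly (P l) x))
     + a (Suc k) * (poly q x * (poly (P k) x * poly (P l) x))" for x
  proof -
    have "poly (pCons c q) x * (poly (P (Suc k)) x * poly (P l) x) = c * (poly (P (Suc k)) x * poly (P l) x)
      + poly q x * (x * poly (P (Suc k)) x) * poly (P l) x" by (simp add: algebra_simps)
    then show ?thesis unfolding recurrence_poly by (simp add: algebra_simps)
  qed
  then show ?thesis unfolding moment_def
    by (simp add: integrable_moment integrable_poly_mult integrable_mult_right orthonormality)
qed

text \<open>The recurrence for \<open>p\<^sub>n\<close> gives a recursion in the degree of \<open>q\<close> with the coefficients of the
  Jacobi matrix, and the addition theorem for the cosine gives the limiting recursion.\<close>
lemma moment_tendsto: "(\<lambda>n. moment q (n + i) (n + j)) \<longlonglongrightarrow> chebyshev_moment q i j"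
proof (induction q arbitrary: i j rule: pCons_induct)
  case 0
  then show ?case by (simp add: moment_def chebyshev_moment_def)
next
  case (pCons c q)
  have al: "(\<lambda>n. a (n + k)) \<longlonglongrightarrow> 1" and bl: "(\<lambda>n. b (n + k)) \<longlonglongrightarrow> 0" for k
    by (intro LIMSEQ_ignore_initial_segment a_lim b_lim)+
  have "(\<lambda>n. (if i = j then c else 0) + a (n + (i + 2)) * moment q (n + (i + 2)) (n + (j + 1))
     + b (n + (i + 2)) * moment q (n + (i + 1)) (n + (j + 1)) + a (n + (i + 1)) * moment q (n + i) (n + (j + 1)))
     \<longlonglongrightarrow> (if i = j then c else 0) + 1 * chebyshev_moment q (i + 2) (j + 1)
     + 0 * chebyshev_moment q (i + 1) (j + 1) + 1 * chebyshev_moment q i (j + 1)"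
    by (intro tendsto_add tendsto_mult tendsto_const al bl pCons.IH)
  then have "(\<lambda>n. moment (pCons c q) (Suc n + i) (Suc n + j)) \<longlonglongrightarrow> chebyshev_moment (pCons c q) i j"
    by (simp add: moment_pCons chebyshev_moment_pCons)
  then show ?case by (rule LIMSEQ_imp_Suc)
qed

text \<open>For \<open>\<bar>x\<bar> < 2\<close> this is \<open>\<bar>a\<^sub>n p\<^sub>n - cnj z p\<^sub>n\<^sub>-\<^sub>1\<bar>\<^sup>2\<close>. Outside \<open>[-2,2]\<close> the quadratic form is indefinite.\<close>
definition amplitude :: "nat \<Rightarrow> real \<Rightarrow> real" where
  "amplitude n x = (a n * poly (P n) x)\<^sup>2 - x * (a n * poly (P n) x) * poly (P (n - 1)) x + (poly (P (n - 1)) x)\<^sup>2"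

lemma integral_poly_amplitude:
  "(LINT x|\<rho>. poly q x * amplitude (Suc n) x) =
    (a (Suc n))\<^sup>2 * moment q (Suc n) (Suc n) - a (Suc n) * moment (pCons 0 q) (Suc n) n + moment q n n"
proof -
  have "poly q x * amplitude (Suc n) x = (a (Suc n))\<^sup>2 * (poly q x * (poly (P (Suc n)) x * poly (P (Suc n)) x))
     - a (Suc n) * (poly (pCons 0 q) x * (poly (P (Suc n)) x * poly (P n) x))
     + poly q x * (poly (P n) x * poly (P n) x)" for x
    by (simp add: amplitude_def power2_eq_square algebra_simps)
  then show ?thesis unfolding moment_def
    using integrable_moment[of q] integrable_moment[of "pCons 0 q"]
    by (simp del: poly_pCons)
qed

text \<open>The three terms of the amplitude have limits with the kernels \<open>1\<close>, \<open>- 2 * cos \<theta> * cos \<theta>\<close> and \<open>1\<close>,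
  whose sum is \<open>2 * (sin \<theta>)\<^sup>2\<close>, the semicircle density in the variable \<open>\<theta>\<close>.\<close>
lemma poly_amplitude_tendsto:
  "(\<lambda>n. LINT x|\<rho>. poly q x * amplitude (Suc n) x) \<longlonglongrightarrow>
    integral {-2..2} (\<lambda>x. poly q x * sqrt (4 - x\<^sup>2)) / (2 * pi)"
proof -
  have al: "(\<lambda>n. a (Suc n)) \<longlonglongrightarrow> 1" by (rule LIMSEQ_Suc[OF a_lim])
  have "(\<lambda>n. (a (Suc n))\<^sup>2 * moment q (n + 1) (n + 1) - a (Suc n) * moment (pCons 0 q) (n + 1) (n + 0)
      + moment q (n + 0) (n + 0)) \<longlonglongrightarrow>
    1\<^sup>2 * chebyshev_moment q 1 1 - 1 * chebyshev_moment (pCons 0 q) 1 0 + chebyshev_moment q 0 0"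
    by (intro tendsto_add tendsto_diff tendsto_mult tendsto_power al moment_tendsto)
  also have "1\<^sup>2 * chebyshev_moment q 1 1 - 1 * chebyshev_moment (pCons 0 q) 1 0 + chebyshev_moment q 0 0
      = (integral {0..pi} (\<lambda>\<theta>. poly q (2 * cos \<theta>) * cos (0 * \<theta>))
        - integral {0..pi} (\<lambda>\<theta>. poly q (2 * cos \<theta>) * cos (2 * \<theta>))) / pi"
    by (simp add: chebyshev_moment_pCons) (simp add: chebyshev_moment_def diff_divide_distrib)
  also have "integral {0..pi} (\<lambda>\<theta>. poly q (2 * cos \<theta>) * cos (0 * \<theta>))
        - integral {0..pi} (\<lambda>\<theta>. poly q (2 * cos \<theta>) * cos (2 * \<theta>))
      = integral {0..pi} (\<lambda>\<theta>. poly q (2 * cos \<theta>) * cos (0 * \<theta>) - poly q (2 * cos \<theta>) * cos (2 * \<theta>))"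
    by (intro integral_diff[symmetric] integrable_trig_poly)
  also have "\<dots> = integral {0..pi} (\<lambda>\<theta>. poly q (2 * cos \<theta>) * (4 * (sin \<theta>)\<^sup>2) / 2)"
    by (intro integral_cong) (simp add: cos_double_sin right_diff_distrib)
  also have "\<dots> = integral {-2..2} (\<lambda>x. poly q x * sqrt (4 - x\<^sup>2)) / 2"
    unfolding integral_divide by (subst semicircle_substitution) (auto intro!: continuous_intros)
  finally show ?thesis unfolding integral_poly_amplitude by (simp add: mult.commute)
qed

lemma L_ge_2: "L \<ge> 2"
proof -
  have "(\<lambda>n. \<bar>b (Suc n)\<bar> + a (Suc n) + a n) \<longlonglongrightarrow> \<bar>0\<bar> + 1 + 1"
    by (intro tendsto_intros LIMSEQ_Suc a_lim b_lim)
  then show ?thesis by (intro LIMSEQ_le_const2[of _ 2 L]) (use L in auto)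
qed

lemma continuous_amplitude [continuous_intros]: "continuous_on S (amplitude n)"
  unfolding amplitude_def by (intro continuous_intros)

lemma integral_abs_amplitude_le: "(LINT x|\<rho>. \<bar>amplitude (Suc n) x\<bar>) \<le> (L + 2) * (L\<^sup>2 + 1)"
proof -
  let ?p = "\<lambda>x. a (Suc n) * poly (P (Suc n)) x" and ?r = "\<lambda>x. poly (P n) x"
  have "(LINT x|\<rho>. \<bar>amplitude (Suc n) x\<bar>) \<le> (LINT x|\<rho>. (L + 2) * ((?p x)\<^sup>2 + (?r x)\<^sup>2))"
  proof (rule integral_mono_AE)
    show "integrable \<rho> (\<lambda>x. \<bar>amplitude (Suc n) x\<bar>)" "integrable \<rho> (\<lambda>x. (L + 2) * ((?p x)\<^sup>2 + (?r x)\<^sup>2))"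
      by (intro integrable_continuous continuous_intros)+
    show "AE x in \<rho>. \<bar>amplitude (Suc n) x\<bar> \<le> (L + 2) * ((?p x)\<^sup>2 + (?r x)\<^sup>2)"
      using AE_bounded
    proof eventually_elim
      case (elim x)
      have "2 * (\<bar>?p x\<bar> * \<bar>?r x\<bar>) \<le> (?p x)\<^sup>2 + (?r x)\<^sup>2"
        using sum_squares_bound[of "\<bar>?p x\<bar>" "\<bar>?r x\<bar>"] by (simp add: power2_abs mult_ac)
      moreover have "0 \<le> \<bar>?p x\<bar> * \<bar>?r x\<bar>" by simp
      ultimately have 1: "\<bar>?p x * ?r x\<bar> \<le> (?p x)\<^sup>2 + (?r x)\<^sup>2" unfolding abs_mult by linarith
      have "\<bar>x\<bar> * \<bar>?p x * ?r x\<bar> \<le> (L + 1) * ((?p x)\<^sup>2 + (?r x)\<^sup>2)"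
        using elim 1 L_pos by (intro mult_mono) auto
      then have "\<bar>x * ?p x * ?r x\<bar> \<le> (L + 1) * ((?p x)\<^sup>2 + (?r x)\<^sup>2)" by (simp add: abs_mult mult.assoc)
      then have "\<bar>amplitude (Suc n) x\<bar> \<le> (?p x)\<^sup>2 + (L + 1) * ((?p x)\<^sup>2 + (?r x)\<^sup>2) + (?r x)\<^sup>2"
        using zero_le_power2[of "?p x"] zero_le_power2[of "?r x"] unfolding amplitude_def diff_Suc_1 by linarith
      then show ?case by (simp add: algebra_simps)
    qed
  qed
  also have "\<dots> = (L + 2) * ((a (Suc n))\<^sup>2 + 1)"
    using integrable_poly_mult orthonormality[of "Suc n" "Suc n"] orthonormality[of n n]
    by (simp add: power_mult_distrib) (simp add: power2_eq_square integrable_mult_right)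
  also have "\<dots> \<le> (L + 2) * (L\<^sup>2 + 1)"
    using L[of n] L_pos a_nonneg by (intro mult_left_mono add_right_mono power_mono)
      (auto intro: order_trans[OF _ L[of n]])
  finally show ?thesis .
qed

text \<open>Weierstrass approximation transfers the limit from polynomials to continuous functions. The
  amplitude need not be positive on the whole support, so the error is controlled by the uniform
  bound on its \<open>L\<^sup>1\<close> norm.\<close>
lemma amplitude_tendsto_semicircle:
  fixes h :: "real \<Rightarrow> real"
  assumes h: "continuous_on UNIV h"
  shows "(\<lambda>n. LINT x|\<rho>. h x * amplitude (Suc n) x) \<longlonglongrightarrow>
    integral {-2..2} (\<lambda>x. h x * sqrt (4 - x\<^sup>2)) / (2 * pi)"
proof (rule LIMSEQ_I)
  fix r :: real assume r: "r > 0"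
  define B where "B = (L + 2) * (L\<^sup>2 + 1)"
  have B: "B > 0" using L_pos by (simp add: B_def add_pos_pos)
  \<comment> \<open>The approximation error is amplified by at most \<open>B\<close> in the integrals and \<open>8\<close> in the limit.\<close>
  define e where "e = r / (3 * (B + 8))"
  have e: "e > 0" using r B by (simp add: e_def)
  obtain q where q: "\<And>x. x \<in> {-(L + 1)..L + 1} \<Longrightarrow> \<bar>h x - poly q x\<bar> < e"
    using poly_uniform_approximation[OF continuous_on_subset[OF h] e] by blast
  define R where "R = (\<lambda>f. integral {-2..2} (\<lambda>x. f x * sqrt (4 - x\<^sup>2)) / (2 * pi))"
  have 1: "\<bar>(LINT x|\<rho>. h x * amplitude (Suc n) x) - (LINT x|\<rho>. poly q x * amplitude (Suc n) x)\<bar> \<le> e * B" for n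
  proof -
    have i: "integrable \<rho> (\<lambda>x. h x * amplitude (Suc n) x)" "integrable \<rho> (\<lambda>x. poly q x * amplitude (Suc n) x)"
      "integrable \<rho> (\<lambda>x. e * \<bar>amplitude (Suc n) x\<bar>)" "integrable \<rho> (\<lambda>x. \<bar>(h x - poly q x) * amplitude (Suc n) x\<bar>)"
      by (intro integrable_continuous continuous_intros h)+
    have "\<bar>(LINT x|\<rho>. h x * amplitude (Suc n) x) - (LINT x|\<rho>. poly q x * amplitude (Suc n) x)\<bar>
        = \<bar>LINT x|\<rho>. (h x - poly q x) * amplitude (Suc n) x\<bar>"
      using i by (simp add: left_diff_distrib)
    also have "\<dots> \<le> (LINT x|\<rho>. \<bar>(h x - poly q x) * amplitude (Suc n) x\<bar>)" by (rule integral_abs_bound)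
    also have "\<dots> \<le> (LINT x|\<rho>. e * \<bar>amplitude (Suc n) x\<bar>)"
    proof (rule integral_mono_AE[OF i(4) i(3)])
      show "AE x in \<rho>. \<bar>(h x - poly q x) * amplitude (Suc n) x\<bar> \<le> e * \<bar>amplitude (Suc n) x\<bar>"
        using abs_le_AE
      proof eventually_elim
        case (elim x)
        show ?case unfolding abs_mult using q[OF elim] by (intro mult_right_mono) auto
      qed
    qed
    also have "\<dots> \<le> e * B" using integral_abs_amplitude_le[of n] e by (simp add: B_def)
    finally show ?thesis .
  qed
  have 2: "\<bar>R h - R (poly q)\<bar> \<le> e * 8"
  proof -
    have ih: "(\<lambda>x. h x * sqrt (4 - x\<^sup>2)) integrable_on {-2..2}" "(\<lambda>x. poly q x * sqrt (4 - x\<^sup>2)) integrable_on {-2..2}"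
      by (intro integrable_continuous_real continuous_intros continuous_on_subset[OF h]; simp)+
    have "R h - R (poly q) = integral {-2..2} (\<lambda>x. h x * sqrt (4 - x\<^sup>2) - poly q x * sqrt (4 - x\<^sup>2)) / (2 * pi)"
      unfolding R_def using ih by (simp add: integral_diff diff_divide_distrib)
    moreover have "norm (integral {-2..2} (\<lambda>x. h x * sqrt (4 - x\<^sup>2) - poly q x * sqrt (4 - x\<^sup>2))) \<le> (e * 2) * (2 - (-2))"
    proof (rule integral_bound)
      show "continuous_on {-2..2} (\<lambda>x. h x * sqrt (4 - x\<^sup>2) - poly q x * sqrt (4 - x\<^sup>2))"
        by (intro continuous_intros continuous_on_subset[OF h]) simp
      fix x :: real assume x: "x \<in> {-2..2}"
      then have "x \<in> {-(L + 1)..L + 1}" using L_ge_2 by auto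
      from q[OF this] have "\<bar>h x - poly q x\<bar> \<le> e" by simp
      moreover have "sqrt (4 - x\<^sup>2) \<le> sqrt (2\<^sup>2)" by (intro real_sqrt_le_mono) simp
      moreover have "x\<^sup>2 \<le> 4" using x abs_le_square_iff[of x 2] by auto
      ultimately have "\<bar>h x - poly q x\<bar> * \<bar>sqrt (4 - x\<^sup>2)\<bar> \<le> e * 2" by (intro mult_mono) auto
      then show "norm (h x * sqrt (4 - x\<^sup>2) - poly q x * sqrt (4 - x\<^sup>2)) \<le> e * 2"
        by (simp add: left_diff_distrib[symmetric] abs_mult)
    qed simp
    ultimately have "\<bar>R h - R (poly q)\<bar> \<le> ((e * 2) * (2 - (-2))) / (2 * pi)"
      using divide_right_mono[of _ "(e * 2) * (2 - (-2))" "2 * pi"] by (simp only: abs_divide real_norm_def) simp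
    then have "\<bar>R h - R (poly q)\<bar> \<le> e * 8 / (2 * pi)" by simp
    also have "\<dots> \<le> e * 8 / 1" using e pi_ge_two by (intro divide_left_mono) auto
    finally show ?thesis by simp
  qed
  have "(\<lambda>n. LINT x|\<rho>. poly q x * amplitude (Suc n) x) \<longlonglongrightarrow> R (poly q)"
    unfolding R_def by (rule poly_amplitude_tendsto)
  from LIMSEQ_D[OF this, of "r / 3"] r obtain N where
    N: "\<And>n. n \<ge> N \<Longrightarrow> \<bar>(LINT x|\<rho>. poly q x * amplitude (Suc n) x) - R (poly q)\<bar> < r / 3" by auto
  have eB: "e * B + e * 8 = r / 3"
  proof -
    have "e * B + e * 8 = e * (B + 8)" by (simp add: distrib_left)
    also have "\<dots> = r / 3"
    proof -
      have "e * (3 * (B + 8)) = r" unfolding e_def by (rule nonzero_eq_divide_eq[THEN iffD1, OF _ refl]) (use B in simp)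
      then show ?thesis by linarith
    qed
    finally show ?thesis .
  qed
  show "\<exists>N. \<forall>n\<ge>N. norm ((LINT x|\<rho>. h x * amplitude (Suc n) x)
      - integral {-2..2} (\<lambda>x. h x * sqrt (4 - x\<^sup>2)) / (2 * pi)) < r"
  proof (intro exI[of _ N] allI impI)
    fix n assume "N \<le> n"
    from N[OF this] 1[of n] 2 eB r show "norm ((LINT x|\<rho>. h x * amplitude (Suc n) x)
      - integral {-2..2} (\<lambda>x. h x * sqrt (4 - x\<^sup>2)) / (2 * pi)) < r"
      unfolding R_def real_norm_def by linarith
  qed
qed

end

section \<open>From the amplitude to the density\<close>

lemma continuous_on_mult_zero_extension:
  fixes h F :: "real \<Rightarrow> real"
  assumes "continuous_on UNIV h" "compact K" "K \<subseteq> V" "open V" "continuous_on V F"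
    and "\<And>x. x \<notin> K \<Longrightarrow> h x = 0"
  shows "continuous_on UNIV (\<lambda>x. h x * F x)"
proof -
  have "continuous_on (V \<union> - K) (\<lambda>x. h x * F x)"
  proof (rule continuous_on_open_Un)
    show "continuous_on V (\<lambda>x. h x * F x)"
      using assms by (intro continuous_on_mult continuous_on_subset[OF assms(1)]) auto
    have "continuous_on (- K) (\<lambda>x. h x * F x) \<longleftrightarrow> continuous_on (- K) (\<lambda>x. 0 :: real)"
      using assms(6) by (intro continuous_on_cong) auto
    then show "continuous_on (- K) (\<lambda>x. h x * F x)" by simp
  qed (use assms in \<open>auto intro: compact_imp_closed\<close>)
  moreover have "V \<union> - K = UNIV" using assms(3) by blast
  ultimately show ?thesis by simp
qed

text \<open>The truncations of \<open>k * dist (x, - G) - 1\<close> increase to the indicator function of \<open>G\<close>, and each of them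
  vanishes outside a compact subset of \<open>G\<close>.\<close>
lemma indicator_open_approximation:
  fixes G :: "real set"
  assumes G: "open G" "G \<subseteq> {c..d}"
  obtains h :: "nat \<Rightarrow> real \<Rightarrow> real" where
    "\<And>k. continuous_on UNIV (h k)" "\<And>k x. 0 \<le> h k x"
    "\<And>k. \<exists>K. compact K \<and> K \<subseteq> G \<and> (\<forall>x. x \<notin> K \<longrightarrow> h k x = 0)"
    "\<And>x. incseq (\<lambda>k. h k x)" "\<And>x. (SUP k. ennreal (h k x)) = indicator G x"
proof -
  have "d + 1 \<notin> G" using G(2) by auto
  then have ne: "- G \<noteq> {}" by blast
  define h where "h = (\<lambda>(k::nat) x. max 0 (min 1 (real (Suc k) * infdist x (- G) - 1)))"
  define K where "K = (\<lambda>k::nat. {x. 1 / real (Suc k) \<le> infdist x (- G)})"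
  have in_G: "x \<in> G \<longleftrightarrow> infdist x (- G) > 0" for x
  proof -
    have "closed (- G)" using G(1) by (simp add: closed_Compl)
    then have "x \<in> - G \<longleftrightarrow> infdist x (- G) = 0" by (rule in_closed_iff_infdist_zero[OF _ ne])
    then show ?thesis using infdist_nonneg[of x "- G"] by (metis ComplD ComplI less_irrefl order_le_less)
  qed
  show thesis
  proof (rule that[of h])
    fix k :: nat
    show "continuous_on UNIV (h k)" unfolding h_def by (intro continuous_intros)
    show "0 \<le> h k x" for x by (simp add: h_def)
    show "\<exists>K. compact K \<and> K \<subseteq> G \<and> (\<forall>x. x \<notin> K \<longrightarrow> h k x = 0)"
    proof (intro exI[of _ "K k"] conjI allI impI)
      show KG: "K k \<subseteq> G"
      proof
        fix x assume "x \<in> K k"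
        then have "1 / real (Suc k) \<le> infdist x (- G)" by (simp add: K_def)
        moreover have "0 < 1 / real (Suc k)" by simp
        ultimately show "x \<in> G" unfolding in_G by linarith
      qed
      have "closed (K k)" unfolding K_def by (intro closed_Collect_le continuous_intros)
      moreover have "bounded (K k)" using KG G(2) by (intro bounded_subset[OF bounded_closed_interval[of c d]]) auto
      ultimately show "compact (K k)" by (simp add: compact_eq_bounded_closed)
      fix x assume "x \<notin> K k"
      then have "infdist x (- G) < 1 / real (Suc k)" by (simp add: K_def)
      then have "real (Suc k) * infdist x (- G) < 1" by (simp add: field_simps)
      then show "h k x = 0" by (simp add: h_def)
    qed
  next
    fix x
    show "incseq (\<lambda>k. h k x)"
    proof (rule incseq_SucI)
      fix k
      have "real (Suc k) * infdist x (- G) \<le> real (Suc (Suc k)) * infdist x (- G)"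
        using infdist_nonneg[of x "- G"] by (intro mult_right_mono) auto
      then show "h k x \<le> h (Suc k) x" unfolding h_def by linarith
    qed
    show "(SUP k. ennreal (h k x)) = indicator G x"
    proof (cases "x \<in> G")
      case True
      then have "infdist x (- G) > 0" by (simp add: in_G)
      then obtain k where "2 < real k * infdist x (- G)" using reals_Archimedean3[of "infdist x (- G)"] by blast
      moreover have "real k * infdist x (- G) \<le> real (Suc k) * infdist x (- G)"
        using infdist_nonneg[of x "- G"] by (intro mult_right_mono) auto
      ultimately have "h k x = 1" by (simp add: h_def)
      then have "1 \<le> (SUP k. ennreal (h k x))" by (intro SUP_upper2[of k]) auto
      moreover have "(SUP k. ennreal (h k x)) \<le> 1" by (intro SUP_least) (simp add: h_def)
      ultimately show ?thesis using True by simp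
    next
      case False
      then have "infdist x (- G) = 0" using in_G[of x] infdist_nonneg[of x "- G"] by linarith
      then show ?thesis using False by (simp add: h_def)
    qed
  qed
qed

context nevai
begin

text \<open>The two limits of \<open>\<integral> h \<bar>\<psi>\<^sub>n\<bar>\<^sup>2 d\<rho>\<close> agree when \<open>h\<close> is supported in a compact part of \<open>V\<close>: the weak limit is the
  semicircle integral and the uniform limit is \<open>\<integral> h T d\<rho>\<close>. Replacing \<open>h\<close> by \<open>h / T\<close> and
  exhausting open sets identifies \<open>\<rho>\<close> on \<open>V\<close>.\<close>
lemma density_on_open:
  assumes V: "open V" "V \<subseteq> {-2<..<2}"
    and T: "continuous_on V T" "\<And>x. x \<in> V \<Longrightarrow> T x > 0"
    and lim: "\<And>K. compact K \<Longrightarrow> K \<subseteq> V \<Longrightarrow> uniform_limit K (\<lambda>n. amplitude (Suc n)) T sequentially"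
    and g: "\<And>x. g x = (if x \<in> V then sqrt (4 - x\<^sup>2) / (2 * pi * T x) else 0)"
    and B: "B \<in> sets borel"
  shows "emeasure \<rho> (V \<inter> B) = (\<integral>\<^sup>+x. ennreal (g x) * indicator B x \<partial>lborel)"
proof -
  have Tnz: "T x \<noteq> 0" if "x \<in> V" for x using T(2)[OF that] by simp
  have gV: "continuous_on V g"
  proof -
    have "continuous_on V (\<lambda>x. sqrt (4 - x\<^sup>2) / (2 * pi * T x))"
      using T(1) Tnz by (intro continuous_intros) auto
    then show ?thesis by (rule continuous_on_eq) (simp add: g)
  qed
  have g0: "g x \<ge> 0" for x
  proof (cases "x \<in> V")
    case True
    then have "x \<in> {-2<..<2}" using V(2) by blast
    then have "\<bar>x\<bar> < 2" by auto
    then have "x\<^sup>2 \<le> 4" using abs_le_square_iff[of x 2] by auto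
    then show ?thesis using T(2)[OF True] by (simp add: g)
  qed (simp add: g)
  have g_meas [measurable]: "g \<in> borel_measurable borel"
  proof -
    have "(\<lambda>x. if x \<in> V then sqrt (4 - x\<^sup>2) / (2 * pi * T x) else 0) \<in> borel_measurable borel"
      using V T(1) Tnz by (intro borel_measurable_continuous_on_if continuous_intros) auto
    then show ?thesis using g by presburger
  qed
  have test: "(LINT x|\<rho>. h x * T x) = integral {-2..2} (\<lambda>x. h x * sqrt (4 - x\<^sup>2)) / (2 * pi)"
    if h: "continuous_on UNIV h" and K: "compact K" "K \<subseteq> V" "\<And>x. x \<notin> K \<Longrightarrow> h x = 0" for h K
  proof (rule LIMSEQ_unique[OF _ amplitude_tendsto_semicircle[OF h]])
    have hT: "continuous_on UNIV (\<lambda>x. h x * T x)"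
      by (rule continuous_on_mult_zero_extension[OF h K(1,2) V(1) T(1) K(3)])
    obtain H where H: "H \<ge> 0" "\<And>x. x \<in> {-(L + 1)..L + 1} \<Longrightarrow> \<bar>h x\<bar> \<le> H" using continuous_bounded[OF h] by blast
    show "(\<lambda>n. LINT x|\<rho>. h x * amplitude (Suc n) x) \<longlonglongrightarrow> (LINT x|\<rho>. h x * T x)"
    proof (rule LIMSEQ_I)
      fix r :: real assume r: "r > 0"
      define e where "e = r / (2 * (H + 1))"
      have e: "e > 0" using r H by (simp add: e_def)
      obtain N where N: "\<And>n x. n \<ge> N \<Longrightarrow> x \<in> K \<Longrightarrow> dist (amplitude (Suc n) x) (T x) < e"
        using uniform_limitD[OF lim[OF K(1,2)] e] unfolding eventually_sequentially by blast
      show "\<exists>N. \<forall>n\<ge>N. norm ((LINT x|\<rho>. h x * amplitude (Suc n) x) - (LINT x|\<rho>. h x * T x)) < r"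
      proof (intro exI[of _ N] allI impI)
        fix n assume n: "N \<le> n"
        have i: "integrable \<rho> (\<lambda>x. h x * amplitude (Suc n) x)" "integrable \<rho> (\<lambda>x. h x * T x)"
          by (intro integrable_continuous continuous_intros h hT)+
        have "norm ((LINT x|\<rho>. h x * amplitude (Suc n) x) - (LINT x|\<rho>. h x * T x))
            = norm (LINT x|\<rho>. h x * amplitude (Suc n) x - h x * T x)" using i by simp
        also have "\<dots> \<le> (LINT x|\<rho>. norm (h x * amplitude (Suc n) x - h x * T x))"
          by (rule integral_norm_bound)
        also have "\<dots> \<le> (LINT x|\<rho>. H * e)"
        proof (rule integral_mono_AE)
          show "AE x in \<rho>. norm (h x * amplitude (Suc n) x - h x * T x) \<le> H * e"
            using abs_le_AE
          proof eventually_elim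
            case (elim x)
            show ?case
            proof (cases "x \<in> K")
              case True
              have "\<bar>h x\<bar> * \<bar>amplitude (Suc n) x - T x\<bar> \<le> H * e"
                using H elim N[OF n True] by (intro mult_mono) (auto simp: dist_real_def)
              then show ?thesis by (simp add: right_diff_distrib[symmetric] abs_mult)
            qed (use K(3) H e in simp)
          qed
        qed (use i in auto)
        also have "\<dots> = H * e" using prob_space by simp
        also have "\<dots> < r"
        proof -
          have "H * e \<le> (H + 1) * e" using e by (intro mult_right_mono) auto
          also have "\<dots> = e * (2 * (H + 1)) / 2" by simp
          also have "e * (2 * (H + 1)) = r"
            unfolding e_def by (rule nonzero_eq_divide_eq[THEN iffD1, OF _ refl]) (use H in simp)
          finally show ?thesis using r by simp
        qed
        finally show "norm ((LINT x|\<rho>. h x * amplitude (Suc n) x) - (LINT x|\<rho>. h x * T x)) < r" .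
      qed
    qed
  qed
  have nn: "(\<integral>\<^sup>+x. ennreal (h x) \<partial>\<rho>) = (\<integral>\<^sup>+x. ennreal (h x) * ennreal (g x) \<partial>lborel)"
    if h: "continuous_on UNIV h" "\<And>x. 0 \<le> h x" and K: "compact K" "K \<subseteq> V" "\<And>x. x \<notin> K \<Longrightarrow> h x = 0" for h K
  proof -
    have Tn: "continuous_on V (\<lambda>x. 1 / T x)" using T(1) Tnz by (intro continuous_intros) auto
    have h': "continuous_on UNIV (\<lambda>x. h x * (1 / T x))"
      by (rule continuous_on_mult_zero_extension[OF h(1) K(1,2) V(1) Tn K(3)])
    have hg: "continuous_on UNIV (\<lambda>x. h x * g x)"
      by (rule continuous_on_mult_zero_extension[OF h(1) K(1,2) V(1) gV K(3)])
    have inV: "x \<in> V" if "h x \<noteq> 0" for x using K that by blast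
    have "(LINT x|\<rho>. h x) = (LINT x|\<rho>. h x * (1 / T x) * T x)"
    proof (intro Bochner_Integration.integral_cong refl)
      fix x show "h x = h x * (1 / T x) * T x"
        using inV[of x] T(2)[of x] by (cases "h x = 0") auto
    qed
    also have "\<dots> = integral {-2..2} (\<lambda>x. h x * (1 / T x) * sqrt (4 - x\<^sup>2)) / (2 * pi)"
      using K(3) by (intro test[OF h' K(1,2)]) simp
    also have "\<dots> = integral {-2..2} (\<lambda>x. h x * (1 / T x) * sqrt (4 - x\<^sup>2) / (2 * pi))"
      by (rule integral_divide[symmetric])
    also have "\<dots> = integral {-2..2} (\<lambda>x. h x * g x)"
    proof (rule integral_cong)
      fix x show "h x * (1 / T x) * sqrt (4 - x\<^sup>2) / (2 * pi) = h x * g x"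
        using inV[of x] by (cases "h x = 0") (auto simp: g)
    qed
    also have "\<dots> = (LINT x:{-2..2}|lborel. h x * g x)"
      by (intro set_borel_integral_eq_integral(2)[symmetric] borel_integrable_atLeastAtMost' continuous_on_subset[OF hg]) simp
    also have "\<dots> = (LINT x|lborel. h x * g x)" unfolding set_lebesgue_integral_def
      using inV V(2) by (intro Bochner_Integration.integral_cong) (force simp: indicator_def)+
    finally have eq: "(LINT x|\<rho>. h x) = (LINT x|lborel. h x * g x)" .
    have "integrable lborel (\<lambda>x. indicator {-2..2} x *\<^sub>R (h x * g x))"
      unfolding set_integrable_def[symmetric]
      by (intro borel_integrable_atLeastAtMost' continuous_on_subset[OF hg]) simp
    also have "(\<lambda>x. indicator {-2..2} x *\<^sub>R (h x * g x)) = (\<lambda>x. h x * g x)"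
      using inV V(2) by (intro ext) (force simp: indicator_def)
    finally have i: "integrable lborel (\<lambda>x. h x * g x)" .
    have "(\<integral>\<^sup>+x. ennreal (h x) \<partial>\<rho>) = ennreal (LINT x|\<rho>. h x)"
      using h integrable_continuous[OF h(1)] by (intro nn_integral_eq_integral) auto
    also have "\<dots> = (\<integral>\<^sup>+x. ennreal (h x * g x) \<partial>lborel)"
      unfolding eq using h g0 i by (intro nn_integral_eq_integral[symmetric]) auto
    finally show ?thesis using h g0 by (simp add: ennreal_mult)
  qed
  have opens: "emeasure \<rho> G = (\<integral>\<^sup>+x. ennreal (g x) * indicator G x \<partial>lborel)" if G: "open G" "G \<subseteq> V" for G
  proof -
    have "G \<subseteq> {-2..2}" using G V(2) by fastforce
    then obtain h :: "nat \<Rightarrow> real \<Rightarrow> real" where h: "\<And>k. continuous_on UNIV (h k)" "\<And>k x. 0 \<le> h k x"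
      "\<And>k. \<exists>K. compact K \<and> K \<subseteq> G \<and> (\<forall>x. x \<notin> K \<longrightarrow> h k x = 0)"
      "\<And>x. incseq (\<lambda>k. h k x)" "\<And>x. (SUP k. ennreal (h k x)) = indicator G x"
      by (rule indicator_open_approximation[OF G(1)]) (rule that)
    have hm: "h k \<in> borel_measurable borel" for k by (rule borel_measurable_continuous_onI[OF h(1)])
    have eqk: "(\<integral>\<^sup>+x. ennreal (h k x) \<partial>\<rho>) = (\<integral>\<^sup>+x. ennreal (h k x) * ennreal (g x) \<partial>lborel)" for k
    proof -
      obtain K where K: "compact K" "K \<subseteq> G" "\<And>x. x \<notin> K \<Longrightarrow> h k x = 0" using h(3) by blast
      show ?thesis by (rule nn[OF h(1,2) K(1) order_trans[OF K(2) G(2)] K(3)])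
    qed
    have "emeasure \<rho> G = (\<integral>\<^sup>+x. (SUP k. ennreal (h k x)) \<partial>\<rho>)"
      unfolding h(5) using G(1) by simp
    also have "\<dots> = (SUP k. \<integral>\<^sup>+x. ennreal (h k x) \<partial>\<rho>)"
      using h(4) borel_measurable_\<rho>[OF hm]
      by (intro nn_integral_monotone_convergence_SUP) (auto simp: incseq_def le_fun_def intro!: ennreal_leI)
    also have "\<dots> = (SUP k. \<integral>\<^sup>+x. ennreal (h k x) * ennreal (g x) \<partial>lborel)" unfolding eqk ..
    also have "\<dots> = (\<integral>\<^sup>+x. (SUP k. ennreal (h k x) * ennreal (g x)) \<partial>lborel)"
      using h(4) hm
      by (intro nn_integral_monotone_convergence_SUP[symmetric])
        (auto simp: incseq_def le_fun_def intro!: ennreal_leI mult_right_mono)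
    also have "\<dots> = (\<integral>\<^sup>+x. ennreal (g x) * indicator G x \<partial>lborel)"
      by (subst SUP_mult_right_ennreal[symmetric]) (simp add: h(5) mult.commute)
    finally show ?thesis .
  qed
  have gV': "ennreal (g x) * indicator (V \<inter> X) x = ennreal (g x) * indicator X x" for x X
    by (simp add: g indicator_def)
  have VS: "V \<in> sets borel" using V(1) by simp
  have d1: "emeasure (density \<rho> (indicator V)) X = emeasure \<rho> (V \<inter> X)" if "X \<in> sets borel" for X
  proof -
    have "emeasure (density \<rho> (indicator V)) X = (\<integral>\<^sup>+x. indicator V x * indicator X x \<partial>\<rho>)"
      using that VS by (intro emeasure_density) auto
    also have "\<dots> = (\<integral>\<^sup>+x. indicator (V \<inter> X) x \<partial>\<rho>)"
      by (intro nn_integral_cong) (simp add: indicator_def)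
    also have "\<dots> = emeasure \<rho> (V \<inter> X)" using that VS by (intro nn_integral_indicator) auto
    finally show ?thesis .
  qed
  have d2: "emeasure (density lborel (\<lambda>x. ennreal (g x))) X = (\<integral>\<^sup>+x. ennreal (g x) * indicator X x \<partial>lborel)"
    if "X \<in> sets borel" for X
    using that by (intro emeasure_density) auto
  have "density \<rho> (indicator V) = density lborel (\<lambda>x. ennreal (g x))"
  proof (rule measure_eqI_generator_eq[of "{S. open S}" UNIV _ _ "\<lambda>_. UNIV"])
    show "Int_stable {S::real set. open S}" by (auto simp: Int_stable_def)
    fix X :: "real set" assume "X \<in> {S. open S}"
    then have X: "open X" by simp
    have "emeasure \<rho> (V \<inter> X) = (\<integral>\<^sup>+x. ennreal (g x) * indicator (V \<inter> X) x \<partial>lborel)"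
      using X V by (intro opens) auto
    then show "emeasure (density \<rho> (indicator V)) X = emeasure (density lborel (\<lambda>x. ennreal (g x))) X"
      using X by (simp add: d1 d2 gV')
  next
    show "sets (density \<rho> (indicator V)) = sigma_sets UNIV {S. open S}"
      "sets (density lborel (\<lambda>x. ennreal (g x))) = sigma_sets UNIV {S. open S}"
      by (simp_all add: borel_def sets_measure_of)
    show "emeasure (density \<rho> (indicator V)) UNIV \<noteq> \<infinity>" for i :: nat
      by (simp add: d1 emeasure_eq_measure)
  qed auto
  then show ?thesis using d1[OF B] d2[OF B] by simp
qed

end

text \<open>On \<open>V\<close> the measure is absolutely continuous, so it gives no mass to the null set that carries the
  singular part; what remains is the uniqueness of densities.\<close>
lemma lebesgue_decomposition_on_open:
  assumes dec: "lebesgue_decomposition M f Ms" and V: "V \<in> sets borel"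
    and g: "g \<in> borel_measurable borel" "\<And>x. x \<in> V \<Longrightarrow> g x \<ge> 0"
    and eq: "\<And>B. B \<in> sets borel \<Longrightarrow> emeasure M (V \<inter> B) = (\<integral>\<^sup>+x. ennreal (g x) * indicator (V \<inter> B) x \<partial>lborel)"
  shows "emeasure Ms V = 0" "AE x in lborel. x \<in> V \<longrightarrow> f x = g x"
proof -
  obtain N where N: "N \<in> null_sets lborel" "emeasure Ms (UNIV - N) = 0"
    and f: "f \<in> borel_measurable borel" "AE x in lborel. 0 \<le> f x" and sets: "sets Ms = sets borel"
    and sum: "\<And>B. B \<in> sets borel \<Longrightarrow> emeasure M B = emeasure (density lborel (\<lambda>x. ennreal (f x))) B + emeasure Ms B"
    using dec unfolding lebesgue_decomposition_def by blast
  have Nb: "N \<in> sets borel" using N(1) by auto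
  have "emeasure M (V \<inter> N) = 0"
  proof -
    have "AE x in lborel. x \<notin> N" by (rule AE_not_in[OF N(1)])
    then have "AE x in lborel. ennreal (g x) * indicator (V \<inter> N) x = 0" by eventually_elim auto
    then show ?thesis unfolding eq[OF Nb] using g(1) V Nb by (subst nn_integral_0_iff_AE) auto
  qed
  then have 1: "emeasure Ms (V \<inter> N) = 0" using sum[of "V \<inter> N"] V Nb by auto
  have "emeasure Ms V \<le> emeasure Ms (V \<inter> N) + emeasure Ms (UNIV - N)"
    using V Nb sets by (intro order_trans[OF emeasure_mono emeasure_subadditive]) auto
  then show Ms0: "emeasure Ms V = 0" using 1 N(2) by simp
  let ?F = "density lborel (\<lambda>x. ennreal (f x) * indicator V x)"
    and ?G = "density lborel (\<lambda>x. ennreal (g x) * indicator V x)"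
  have "?F = ?G"
  proof (rule measure_eqI)
    fix B assume "B \<in> sets ?F"
    then have B: "B \<in> sets borel" by simp
    have VB: "emeasure Ms (V \<inter> B) = 0"
      using emeasure_mono[of "V \<inter> B" V Ms] Ms0 V B sets by simp
    have ind: "u * indicator V x * indicator B x = u * indicator (V \<inter> B) x" for u :: ennreal and x :: real
      by (simp add: indicator_def)
    have "emeasure ?F B
        = (\<integral>\<^sup>+x. ennreal (f x) * indicator (V \<inter> B) x \<partial>lborel)"
      using f V B by (subst emeasure_density) (auto simp: ind)
    also have "\<dots> = emeasure (density lborel (\<lambda>x. ennreal (f x))) (V \<inter> B)"
      using f V B by (subst emeasure_density) auto
    also have "\<dots> = emeasure M (V \<inter> B)" using sum[of "V \<inter> B"] V B VB by simp
    also have "\<dots> = emeasure ?G B"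
      unfolding eq[OF B] using g V B by (subst emeasure_density) (auto simp: ind)
    finally show "emeasure ?F B
      = emeasure ?G B" .
  qed simp
  then have "AE x in lborel. ennreal (f x) * indicator V x = ennreal (g x) * indicator V x"
    using f g V by (intro sigma_finite_measure.density_unique[OF sigma_finite_lborel]) auto
  with f(2) show "AE x in lborel. x \<in> V \<longrightarrow> f x = g x"
    by eventually_elim (use g(2) in \<open>auto simp: indicator_def\<close>)
qed

text \<open>The limits on the compact subsets are all equal to the pointwise limit, which is therefore locally a
  uniform limit of polynomials.\<close>
lemma (in nevai) amplitude_limit:
  assumes V: "open V" "V \<subseteq> {-2<..<2}"
    and K: "\<And>K. compact K \<Longrightarrow> K \<subseteq> V \<Longrightarrow>
      \<exists>T. uniform_limit K (\<lambda>n. amplitude (Suc n)) T sequentially \<and> (\<forall>x\<in>K. T x > 0)"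
  shows "\<exists>T. continuous_on V T \<and> (\<forall>x\<in>V. T x > 0) \<and>
    (\<forall>K. compact K \<longrightarrow> K \<subseteq> V \<longrightarrow> uniform_limit K (\<lambda>n. amplitude (Suc n)) T sequentially)"
proof -
  define T where "T = (\<lambda>x. lim (\<lambda>n. amplitude (Suc n) x))"
  have T: "uniform_limit K (\<lambda>n. amplitude (Suc n)) T sequentially \<and> (\<forall>x\<in>K. T x > 0)"
    if "compact K" "K \<subseteq> V" for K
  proof -
    obtain T' where T': "uniform_limit K (\<lambda>n. amplitude (Suc n)) T' sequentially" "\<forall>x\<in>K. T' x > 0"
      using K[OF \<open>compact K\<close> \<open>K \<subseteq> V\<close>] by blast
    have eq: "T x = T' x" if "x \<in> K" for x
      unfolding T_def by (rule limI[OF tendsto_uniform_limitI[OF T'(1) that]])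
    have "uniform_limit K (\<lambda>n. amplitude (Suc n)) T sequentially
        \<longleftrightarrow> uniform_limit K (\<lambda>n. amplitude (Suc n)) T' sequentially"
      by (rule uniform_limit_cong') (simp_all add: eq)
    then show ?thesis using T' eq by auto
  qed
  have "isCont T x" if x: "x \<in> V" for x
  proof -
    obtain r where r: "r > 0" "cball x r \<subseteq> V" using V(1) x open_contains_cball by blast
    have "uniform_limit (cball x r) (\<lambda>n. amplitude (Suc n)) T sequentially" using T[of "cball x r"] r(2) by auto
    then have "continuous_on (cball x r) T"
      by (rule uniform_limit_theorem[rotated]) (simp_all add: continuous_amplitude)
    then show ?thesis using r(1) by (intro continuous_on_interior[of "cball x r"]) auto
  qed
  then have "continuous_on V T" using V(1) by (simp add: continuous_on_eq_continuous_at)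
  moreover have "T x > 0" if "x \<in> V" for x using T[of "{x}"] that by auto
  ultimately show ?thesis using T by blast
qed

section \<open>Transfer matrices as oscillating perturbations\<close>

lemma compact_bounded_below:
  fixes f :: "real \<Rightarrow> complex"
  assumes "compact X" "continuous_on X f" "\<And>x. x \<in> X \<Longrightarrow> f x \<noteq> 0"
  shows "\<exists>d>0. \<forall>x\<in>X. d \<le> cmod (f x)"
proof (cases "X = {}")
  case False
  then obtain y where "y \<in> X" "\<forall>x\<in>X. cmod (f y) \<le> cmod (f x)"
    using continuous_attains_inf[OF assms(1) _ continuous_on_norm[OF assms(2)]] by blast
  then show ?thesis using assms(3) by (intro exI[of _ "cmod (f y)"]) auto
qed (auto intro: exI[of _ 1])

text \<open>The inverse of \<open>z \<mapsto> z + 1/z\<close> from \<open>(-2,2)\<close> to the upper unit semicircle.\<close>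
definition joukowsky :: "real \<Rightarrow> complex" where
  "joukowsky x = Complex (x / 2) (sqrt (1 - x\<^sup>2 / 4))"

lemma continuous_joukowsky [continuous_intros]: "continuous_on X joukowsky"
  unfolding joukowsky_def Complex_eq by (intro continuous_intros) auto

lemma square_less_4: "x \<in> {-2<..<2} \<Longrightarrow> x\<^sup>2 < (4::real)"
  using abs_square_less_1[of "x / 2"] by (auto simp: power_divide)

lemma joukowsky_unit:
  assumes "x \<in> {-2<..<2}"
  shows "cmod (joukowsky x) = 1" "Im (joukowsky x) > 0"
    "(Re (joukowsky x))\<^sup>2 + (Im (joukowsky x))\<^sup>2 = 1" "2 * Re (joukowsky x) = x"
  using square_less_4[OF assms] by (auto simp: joukowsky_def cmod_def power_divide)

context nevai
begin

text \<open>Running the recurrence backwards, a common zero of two consecutive polynomials would be a zero of the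
  constant \<open>p\<^sub>0\<close>.\<close>
lemma no_common_zero: "poly (P n) x = 0 \<Longrightarrow> poly (P (Suc n)) x \<noteq> 0"
proof (induction n)
  case 0
  have "poly (P 0) x = coeff (P 0) 0" by (simp add: poly_altdef degree_P)
  then show ?case using 0 lead_coeff_P[of 0] degree_P[of 0] by simp
next
  case (Suc n)
  show ?case
  proof
    assume "poly (P (Suc (Suc n))) x = 0"
    then have "a (Suc n) * poly (P n) x = 0" using recurrence_poly[of x "Suc n"] Suc.prems by simp
    then have "poly (P n) x = 0" using a_pos[of "Suc n"] by simp
    with Suc show False by blast
  qed
qed

text \<open>In the basis of \<open>\<psi>\<^sub>n\<close> and its conjugate the free transfer matrix is the rotation by \<open>z\<close>, and the
  perturbations \<open>A\<close>, \<open>B\<close> are linear in \<open>a\<^sup>2 - 1\<close> and \<open>b\<close>. Their coefficients contain \<open>1 / Im z\<close>, which is bounded on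
  compact subsets of \<open>(-2,2)\<close>.\<close>
lemma amplitude_converges_uniformly:
  assumes U: "finite U" "\<And>u. u \<in> U \<Longrightarrow> cmod u = 1" and p: "p \<ge> 1"
    and \<alpha>: "gbv_unit U (\<lambda>n. complex_of_real ((a (Suc n))\<^sup>2 - 1))"
      "summable (\<lambda>n. cmod (complex_of_real ((a (Suc n))\<^sup>2 - 1)) ^ p)"
    and b: "gbv_unit U (\<lambda>n. complex_of_real (b (Suc n)))"
      "summable (\<lambda>n. cmod (complex_of_real (b (Suc n))) ^ p)"
    and X: "compact X" "X \<subseteq> {-2<..<2}"
    and nonres: "\<And>m v x. m < p \<Longrightarrow> v \<in> U ^ m \<Longrightarrow> x \<in> X \<Longrightarrow> (joukowsky x)\<^sup>2 \<noteq> v"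
  shows "\<exists>T. uniform_limit X (\<lambda>n. amplitude (Suc n)) T sequentially \<and> (\<forall>x\<in>X. T x > 0)"
proof -
  define U' where "U' = {u \<in> U. cnj u \<in> U}"
  have U': "finite U'" "\<And>u. u \<in> U' \<Longrightarrow> cmod u = 1" "\<And>u. u \<in> U' \<Longrightarrow> cnj u \<in> U'"
    using U by (auto simp: U'_def)
  have pow: "U' ^ m \<subseteq> U ^ m" for m
  proof (induction m)
    case (Suc m)
    show ?case unfolding power_Suc by (rule set_times_mono2[OF _ Suc]) (auto simp: U'_def)
  qed simp
  have "\<exists>\<beta>. (\<forall>u\<in>U'. rbv u (\<beta> u) \<and> summable (\<lambda>n. cmod (\<beta> u n) ^ p)) \<and>
      summable (\<lambda>n. cmod (complex_of_real ((a (Suc n))\<^sup>2 - 1) - (\<Sum>u\<in>U'. \<beta> u n)))"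
    unfolding U'_def by (rule symmetric_decomposition[OF U \<alpha> p])
  then obtain \<beta> where \<beta>0: "\<forall>u\<in>U'. rbv u (\<beta> u) \<and> summable (\<lambda>n. cmod (\<beta> u n) ^ p)"
    and \<beta>1: "summable (\<lambda>n. cmod (complex_of_real ((a (Suc n))\<^sup>2 - 1) - (\<Sum>u\<in>U'. \<beta> u n)))"
    by (elim exE conjE) (rule that)
  have \<beta>: "rbv u (\<beta> u)" "summable (\<lambda>n. cmod (\<beta> u n) ^ p)" if "u \<in> U'" for u
    using \<beta>0 that by blast+
  have "\<exists>\<gamma>. (\<forall>u\<in>U'. rbv u (\<gamma> u) \<and> summable (\<lambda>n. cmod (\<gamma> u n) ^ p)) \<and>
      summable (\<lambda>n. cmod (complex_of_real (b (Suc n)) - (\<Sum>u\<in>U'. \<gamma> u n)))"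
    unfolding U'_def by (rule symmetric_decomposition[OF U b p])
  then obtain \<gamma> where \<gamma>0: "\<forall>u\<in>U'. rbv u (\<gamma> u) \<and> summable (\<lambda>n. cmod (\<gamma> u n) ^ p)"
    and \<gamma>1: "summable (\<lambda>n. cmod (complex_of_real (b (Suc n)) - (\<Sum>u\<in>U'. \<gamma> u n)))"
    by (elim exE conjE) (rule that)
  have \<gamma>: "rbv u (\<gamma> u)" "summable (\<lambda>n. cmod (\<gamma> u n) ^ p)" if "u \<in> U'" for u
    using \<gamma>0 that by blast+
  define \<omega> where "\<omega> = (\<lambda>n. \<Sum>u\<in>U'. cmod (\<beta> u n) + cmod (\<gamma> u n))"
  have \<omega>_le: "cmod (\<beta> u n) \<le> \<omega> n" "cmod (\<gamma> u n) \<le> \<omega> n" if "u \<in> U'" for u n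
  proof -
    have "cmod (\<beta> u n) + cmod (\<gamma> u n) \<le> \<omega> n" unfolding \<omega>_def
      by (rule member_le_sum[OF that]) (use U'(1) in auto)
    then show "cmod (\<beta> u n) \<le> \<omega> n" "cmod (\<gamma> u n) \<le> \<omega> n"
      using norm_ge_zero[of "\<beta> u n"] norm_ge_zero[of "\<gamma> u n"] by linarith+
  qed
  have \<omega>0: "\<omega> n \<ge> 0" for n by (simp add: \<omega>_def sum_nonneg)
  have "summable (\<lambda>n. norm (\<Sum>u\<in>U'. cmod (\<beta> u n) + cmod (\<gamma> u n)) ^ p)"
    using \<beta>(2) \<gamma>(2) by (intro summable_power_sum[OF U'(1) _ p] summable_power_add) auto
  moreover have "norm (\<Sum>u\<in>U'. cmod (\<beta> u n) + cmod (\<gamma> u n)) = \<omega> n" for n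
    using \<omega>0[of n] by (simp add: \<omega>_def)
  ultimately have \<omega>p: "summable (\<lambda>n. \<omega> n ^ p)" by simp
  interpret nonresonant X joukowsky U' \<omega> p
  proof
    fix x assume "x \<in> X" then show "cmod (joukowsky x) = 1" using X(2) joukowsky_unit by blast
  next
    fix m v assume mv: "m < p" "v \<in> U' ^ m"
    show "\<exists>d>0. \<forall>x\<in>X. d \<le> cmod (joukowsky x - cnj (joukowsky x) * v)"
    proof (rule compact_bounded_below[OF X(1)])
      show "continuous_on X (\<lambda>x. joukowsky x - cnj (joukowsky x) * v)" by (intro continuous_intros)
      fix x assume x: "x \<in> X"
      show "joukowsky x - cnj (joukowsky x) * v \<noteq> 0"
      proof
        assume "joukowsky x - cnj (joukowsky x) * v = 0"
        then have "joukowsky x * joukowsky x = joukowsky x * cnj (joukowsky x) * v" by simp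
        also have "joukowsky x * cnj (joukowsky x) = 1"
          using joukowsky_unit(1)[of x] X(2) x complex_norm_square[of "joukowsky x"] by auto
        finally show False using nonres[OF mv(1) _ x] mv(2) pow[of m] by (auto simp: power2_eq_square)
      qed
    qed
  qed (use U' \<omega>0 \<omega>p p in auto)
  have osc_coeff: "osc 1 (\<lambda>n x. s n)"
    if "\<And>u. u \<in> U' \<Longrightarrow> rbv u (\<eta> u)" "summable (\<lambda>n. cmod (s n - (\<Sum>u\<in>U'. \<eta> u n)))"
      "\<And>u n. u \<in> U' \<Longrightarrow> cmod (\<eta> u n) \<le> \<omega> n" for s \<eta>
  proof -
    note \<eta> = that
    have "osc 1 (\<lambda>n x. 1 * \<eta> u n)" if u: "u \<in> U'" for u
    proof -
      have "u \<in> U' ^ 1" using u by (simp only: power_one_right)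
      moreover have "cmod (\<eta> u n) \<le> 1 * \<omega> n ^ 1" for n using \<eta>(3)[OF u] by simp
      ultimately show ?thesis using \<eta>(1)[OF u] by (intro osc_term[of 1 1 u "\<eta> u" 1 1]) (simp_all only: order_refl zero_le_one norm_one)
    qed
    then have 1: "osc 1 (\<lambda>n x. \<Sum>u\<in>U'. \<eta> u n)" using U'(1) by (intro osc_sum) auto
    have 2: "usummable (\<lambda>n x. s n - (\<Sum>u\<in>U'. \<eta> u n))" using that(2) by (auto simp: usummable_def)
    show ?thesis using osc_add[OF osc_usummable[OF 2] 1] by simp
  qed
  have o\<alpha>: "osc 1 (\<lambda>n x. complex_of_real ((a (Suc n))\<^sup>2 - 1))"
    by (rule osc_coeff[OF \<beta>(1) \<beta>1 \<omega>_le(1)])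
  have ob: "osc 1 (\<lambda>n x. complex_of_real (b (Suc (Suc n))))"
    using osc_Suc[OF osc_coeff[OF \<gamma>(1) \<gamma>1 \<omega>_le(2)]] by simp
  define c where "c = (\<lambda>x. Re (joukowsky x))"
  define s where "s = (\<lambda>x. Im (joukowsky x))"
  have cs: "s x > 0" "(c x)\<^sup>2 + (s x)\<^sup>2 = 1" "2 * c x = x" if "x \<in> X" for x
    using that X(2) joukowsky_unit unfolding c_def s_def by blast+
  obtain d where d: "d > 0" "\<And>x. x \<in> X \<Longrightarrow> d \<le> s x"
  proof -
    have "\<exists>d>0. \<forall>x\<in>X. d \<le> cmod (complex_of_real (s x))"
    proof (rule compact_bounded_below[OF X(1)])
      show "continuous_on X (\<lambda>x. complex_of_real (s x))" unfolding s_def by (intro continuous_intros)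
      show "complex_of_real (s x) \<noteq> 0" if "x \<in> X" for x using cs(1)[OF that] by simp
    qed
    then obtain d where "d > 0" "\<And>x. x \<in> X \<Longrightarrow> d \<le> \<bar>s x\<bar>" by auto
    moreover have "\<bar>s x\<bar> = s x" if "x \<in> X" for x using cs(1)[OF that] by simp
    ultimately show ?thesis using that by simp
  qed
  define A where "A = (\<lambda>n x. Complex (- 1 / 2) (c x / (2 * s x)) * of_real (b (Suc (Suc n)))
     + Complex 0 (1 / (2 * s x)) * of_real ((a (Suc n))\<^sup>2 - 1))"
  define B where "B = (\<lambda>n x. Complex (- 1 / 2) (- (c x / (2 * s x))) * of_real (b (Suc (Suc n)))
     + Complex 0 (- (1 / (2 * s x))) * of_real ((a (Suc n))\<^sup>2 - 1))"
  have hb: "cmod (Complex u v) \<le> 1 + 1 / (2 * d)" if "\<bar>u\<bar> \<le> 1" "\<bar>v\<bar> \<le> 1 / (2 * s x)" "x \<in> X" for u v x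
  proof -
    have "1 / (2 * s x) \<le> 1 / (2 * d)" using d d(2)[OF that(3)] by (intro divide_left_mono mult_pos_pos) auto
    then show ?thesis using cmod_le[of "Complex u v"] that by simp
  qed
  have cb: "\<bar>c x / (2 * s x)\<bar> \<le> 1 / (2 * s x)" if "x \<in> X" for x
  proof -
    have "(c x)\<^sup>2 \<le> 1" using cs(2)[OF that] zero_le_power2[of "s x"] by linarith
    then have "\<bar>c x\<bar> \<le> 1" by (simp add: abs_square_le_1)
    then show ?thesis using cs(1)[OF that] by (simp add: abs_divide divide_right_mono)
  qed
  have H0: "0 \<le> 1 + 1 / (2 * d)" using d by simp
  have oA: "osc 1 A" unfolding A_def
    using cb cs(1) by (intro osc_add osc_scale[OF ob H0] osc_scale[OF o\<alpha> H0] hb) (auto simp: less_imp_le)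
  have oB: "osc 1 B" unfolding B_def
    using cb cs(1) by (intro osc_add osc_scale[OF ob H0] osc_scale[OF o\<alpha> H0] hb) (auto simp: less_imp_le)
  define \<psi> where "\<psi> = (\<lambda>n x. Complex (a (Suc n) * poly (P (Suc n)) x - c x * poly (P n) x) (s x * poly (P n) x))"
  have amp: "(cmod (\<psi> n x))\<^sup>2 = amplitude (Suc n) x" if "x \<in> X" for n x
  proof -
    let ?p = "a (Suc n) * poly (P (Suc n)) x" and ?r = "poly (P n) x"
    have "(cmod (\<psi> n x))\<^sup>2 = ?p\<^sup>2 - 2 * c x * ?p * ?r + ((c x)\<^sup>2 + (s x)\<^sup>2) * ?r\<^sup>2"
      unfolding cmod_power2 \<psi>_def by (simp add: power2_eq_square algebra_simps)
    then show ?thesis unfolding cs[OF that] amplitude_def by simp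
  qed
  have "\<exists>T. uniform_limit X (\<lambda>n x. (cmod (\<psi> n x))\<^sup>2) T sequentially \<and> (\<forall>x\<in>X. T x > 0)"
  proof (rule amplitude_converges[OF oA oB])
    show "a (Suc n) > 0" for n using a_pos[of "Suc n"] by simp
    show "(\<lambda>n. a (Suc n)) \<longlonglongrightarrow> 1" by (rule LIMSEQ_Suc[OF a_lim])
    fix n x assume x: "x \<in> X"
    let ?p = "poly (P (Suc n)) x" and ?r = "poly (P n) x"
    let ?a = "a (Suc n)" and ?b = "b (Suc (Suc n))"
    have j: "joukowsky x = Complex (c x) (s x)" by (simp add: c_def s_def)
    \<comment> \<open>The recurrence and the determinant are polynomial identities in real and imaginary parts, with \<open>c\<^sup>2 + s\<^sup>2 = 1\<close>.\<close>
    define w where "w = (?b * c x + (?a\<^sup>2 - 1)) / (2 * s x)"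
    have A: "A n x = Complex (- ?b / 2) w" unfolding A_def w_def
      by (simp add: complex_eq_iff add_divide_distrib mult.commute)
    have B: "B n x = Complex (- ?b / 2) (- w)" unfolding B_def w_def
      by (simp add: complex_eq_iff add_divide_distrib diff_divide_distrib mult.commute)
    have sw: "2 * (s x * w) = ?b * c x + (?a\<^sup>2 - 1)" unfolding w_def using cs(1)[OF x] by simp
    have rec: "a (Suc (Suc n)) * poly (P (Suc (Suc n))) x = (2 * c x - ?b) * ?p - ?a * ?r"
      using recurrence_poly[of x "Suc n"] cs(3)[OF x] by (simp add: left_diff_distrib)
    show "of_real ?a * \<psi> (Suc n) x = (joukowsky x + A n x) * \<psi> n x + B n x * cnj (\<psi> n x)"
    proof (rule complex_eqI)
      have "Re ((joukowsky x + A n x) * \<psi> n x + B n x * cnj (\<psi> n x))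
          = (c x - ?b) * (?a * ?p - c x * ?r) - (s x)\<^sup>2 * ?r - 2 * (s x * w) * ?r"
        unfolding j A B \<psi>_def by (simp add: power2_eq_square algebra_simps)
      also have "\<dots> = (c x - ?b) * ?a * ?p - ((c x)\<^sup>2 + (s x)\<^sup>2) * ?r - (?a\<^sup>2 - 1) * ?r"
        unfolding sw by (simp add: power2_eq_square algebra_simps)
      also have "\<dots> = ?a * ((2 * c x - ?b) * ?p - ?a * ?r) - ?a * (c x * ?p)"
        unfolding cs(2)[OF x] by (simp add: power2_eq_square algebra_simps)
      finally show "Re (of_real ?a * \<psi> (Suc n) x) = Re ((joukowsky x + A n x) * \<psi> n x + B n x * cnj (\<psi> n x))"
        by (simp add: \<psi>_def rec right_diff_distrib)
      show "Im (of_real ?a * \<psi> (Suc n) x) = Im ((joukowsky x + A n x) * \<psi> n x + B n x * cnj (\<psi> n x))"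
        unfolding j A B \<psi>_def by (simp add: algebra_simps)
    qed
    show "(cmod (joukowsky x + A n x))\<^sup>2 - (cmod (B n x))\<^sup>2 = ?a\<^sup>2"
    proof -
      have "(cmod (joukowsky x + A n x))\<^sup>2 - (cmod (B n x))\<^sup>2
          = ((c x)\<^sup>2 + (s x)\<^sup>2) - ?b * c x + 2 * (s x * w)"
        unfolding cmod_power2 j A B by (simp add: power2_eq_square algebra_simps)
      then show ?thesis unfolding cs(2)[OF x] sw by simp
    qed
    show "\<psi> n x \<noteq> 0"
    proof
      assume "\<psi> n x = 0"
      then have "s x * ?r = 0" "?a * ?p - c x * ?r = 0" by (simp_all add: \<psi>_def complex_eq_iff)
      then have "?r = 0" "?p = 0" using cs(1)[OF x] a_pos[of "Suc n"] by auto
      then show False using no_common_zero by blast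
    qed
  next
    fix n
    have "continuous_on X (\<psi> n)" unfolding \<psi>_def Complex_eq c_def s_def by (intro continuous_intros)
    then have "bounded (\<psi> n ` X)" using X(1) by (intro compact_imp_bounded compact_continuous_image)
    then show "\<exists>M. \<forall>x\<in>X. cmod (\<psi> n x) \<le> M" unfolding bounded_iff by auto
  qed
  then obtain T where T: "uniform_limit X (\<lambda>n x. (cmod (\<psi> n x))\<^sup>2) T sequentially" "\<forall>x\<in>X. T x > 0" by blast
  have "uniform_limit X (\<lambda>n. amplitude (Suc n)) T sequentially"
    using T(1) amp by (subst uniform_limit_cong'[of _ _ "\<lambda>n x. (cmod (\<psi> n x))\<^sup>2" _ T]) auto
  then show ?thesis using T(2) by blast
qed

end

section \<open>The exceptional set and the singular part\<close>

lemma finite_sumset_power: "finite B \<Longrightarrow> finite (sumset_power k B)"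
  unfolding sumset_power_def by (induction k) (auto intro: finite_set_plus)

lemma finite_exceptional_set:
  assumes "finite B"
  shows "finite (exceptional_set k B)"
proof -
  have "exceptional_set k B \<subseteq> (\<lambda>\<sigma>. 2 * cos (\<sigma> / 2)) ` sumset_power k B \<union> (\<lambda>\<sigma>. - 2 * cos (\<sigma> / 2)) ` sumset_power k B"
  proof
    fix y assume "y \<in> exceptional_set k B"
    then obtain \<sigma> and m :: int where *: "\<sigma> \<in> sumset_power k B" "y = 2 * cos ((\<sigma> + 2 * pi * of_int m) / 2)"
      unfolding exceptional_set_def by blast
    have "(\<sigma> + 2 * pi * of_int m) / 2 = \<sigma> / 2 + pi * of_int m" by (simp add: add_divide_distrib)
    then have "cos ((\<sigma> + 2 * pi * of_int m) / 2) = cos (\<sigma> / 2) * (if even m then 1 else - 1)"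
      by (simp only: cos_add cos_npi_int sin_npi_int mult_zero_right diff_zero)
    then have "y = 2 * cos (\<sigma> / 2) \<or> y = - 2 * cos (\<sigma> / 2)" using *(2) by (simp split: if_splits)
    then show "y \<in> (\<lambda>\<sigma>. 2 * cos (\<sigma> / 2)) ` sumset_power k B \<union> (\<lambda>\<sigma>. - 2 * cos (\<sigma> / 2)) ` sumset_power k B"
      using *(1) by blast
  qed
  then show ?thesis using finite_sumset_power[OF assms] by (meson finite_UnI finite_imageI finite_subset)
qed

lemma sumset_power_mono:
  assumes "0 \<in> B" "m \<le> k"
  shows "sumset_power m B \<subseteq> sumset_power k B"
  using assms(2)
proof (induction k rule: dec_induct)
  case (step k)
  have "sumset_power k B \<subseteq> sumset_power (Suc k) B"
    using set_zero_plus2[OF assms(1), of "sumset_power k B"] by (simp add: sumset_power_def add.commute)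
  then show ?case using step by blast
qed simp

lemma cis_power_sumset: "v \<in> (cis ` B) ^ m \<Longrightarrow> \<exists>\<sigma>\<in>sumset_power m B. v = cis \<sigma>"
proof (induction m arbitrary: v)
  case 0
  then show ?case by (simp add: sumset_power_def)
next
  case (Suc m)
  then obtain \<phi> w where "\<phi> \<in> B" "w \<in> (cis ` B) ^ m" "v = cis \<phi> * w" by (auto simp: set_times_def)
  moreover from Suc.IH[OF this(2)] obtain \<sigma> where "\<sigma> \<in> sumset_power m B" "w = cis \<sigma>" by blast
  ultimately have "v = cis (\<sigma> + \<phi>)" "\<sigma> + \<phi> \<in> sumset_power (Suc m) B"
    by (auto simp: cis_mult add.commute sumset_power_def)
  then show ?case by blast
qed

text \<open>With \<open>x = 2 * cos \<theta>\<close> and \<open>z = cis \<theta>\<close>, a resonance \<open>z\<^sup>2 = cis \<sigma>\<close> means \<open>2 * \<theta> = \<sigma>\<close> modulo \<open>2 * pi\<close>. A sum of \<open>m\<close> phases is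
  also a sum of \<open>p - 1\<close> phases since \<open>0\<close> is one of them.\<close>
lemma nonexceptional_nonresonant:
  assumes B: "0 \<in> B" and x: "x \<in> {-2<..<2}" "x \<notin> exceptional_set (p - 1) B"
    and m: "m < p" "v \<in> (cis ` B) ^ m"
  shows "(joukowsky x)\<^sup>2 \<noteq> v"
proof
  assume eq: "(joukowsky x)\<^sup>2 = v"
  obtain \<sigma> where \<sigma>: "\<sigma> \<in> sumset_power m B" "v = cis \<sigma>" using cis_power_sumset[OF m(2)] by blast
  have \<sigma>p: "\<sigma> \<in> sumset_power (p - 1) B" 
  proof -
    have "m \<le> p - 1" using m(1) by linarith
    then show ?thesis using sumset_power_mono[OF B] \<sigma>(1) by blast
  qed
  define \<theta> where "\<theta> = arccos (x / 2)"
  have c: "cos \<theta> = x / 2" "sin \<theta> = sqrt (1 - (x / 2)\<^sup>2)"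
    unfolding \<theta>_def using x(1) by (auto intro!: cos_arccos sin_arccos)
  have "joukowsky x = cis \<theta>" by (simp add: joukowsky_def complex_eq_iff c power_divide)
  then have "cis (2 * \<theta>) = cis \<sigma>" using eq \<sigma>(2) by (simp add: power2_eq_square cis_mult)
  then obtain n :: int where "\<i> * complex_of_real (2 * \<theta>) = \<i> * complex_of_real \<sigma> + (of_int (2 * n) * pi) * \<i>"
    unfolding cis_conv_exp exp_eq by blast
  then have "complex_of_real (2 * \<theta>) * \<i> = complex_of_real (\<sigma> + 2 * pi * of_int n) * \<i>"
    by (simp add: algebra_simps)
  then have "complex_of_real (2 * \<theta>) = complex_of_real (\<sigma> + 2 * pi * of_int n)" by simp
  then have "2 * \<theta> = \<sigma> + 2 * pi * of_int n" by (simp only: of_real_eq_iff)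
  moreover have "x = 2 * cos (2 * \<theta> / 2)" by (simp add: c)
  ultimately have "x \<in> exceptional_set (p - 1) B" unfolding exceptional_set_def using \<sigma>p by blast
  then show False using x(2) by blast
qed

text \<open>By the Lindelof property countably many of the null neighbourhoods suffice.\<close>
lemma null_of_locally_null:
  assumes "sets M = sets borel" "\<And>x. x \<in> E \<Longrightarrow> \<exists>U. open U \<and> x \<in> U \<and> emeasure M U = 0"
  shows "\<exists>W. open W \<and> E \<subseteq> W \<and> emeasure M (W :: real set) = 0"
proof -
  define F where "F = {U. open U \<and> emeasure M U = 0}"
  obtain F' where F': "F' \<subseteq> F" "countable F'" "\<Union>F' = \<Union>F"
    using Lindelof[of F] by (auto simp: F_def)
  have "\<Union>F' \<in> null_sets M"
  proof -
    have "(\<Union>U\<in>F'. U) \<in> null_sets M"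
      using F'(1) assms(1) by (intro null_sets_UN' F'(2)) (auto simp: F_def null_sets_def)
    then show ?thesis by simp
  qed
  then have "emeasure M (\<Union>F) = 0" unfolding F'(3) by (rule null_setsD1)
  moreover have "open (\<Union>F)" by (auto simp: F_def)
  moreover have "E \<subseteq> \<Union>F" using assms(2) by (auto simp: F_def)
  ultimately show ?thesis by blast
qed

text \<open>A measure that is null near every massless point outside a countable set lives on its
  countably many atoms, together with a countable set of massless points.\<close>
lemma continuous_part_null:
  assumes M: "sets M = sets borel" "finite_measure M"
    and C: "countable C" "\<And>x. x \<notin> C \<Longrightarrow> emeasure M {x} = 0 \<Longrightarrow> \<exists>U. open U \<and> x \<in> U \<and> emeasure M U = 0"
  shows "continuous_part M = null_measure borel"
proof -
  interpret finite_measure M by (rule M(2))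
  define D where "D = {x. emeasure M {x} = 0}"
  have "countable {x. measure M {x} \<noteq> 0}" by (rule countable_support)
  moreover have "{x. measure M {x} \<noteq> 0} = - D" unfolding D_def emeasure_eq_measure by auto
  ultimately have cD: "countable (- D)" by simp
  have "- D \<in> sets borel" using sets.countable[OF _ cD, of borel] by simp
  then have Db: "D \<in> sets borel" using borel_comp[of "- D"] by simp
  have Ds: "D \<in> sets M" using Db M(1) by simp
  have DC: "emeasure M (C \<inter> D) = 0"
  proof -
    have "{x} \<in> null_sets M" if "x \<in> D" for x
      using that M(1) by (intro null_setsI) (simp_all add: D_def)
    then have "(\<Union>x\<in>C \<inter> D. {x}) \<in> null_sets M"
      using C(1) by (intro null_sets_UN' countable_Int1) simp_all
    moreover have "(\<Union>x\<in>C \<inter> D. {x}) = C \<inter> D" by blast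
    ultimately have "C \<inter> D \<in> null_sets M" by (simp only:)
    then show ?thesis by (rule null_setsD1)
  qed
  obtain W where W: "open W" "D - C \<subseteq> W" "emeasure M W = 0"
    
  proof -
    have "\<exists>U. open U \<and> x \<in> U \<and> emeasure M U = 0" if "x \<in> D - C" for x
      using that C(2)[of x] by (simp add: D_def)
    from null_of_locally_null[OF M(1) this] show ?thesis using that by blast
  qed
  have CDb: "C \<inter> D \<in> sets M"
    using M(1) by (intro sets.countable[OF _ countable_Int1[OF C(1)]]) simp
  have Wb: "W \<in> sets M" using W(1) M(1) by simp
  have "D \<subseteq> (C \<inter> D) \<union> W" using W(2) by blast
  then have "emeasure M D \<le> emeasure M ((C \<inter> D) \<union> W)" using CDb Wb by (intro emeasure_mono) simp_all
  also have "\<dots> \<le> emeasure M (C \<inter> D) + emeasure M W" by (rule emeasure_subadditive[OF CDb Wb])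
  finally have "emeasure M D \<le> emeasure M (C \<inter> D) + emeasure M W" .
  then have D0: "emeasure M D = 0" using DC W(3) by simp
  show ?thesis
  proof (rule measure_eqI)
    show "sets (continuous_part M) = sets (null_measure borel)" by (simp add: continuous_part_def M(1))
    fix B assume "B \<in> sets (continuous_part M)"
    then have B: "B \<in> sets M" by (simp add: continuous_part_def)
    have "emeasure (continuous_part M) B = (\<integral>\<^sup>+x. indicator D x * indicator B x \<partial>M)"
      unfolding continuous_part_def D_def[symmetric] by (rule emeasure_density[OF borel_measurable_indicator[OF Ds] B])
    also have "\<dots> = (\<integral>\<^sup>+x. indicator (D \<inter> B) x \<partial>M)" by (intro nn_integral_cong) (simp add: indicator_def)
    also have "\<dots> = emeasure M (D \<inter> B)" using B Ds by (intro nn_integral_indicator sets.Int)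
    also have "\<dots> \<le> emeasure M D" using Ds by (intro emeasure_mono) simp_all
    finally show "emeasure (continuous_part M) B = emeasure (null_measure borel) B" using D0 by simp
  qed
qed

theorem theorem1p2:
  fixes \<rho> \<rho>s :: "real measure" and f :: "real \<Rightarrow> real"
    and a b :: "nat \<Rightarrow> real" and p :: nat and A At S :: "real set"
  assumes "prob_space \<rho>" and "sets \<rho> = sets borel"
    and "infinite (measure_support \<rho>)"
    and "\<forall>k::nat. integrable \<rho> (\<lambda>x. x ^ k)"
    and "lebesgue_decomposition \<rho> f \<rho>s"
    and "jacobi_coefficients \<rho> a b"
    and "p \<ge> 1" and "finite A"
    and "((\<lambda>n. complex_of_real ((a n)\<^sup>2 - 1)) \<in> lp_seq 1 p \<inter> GBV 1 A \<and>
          (\<lambda>n. complex_of_real (b n)) \<in> lp_seq 1 p \<inter> GBV 1 A \<and>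
          At = A \<union> {0}) \<or>
         ((\<lambda>n. complex_of_real (a n - 1)) \<in> lp_seq 1 p \<inter> GBV 1 A \<and>
          (\<lambda>n. complex_of_real (b n)) \<in> lp_seq 1 p \<inter> GBV 1 A \<and>
          At = (A + A) \<union> A \<union> {0})"
    and "S = exceptional_set (p - 1) At"
  shows "measure_support \<rho>s \<inter> {-2<..<2} \<subseteq> S \<and>
         continuous_part \<rho>s = null_measure borel \<and>
         (\<exists>g. (AE x in lborel. f x = g x) \<and>
              continuous_on ({-2<..<2} - S) g \<and>
              (\<forall>x \<in> {-2<..<2} - S. g x > 0))"
proof -
  obtain P where a_pos: "\<And>n. n \<ge> 1 \<Longrightarrow> a n > 0" and P: "orthonormal_polynomials \<rho> P"
    and rec: "\<And>n. [:0, 1:] * P n = smult (a (n + 1)) (P (n + 1)) + smult (b (n + 1)) (P n) +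
           (if n = 0 then 0 else smult (a n) (P (n - 1)))"
    using assms(6) unfolding jacobi_coefficients_def by blast
  have "\<forall>n\<ge>1. a n > 0" using a_pos by blast
  note red = coefficients_reduction[OF \<open>finite A\<close> \<open>p \<ge> 1\<close> this assms(9)]
  \<comment> \<open>The coefficients start at index 1; the value \<open>0\<close> at index 0 makes the recurrence uniform in \<open>n\<close>.\<close>
  define a' where "a' = a(0 := 0)"
  have a': "a' (Suc n) = a (Suc n)" for n by (simp add: a'_def)
  have a'_lim: "a' \<longlonglongrightarrow> 1"
    using LIMSEQ_Suc[OF red(3)] unfolding a'[symmetric] by (rule LIMSEQ_imp_Suc)
  have "(\<lambda>n. \<bar>b (Suc n)\<bar> + a' (Suc n) + a' n) \<longlonglongrightarrow> \<bar>0\<bar> + 1 + 1"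
    by (intro tendsto_intros LIMSEQ_Suc a'_lim red(4))
  then have "convergent (\<lambda>n. \<bar>b (Suc n)\<bar> + a' (Suc n) + a' n)" by (rule convergentI)
  then have "Bseq (\<lambda>n. \<bar>b (Suc n)\<bar> + a' (Suc n) + a' n)" by (rule convergent_imp_Bseq)
  then obtain L where L: "\<And>n. norm (\<bar>b (Suc n)\<bar> + a' (Suc n) + a' n) \<le> L" unfolding Bseq_def by blast
  interpret prob_space \<rho> by (rule assms(1))
  interpret nevai \<rho> P a' b L
  proof
    show "sets \<rho> = sets borel" "orthonormal_polynomials \<rho> P" "a' \<longlonglongrightarrow> 1" "b \<longlonglongrightarrow> 0"
      by (fact assms(2) P a'_lim red(4))+
    show "integrable \<rho> (\<lambda>x. x ^ k)" for k using assms(4) by blast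
    show "a' 0 = 0" by (simp add: a'_def)
    show "0 < a' n" if "1 \<le> n" for n using a_pos[OF that] that by (simp add: a'_def)
    show "[:0, 1:] * P n = smult (a' (Suc n)) (P (Suc n)) + smult (b (Suc n)) (P n) + smult (a' n) (P (n - 1))" for n
      using rec[of n] by (simp add: a'_def)
    show "\<bar>b (Suc n)\<bar> + a' (Suc n) + a' n \<le> L" for n using L[of n] by simp
  qed
  have finS: "finite S" unfolding assms(10) by (rule finite_exceptional_set[OF red(1)])
  define V where "V = {-2<..<2} - S"
  have V: "open V" "V \<subseteq> {-2<..<2}" unfolding V_def using finS by (auto intro!: open_Diff finite_imp_closed)
  have "\<exists>T. uniform_limit K (\<lambda>n. amplitude (Suc n)) T sequentially \<and> (\<forall>x\<in>K. T x > 0)"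
    if K: "compact K" "K \<subseteq> V" for K
  proof (rule amplitude_converges_uniformly[of "cis ` At" p])
    fix m v x assume "m < p" "v \<in> (cis ` At) ^ m" "x \<in> K"
    then show "(joukowsky x)\<^sup>2 \<noteq> v"
      using K(2) by (intro nonexceptional_nonresonant[OF red(2)]) (auto simp: V_def assms(10))
  qed (use red K V assms(7) in \<open>auto simp: a'\<close>)
  from amplitude_limit[OF V this] obtain T where T: "continuous_on V T" "\<And>x. x \<in> V \<Longrightarrow> T x > 0"
    "\<And>K. compact K \<Longrightarrow> K \<subseteq> V \<Longrightarrow> uniform_limit K (\<lambda>n. amplitude (Suc n)) T sequentially" by blast
  define w where "w = (\<lambda>x. sqrt (4 - x\<^sup>2) / (2 * pi * T x))"
  have w_pos: "w x > 0" if "x \<in> V" for x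
    using T(2)[OF that] square_less_4[of x] that V(2) by (auto simp: w_def)
  have w_cont: "continuous_on V w" unfolding w_def using T(1,2) by (intro continuous_intros) fastforce+
  have Vb: "V \<in> sets borel" using V(1) by simp
  define g where "g = (\<lambda>x. if x \<in> V then w x else 0)"
  have g_meas: "g \<in> borel_measurable borel"
    unfolding g_def using Vb w_cont by (intro borel_measurable_continuous_on_if) auto
  have dens: "emeasure \<rho> (V \<inter> B) = (\<integral>\<^sup>+x. ennreal (g x) * indicator (V \<inter> B) x \<partial>lborel)" if "B \<in> sets borel" for B
  proof -
    have "emeasure \<rho> (V \<inter> B) = (\<integral>\<^sup>+x. ennreal (g x) * indicator B x \<partial>lborel)"
      by (rule density_on_open[OF V T _ that]) (simp_all add: g_def w_def)
    also have "\<dots> = (\<integral>\<^sup>+x. ennreal (g x) * indicator (V \<inter> B) x \<partial>lborel)"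
      by (intro nn_integral_cong) (simp add: g_def indicator_def)
    finally show ?thesis .
  qed
  have g_nonneg: "g x \<ge> 0" if "x \<in> V" for x using w_pos[OF that] that by (simp add: g_def)
  have parts: "emeasure \<rho>s V = 0" "AE x in lborel. x \<in> V \<longrightarrow> f x = g x"
    by (rule lebesgue_decomposition_on_open[OF assms(5) Vb g_meas g_nonneg dens]; assumption)+
  have sets_s: "sets \<rho>s = sets borel"
    and sum: "\<And>B. B \<in> sets borel \<Longrightarrow>
      emeasure \<rho> B = emeasure (density lborel (\<lambda>x. ennreal (f x))) B + emeasure \<rho>s B"
    and f_meas: "f \<in> borel_measurable borel"
    using assms(5) unfolding lebesgue_decomposition_def by blast+
  have "measure_support \<rho>s \<inter> {-2<..<2} \<subseteq> S"
  proof
    fix x assume x: "x \<in> measure_support \<rho>s \<inter> {-2<..<2}"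
    show "x \<in> S"
    proof (rule ccontr)
      assume "x \<notin> S"
      then have "x \<in> V" using x by (simp add: V_def)
      then show False using x V(1) parts(1) by (auto simp: measure_support_def)
    qed
  qed
  moreover have "continuous_part \<rho>s = null_measure borel"
  proof (rule continuous_part_null[OF sets_s])
    have "emeasure \<rho>s UNIV \<le> emeasure \<rho> UNIV" using sum[of UNIV] by (simp add: add_increasing)
    then show "finite_measure \<rho>s"
      using sets_eq_imp_space_eq[OF sets_s] by (intro finite_measureI) (auto simp: emeasure_eq_measure top_unique)
    show "countable (S \<union> {-2, 2})" using finS by (simp add: countable_finite)
    fix x assume x: "x \<notin> S \<union> {-2, 2}" "emeasure \<rho>s {x} = 0"
    show "\<exists>U. open U \<and> x \<in> U \<and> emeasure \<rho>s U = 0"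
    proof (cases "\<bar>x\<bar> < 2")
      case True
      then have "x \<in> V" using x(1) by (auto simp: V_def)
      then show ?thesis using V(1) parts(1) by blast
    next
      case False
      then have x2: "\<bar>x\<bar> > 2" using x(1) by auto
      have "{x} \<in> null_sets lborel" by (intro null_setsI) simp_all
      then have "AE y in lborel. y \<notin> {x}" by (rule AE_not_in)
      then have "AE y in lborel. ennreal (f y) * indicator {x} y = 0" by eventually_elim simp
      then have "emeasure (density lborel (\<lambda>x. ennreal (f x))) {x} = 0"
        using f_meas by (subst emeasure_density) (auto simp: nn_integral_0_iff_AE)
      then have "measure \<rho> {x} = 0" using sum[of "{x}"] x(2) by (simp add: measure_def)
      from no_continuous_mass_outside[OF x2 this] obtain \<delta> where "\<delta> > 0" "emeasure \<rho> (ball x \<delta>) = 0" by blast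
      then show ?thesis using sum[of "ball x \<delta>"] by (intro exI[of _ "ball x \<delta>"]) auto
    qed
  qed
  moreover have "\<exists>g. (AE x in lborel. f x = g x) \<and> continuous_on V g \<and> (\<forall>x\<in>V. g x > 0)"
  proof (intro exI[of _ "\<lambda>x. if x \<in> V then w x else f x"] conjI ballI)
    show "AE x in lborel. f x = (if x \<in> V then w x else f x)"
      using parts(2) by eventually_elim (auto simp: g_def)
    show "continuous_on V (\<lambda>x. if x \<in> V then w x else f x)"
      using w_cont by (rule continuous_on_eq) simp
  qed (use w_pos in simp)
  ultimately show ?thesis unfolding V_def by blast
qed

end
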